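(* Let $S\subset\mathbb H$ be a minimal cone of class $C^2$. Then $S$ is a vertical plane, or the horizontal plane $\{t=0\}$, or the image under a rotation about the $t$-axis of the graph of the function $t=-xy$.
   Context: Heisenberg group: $\mathbb H=\mathbb R^3$ with product $(x,y,t)*(x',y',t')=(x+x',y+y',t+t'+(x'y-xy'))$ and dilations $\delta_\lambda(x,y,t)=(\lambda x,\lambda y,\lambda^2t)$, $\lambda>0$. Left-invariant fields: $X=\partial_x+y\,\partial_t$, $Y=\partial_y-x\,\partial_t$. A horizontal vector field is $V=v_1X+v_2Y$, with $|V|=(v_1^2+v_2^2)^{1/2}$ and $\operatorname{div}V=Xv_1+Yv_2$. A vertical plane is an affine plane of $\mathbb R^3$ parallel to the $t$-axis. A cone is a set invariant under all $\delta_\lambda$, $\lambda>0$. Perimeter: for $E\subset\mathbb H$ measurable and $\Omega\subset\mathbb H$ open, $P(E;\Omega)=\sup\{\int_E\operatorname{div}(V)\,d\mathcal L^3: V \text{ a } C^1 \text{ horizontal vector field with compact support in }\Omega,\ |V|\le1\}$. $E$ has locally finite perimeter if $P(E;\Omega)<\infty$ for every bounded open $\Omega$; then $|\partial E|$ denotes the Radon measure with $|\partial E|(\Omega)=P(E;\Omega)$ for open $\Omega$. $E$ is a perimeter minimizer in $\Omega$ if $P(E;\Omega)\le P(F;\Omega)$ for every $F$ of locally finite perimeter whose symmetric difference with $E$ is relatively compact in $\Omega$; it is a local perimeter minimizer if this holds in every bounded open set $\Omega$. A (non-empty) surface $S\subset\mathbb H$ is minimal if there is a local perimeter minimizer $E$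 of locally finite perimeter such that $S$ is the closure of the reduced boundary of $E$, i.e. $S$ is the support of $|\partial E|$. A minimal cone is a minimal surface that is a cone. A surface is of class $C^k$ if it is an embedded two-dimensional $C^k$ submanifold of $\mathbb R^3$. *)

theory Defs
  imports "HOL-Analysis.Analysis"
begin

text \<open>Points \<open>(x, y, t)\<close> of the Heisenberg group. The product type carries the Euclidean
  topology and metric of three-space, and \<open>lebesgue\<close> on it is three-dimensional Lebesgue measure.\<close>

type_synonym heis = "real \<times> real \<times> real"

fun dil :: "real \<Rightarrow> heis \<Rightarrow> heis" where
  "dil l (x, y, t) = (l * x, l * y, l\<^sup>2 * t)"

definition is_cone :: "heis set \<Rightarrow> bool" where
  "is_cone S \<longleftrightarrow> (\<forall>l>0. dil l ` S = S)"

text \<open>The left-invariant fields \<open>X = \<partial>\<^sub>x + y \<partial>\<^sub>t\<close> and \<open>Y = \<partial>\<^sub>y - x \<partial>\<^sub>t\<close> as coefficient vectors.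
  They are left-invariant for the group law
  \<open>(x,y,t) * (x',y',t') = (x + x', y + y', t + t' + (x' y - x y'))\<close>.\<close>

fun X_field :: "heis \<Rightarrow> heis" where
  "X_field (x, y, t) = (1, 0, y)"

fun Y_field :: "heis \<Rightarrow> heis" where
  "Y_field (x, y, t) = (0, 1, - x)"

text \<open>The action of a vector field on a (differentiable) function.\<close>

definition field_deriv :: "(heis \<Rightarrow> heis) \<Rightarrow> (heis \<Rightarrow> real) \<Rightarrow> heis \<Rightarrow> real" where
  "field_deriv Z f p = frechet_derivative f (at p) (Z p)"

text \<open>The horizontal field \<open>v\<^sub>1 X + v\<^sub>2 Y\<close> is given by its coefficients \<open>V p = (v\<^sub>1 p, v\<^sub>2 p)\<close>;
  the norm of the pair \<open>V p\<close> is then the horizontal length.\<close>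

definition hdiv :: "(heis \<Rightarrow> real \<times> real) \<Rightarrow> heis \<Rightarrow> real" where
  "hdiv V p = field_deriv X_field (\<lambda>q. fst (V q)) p + field_deriv Y_field (\<lambda>q. snd (V q)) p"

text \<open>Class \<open>C\<^sup>k\<close> on an open set \<open>U\<close>. In finite dimension, continuity of all iterated directional
  derivatives is the same as continuity of the iterated Frechet derivatives.\<close>

primrec Ck_on :: "nat \<Rightarrow> 'a::euclidean_space set \<Rightarrow> ('a \<Rightarrow> 'b::euclidean_space) \<Rightarrow> bool" where
  "Ck_on 0 U f \<longleftrightarrow> continuous_on U f"
| "Ck_on (Suc k) U f \<longleftrightarrow> (\<forall>p\<in>U. f differentiable (at p)) \<and>
     (\<forall>v. Ck_on k U (\<lambda>p. frechet_derivative f (at p) v))"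

text \<open>Fields are defined on the whole space; a \<open>C\<^sup>1\<close> field with compact support in an open
  set \<open>\<Omega>\<close> is identified with its extension by zero.\<close>

definition test_fields :: "heis set \<Rightarrow> (heis \<Rightarrow> real \<times> real) set" where
  "test_fields \<Omega> = {V. Ck_on 1 UNIV V \<and>
     compact (closure {p. V p \<noteq> 0}) \<and> closure {p. V p \<noteq> 0} \<subseteq> \<Omega> \<and> (\<forall>p. norm (V p) \<le> 1)}"

definition perimeter :: "heis set \<Rightarrow> heis set \<Rightarrow> ereal" where
  "perimeter E \<Omega> = (SUP V\<in>test_fields \<Omega>. ereal (LINT p:E|lebesgue. hdiv V p))"

definition loc_finite_perimeter :: "heis set \<Rightarrow> bool" where
  "loc_finite_perimeter E \<longleftrightarrow> E \<in> sets lebesgue \<and>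
     (\<forall>\<Omega>. open \<Omega> \<and> bounded \<Omega> \<longrightarrow> perimeter E \<Omega> < \<infinity>)"

text \<open>The Radon measure \<open>|\<partial>E|\<close>. It is uniquely determined by these conditions: Borel measures on
  Euclidean space that are finite on compact sets are automatically regular.\<close>

definition is_perimeter_measure :: "heis set \<Rightarrow> heis measure \<Rightarrow> bool" where
  "is_perimeter_measure E \<mu> \<longleftrightarrow> sets \<mu> = sets borel \<and>
     (\<forall>K. compact K \<longrightarrow> emeasure \<mu> K < \<infinity>) \<and>
     (\<forall>\<Omega>. open \<Omega> \<longrightarrow> enn2ereal (emeasure \<mu> \<Omega>) = perimeter E \<Omega>)"

definition measure_support :: "'a::topological_space measure \<Rightarrow> 'a set" where
  "measure_support \<mu> = {p. \<forall>U. open U \<and> p \<in> U \<longrightarrow> emeasure \<mu> U > 0}"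

definition perimeter_minimizer_in :: "heis set \<Rightarrow> heis set \<Rightarrow> bool" where
  "perimeter_minimizer_in \<Omega> E \<longleftrightarrow>
     (\<forall>F. loc_finite_perimeter F \<and> compact (closure (sym_diff E F)) \<and> closure (sym_diff E F) \<subseteq> \<Omega>
        \<longrightarrow> perimeter E \<Omega> \<le> perimeter F \<Omega>)"

definition local_perimeter_minimizer :: "heis set \<Rightarrow> bool" where
  "local_perimeter_minimizer E \<longleftrightarrow>
     (\<forall>\<Omega>. open \<Omega> \<and> bounded \<Omega> \<longrightarrow> perimeter_minimizer_in \<Omega> E)"

definition minimal_surface :: "heis set \<Rightarrow> bool" where
  "minimal_surface S \<longleftrightarrow> S \<noteq> {} \<and>
     (\<exists>E \<mu>. loc_finite_perimeter E \<and> local_perimeter_minimizer E \<and>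
        is_perimeter_measure E \<mu> \<and> S = measure_support \<mu>)"

definition minimal_cone :: "heis set \<Rightarrow> bool" where
  "minimal_cone S \<longleftrightarrow> minimal_surface S \<and> is_cone S"

text \<open>Embedded two-dimensional \<open>C\<^sup>k\<close> submanifolds, via slice charts: locally \<open>S\<close> is carried to the
  plane \<open>c = 0\<close> by a \<open>C\<^sup>k\<close> diffeomorphism \<open>\<phi>\<close> (with inverse \<open>\<psi>\<close>) between open sets.\<close>

definition Ck_surface :: "nat \<Rightarrow> heis set \<Rightarrow> bool" where
  "Ck_surface k S \<longleftrightarrow>
     (\<forall>p\<in>S. \<exists>U W (\<phi> :: heis \<Rightarrow> heis) (\<psi> :: heis \<Rightarrow> heis).
        open U \<and> p \<in> U \<and> open W \<and> homeomorphism U W \<phi> \<psi> \<and> Ck_on k U \<phi> \<and> Ck_on k W \<psi> \<and>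
        \<phi> ` (S \<inter> U) = W \<inter> {(a, b, c). c = 0})"

definition vertical_plane :: "heis set \<Rightarrow> bool" where
  "vertical_plane S \<longleftrightarrow> affine S \<and> aff_dim S = 2 \<and> (\<forall>p\<in>S. \<forall>s. p + (0, 0, s) \<in> S)"

fun rot :: "real \<Rightarrow> heis \<Rightarrow> heis" where
  "rot \<theta> (x, y, t) = (cos \<theta> * x - sin \<theta> * y, sin \<theta> * x + cos \<theta> * y, t)"

end

theory Submission
  imports Defs
begin

text \<open>Let \<open>F\<close> be a \<open>C\<^sup>2\<close> defining function of \<open>S\<close> at the origin. Differentiating
  \<open>F (l x, l y, l\<^sup>2 t) = 0\<close> at \<open>l = 0\<close> shows that \<open>S\<close> lies in a vertical plane if the
  horizontal part of \<open>dF\<close> does not vanish there, and otherwise, by a second differentiation, in the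
  graph of a quadratic form; invariance of domain and dilations turn the inclusion into equality.

  Let \<open>S\<close> be the graph of a quadratic form \<open>q\<close>. Off \<open>S\<close> the perimeter vanishes, so there the
  indicator of \<open>E\<close> is weakly constant along \<open>X\<close> and \<open>Y\<close>, hence along their commutator, and \<open>E\<close>
  is, up to complement, the subgraph of \<open>q\<close>. The perimeter of a subgraph is the integral of \<open>\<bar>G\<bar>\<close>,
  where \<open>G = (y - q\<^sub>x, - x - q\<^sub>y)\<close> is linear in \<open>(x, y)\<close>. Comparison with \<open>q + s \<phi>\<close> gives
  \<open>\<integral> (G \<bullet> \<nabla>\<phi>) / \<bar>G\<bar> = 0\<close> for all \<open>\<phi>\<close>. If \<open>G\<close> is invertible, then
  the pointwise equation \<open>div (G / \<bar>G\<bar>) = 0\<close> at three points forces \<open>q = 0\<close>. If \<open>G\<close> has rank one,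
  then \<open>G / \<bar>G\<bar>\<close> jumps across the characteristic line \<open>G = 0\<close>, and the equation says that its jump is
  tangent to this line, that is, the trace of \<open>G\<close> vanishes; this is the rotated saddle.\<close>

section \<open>Cones with a tangent plane at the origin\<close>

text \<open>Quadratic forms appear because t has weight two under the dilations: a cone tangent to t
  = 0 at the origin is governed by the second-order jet of F, which is what class C^2 supplies. The
  matrix of G is minus the Hessian of q plus a fixed quarter turn, the footprint of the
  non-integrability of the horizontal planes. It is therefore never zero, and the characteristic set
  is at most a line, hence null. Two obstacles shape the rest. The horizontal normal is not
  continuous at characteristic points, so it cannot be a test field; the lower bound for the
  perimeter passes through regularizations and is proved for linear G, while Cauchy-Schwarz gives
  the upper bound for every C^1 competitor. In the rank-one case G / |G| is constant on either side
  of the characteristic line, so the pointwise equation is void there, and only the weak equation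
  tested across the line carries information. Moreover E is known only up to null sets: integrals
  use a Borel representative, and competitors change E only inside a compact box.\<close>

lemma origin_in_closed_cone:
  assumes "closed S" "is_cone S" "S \<noteq> {}"
  shows "(0, 0, 0) \<in> S"
proof -
  obtain x y t where p: "(x, y, t) \<in> S"
    using assms(3) by (metis all_not_in_conv prod_cases3)
  have "dil (1 / real (Suc n)) (x, y, t) \<in> S" for n
    using assms(2) p unfolding is_cone_def
    by (metis divide_pos_pos image_eqI of_nat_0_less_iff zero_less_Suc zero_less_one)
  moreover have "(\<lambda>n. dil (1 / real (Suc n)) (x, y, t)) \<longlonglongrightarrow> (0 * x, 0 * y, 0\<^sup>2 * t)"
    unfolding dil.simps by (intro tendsto_intros LIMSEQ_Suc[OF lim_1_over_n])
  ultimately show ?thesis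
    using closed_sequentially[OF assms(1)] by fastforce
qed

lemma cone_dil_mem:
  assumes "is_cone S" "l > 0"
  shows "dil l p \<in> S \<longleftrightarrow> p \<in> S"
proof
  assume "dil l p \<in> S"
  then have "dil (1 / l) (dil l p) \<in> S"
    using assms unfolding is_cone_def by (metis divide_pos_pos image_eqI zero_less_one)
  moreover have "dil (1 / l) (dil l p) = p"
    using assms(2) by (cases p) (auto simp: power2_eq_square)
  ultimately show "p \<in> S" by simp
next
  assume "p \<in> S"
  then show "dil l p \<in> S"
    using assms unfolding is_cone_def by (metis image_eqI)
qed

lemma eventually_dil_in_open:
  assumes "open U" "(0, 0, 0) \<in> U"
  shows "eventually (\<lambda>l. dil l p \<in> U) (at 0)"
proof -
  obtain x y t where p: "p = (x, y, t)" by (cases p)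
  have "((\<lambda>l. dil l p) \<longlongrightarrow> (0 * x, 0 * y, 0\<^sup>2 * t)) (at 0)"
    unfolding dil.simps p by (intro tendsto_intros)
  then show ?thesis
    using assms by (intro topological_tendstoD) auto
qed

text \<open>Dilations contract every point to the origin and preserve a cone, so what holds near the
  origin spreads to the whole cone.\<close>

lemma exists_dil_in_open:
  assumes "open U" "(0, 0, 0) \<in> U"
  obtains l where "l > 0" "dil l p \<in> U"
proof -
  have "eventually (\<lambda>l. l > 0 \<and> dil l p \<in> U) (at_right 0)"
    using eventually_dil_in_open[OF assms, of p]
    by (auto simp: eventually_at_filter elim: eventually_mono)
  from eventually_happens'[OF trivial_limit_at_right_real this] show ?thesis
    using that by blast
qed

text \<open>A defining function \<open>F\<close> of \<open>S\<close> at the origin vanishes along each orbit \<open>l \<mapsto> dil l p\<close>; its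
  first, respectively second, derivative at \<open>l = 0\<close> gives the equation of the cone.\<close>

lemma cone_first_order:
  assumes U: "open U" "(0, 0, 0) \<in> U" and S: "is_cone S" "p \<in> S"
    and F: "\<And>q. q \<in> S \<inter> U \<Longrightarrow> F q = (0::real)" "F (0, 0, 0) = 0"
    and F': "(F has_derivative D) (at (0, 0, 0))"
    and p: "p = (x, y, t)"
  shows "D (x, y, 0) = 0"
proof -
  have dil0: "dil 0 p = (0, 0, 0)" by (simp add: p)
  have "((\<lambda>l. dil l p) has_derivative (\<lambda>h. (h * x, h * y, 0))) (at 0)"
    unfolding p dil.simps by (auto intro!: derivative_eq_intros)
  then have "((\<lambda>l. F (dil l p)) has_derivative (\<lambda>h. D (h * x, h * y, 0))) (at 0)"
    using has_derivative_compose[of "\<lambda>l. dil l p" _ 0 UNIV F D] F' dil0 by auto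
  moreover have "D (h * x, h * y, 0) = D (x, y, 0) * h" for h
    using linear_scale[OF has_derivative_linear[OF F'], of h "(x, y, 0)"] by simp
  ultimately have "((\<lambda>l. F (dil l p)) has_real_derivative D (x, y, 0)) (at 0)"
    by (simp add: has_field_derivative_def)
  \<comment> \<open>Only l > 0 keeps \<open>dil l p\<close> on the cone, so the derivative is read
    off from the right, where the quotient is eventually zero.\<close>
  then have "((\<lambda>l. F (dil l p) / l) \<longlongrightarrow> D (x, y, 0)) (at_right 0)"
    unfolding has_field_derivative_iff dil0 F(2) diff_0_right add_0_left
    by (rule tendsto_within_subset) simp
  moreover have "eventually (\<lambda>l. F (dil l p) / l = 0) (at_right 0)"
    using eventually_dil_in_open[OF U, of p] unfolding eventually_at_filter
    by (rule eventually_mono) (use cone_dil_mem[OF S(1)] S(2) F(1) in simp)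
  then have "((\<lambda>l. F (dil l p) / l) \<longlongrightarrow> 0) (at_right 0)"
    by (rule tendsto_eventually)
  ultimately show ?thesis
    using tendsto_unique[OF trivial_limit_at_right_real] by blast
qed

lemma cone_second_order:
  assumes U: "open U" "(0, 0, 0) \<in> U" and S: "is_cone S" "p \<in> S"
    and F: "\<And>q. q \<in> S \<inter> U \<Longrightarrow> F q = (0::real)"
    and F': "\<And>q. q \<in> U \<Longrightarrow> (F has_derivative DF q) (at q)"
    and DF0: "DF (0, 0, 0) (x, y, 0) = 0"
    and F'': "((\<lambda>q. DF q (x, y, 0)) has_derivative D2) (at (0, 0, 0))"
    and cont: "isCont (\<lambda>q. DF q (0, 0, 1)) (0, 0, 0)"
    and p: "p = (x, y, t)"
  shows "D2 (x, y, 0) + 2 * t * DF (0, 0, 0) (0, 0, 1) = 0"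
proof -
  \<comment> \<open>For l > 0 the orbit has velocity (x, y, 2 l t), so A + 2 l t B vanishes along
    it. Division by l takes the place of a second derivative of \<open>F\<close> along the orbit: A
    / l tends to the derivative of A, since A vanishes at the origin, and continuity controls
    B.\<close>
  define A where "A q = DF q (x, y, 0)" for q
  define B where "B q = DF q (0, 0, 1)" for q
  have dil0: "dil 0 p = (0, 0, 0)" by (simp add: p)
  have "((\<lambda>l. dil l p) has_derivative (\<lambda>h. (h * x, h * y, 0))) (at 0)"
    unfolding p dil.simps by (auto intro!: derivative_eq_intros)
  then have "((\<lambda>l. A (dil l p)) has_derivative (\<lambda>h. D2 (h * x, h * y, 0))) (at 0)"
    using has_derivative_compose[of "\<lambda>l. dil l p" _ 0 UNIV A D2] F'' dil0 unfolding A_def by auto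
  moreover have "D2 (h * x, h * y, 0) = D2 (x, y, 0) * h" for h
    using linear_scale[OF has_derivative_linear[OF F''], of h "(x, y, 0)"] by simp
  ultimately have "((\<lambda>l. A (dil l p)) has_real_derivative D2 (x, y, 0)) (at 0)"
    by (simp add: has_field_derivative_def)
  then have "((\<lambda>l. A (dil l p) / l) \<longlongrightarrow> D2 (x, y, 0)) (at 0)"
    unfolding has_field_derivative_iff dil0 by (simp add: A_def DF0)
  moreover have "((\<lambda>l. B (dil l p)) \<longlongrightarrow> B (0, 0, 0)) (at 0)"
  proof -
    have "((\<lambda>l. dil l p) \<longlongrightarrow> (0 * x, 0 * y, 0\<^sup>2 * t)) (at 0)"
      unfolding dil.simps p by (intro tendsto_intros)
    then show ?thesis
      using isCont_tendsto_compose[OF cont, of "\<lambda>l. dil l p"] unfolding B_def by simp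
  qed
  ultimately have "((\<lambda>l. A (dil l p) / l + 2 * t * B (dil l p)) \<longlongrightarrow> D2 (x, y, 0) + 2 * t * B (0, 0, 0)) (at 0)"
    by (intro tendsto_intros)
  then have 1: "((\<lambda>l. A (dil l p) / l + 2 * t * B (dil l p)) \<longlongrightarrow> D2 (x, y, 0) + 2 * t * B (0, 0, 0)) (at_right 0)"
    by (rule tendsto_within_subset) simp
  have zero: "A (dil l p) / l + 2 * t * B (dil l p) = 0" if l: "l > 0" "dil l p \<in> U" for l
  proof -
    have "((\<lambda>l. dil l p) has_derivative (\<lambda>h. (h * x, h * y, 2 * l * h * t))) (at l)"
      unfolding p dil.simps by (auto intro!: derivative_eq_intros simp: power2_eq_square)
    then have "((\<lambda>l. F (dil l p)) has_derivative (\<lambda>h. DF (dil l p) (h * x, h * y, 2 * l * h * t))) (at l)"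
      using has_derivative_compose[of "\<lambda>l. dil l p" _ l UNIV F] F'[OF l(2)] by auto
    moreover have "((\<lambda>l. F (dil l p)) has_derivative (\<lambda>h. 0)) (at l)"
    proof (rule has_derivative_transform_within_open)
      show "open ((\<lambda>l. dil l p) -` U \<inter> {0<..})"
        using U(1) unfolding p dil.simps
        by (intro open_Int open_vimage continuous_intros) auto
      show "0 = F (dil m p)" if "m \<in> (\<lambda>l. dil l p) -` U \<inter> {0<..}" for m
        using that cone_dil_mem[OF S(1)] S(2) F by auto
    qed (use l in auto)
    ultimately have "(\<lambda>h. DF (dil l p) (h * x, h * y, 2 * l * h * t)) = (\<lambda>h. 0)"
      by (rule has_derivative_unique)
    from fun_cong[OF this, of 1] have "DF (dil l p) (x, y, 2 * l * t) = 0"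
      by simp
    moreover have lin: "linear (DF (dil l p))"
      by (rule has_derivative_linear[OF F'[OF l(2)]])
    have "DF (dil l p) (x, y, 2 * l * t) = A (dil l p) + 2 * l * t * B (dil l p)"
      unfolding A_def B_def
      using linear_add[OF lin, of "(x, y, 0)" "(2 * l * t) *\<^sub>R (0, 0, 1)"]
        linear_scale[OF lin, of "2 * l * t" "(0, 0, 1)"] by simp
    ultimately have "A (dil l p) = - (2 * l * t * B (dil l p))"
      by linarith
    then show ?thesis
      using l(1) by simp
  qed
  have "eventually (\<lambda>l. A (dil l p) / l + 2 * t * B (dil l p) = 0) (at_right 0)"
    using eventually_dil_in_open[OF U, of p] unfolding eventually_at_filter
    by (rule eventually_mono) (use zero in simp)
  then have "((\<lambda>l. A (dil l p) / l + 2 * t * B (dil l p)) \<longlongrightarrow> 0) (at_right 0)"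
    by (rule tendsto_eventually)
  with 1 show ?thesis
    unfolding B_def using tendsto_unique[OF trivial_limit_at_right_real] by blast
qed

lemma quadric_cone_dil:
  "l > 0 \<Longrightarrow> (l\<^sup>2 * t = a * (l * x)\<^sup>2 + b * (l * x) * (l * y) + c * (l * y)\<^sup>2) \<longleftrightarrow>
    t = a * x\<^sup>2 + b * x * y + c * (y::real)\<^sup>2"
proof -
  assume "l > 0"
  have "a * (l * x)\<^sup>2 + b * (l * x) * (l * y) + c * (l * y)\<^sup>2 = l\<^sup>2 * (a * x\<^sup>2 + b * x * y + c * y\<^sup>2)"
    by (simp add: power2_eq_square algebra_simps)
  then show ?thesis using \<open>l > 0\<close> by simp
qed

theorem C2_cone_cases:
  assumes S: "closed S" "is_cone S" "S \<noteq> {}" "Ck_surface 2 S"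
  shows "vertical_plane S \<or> (\<exists>a b c. S = {(x, y, t). t = a * x\<^sup>2 + b * x * y + c * y\<^sup>2})"
proof -
  have 0: "(0, 0, 0) \<in> S" by (rule origin_in_closed_cone[OF S(1-3)])
  obtain U W and \<phi> \<psi> :: "heis \<Rightarrow> heis" where U: "open U" "(0, 0, 0) \<in> U" and W: "open W"
    and hom: "homeomorphism U W \<phi> \<psi>" and C: "Ck_on 2 U \<phi>" "Ck_on 2 W \<psi>"
    and slice: "\<phi> ` (S \<inter> U) = W \<inter> {(a, b, c). c = 0}"
    using S(4) 0 unfolding Ck_surface_def by metis
  define F where "F q = snd (snd (\<phi> q))" for q
  define DF where "DF q v = snd (snd (frechet_derivative \<phi> (at q) v))" for q v
  have diff: "\<phi> differentiable (at q)" if "q \<in> U" for q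
    using C(1) that by (simp add: numeral_2_eq_2)
  have diff2: "(\<lambda>q. frechet_derivative \<phi> (at q) v) differentiable (at q)" if "q \<in> U" for q v
    using C(1) that by (cases v) (simp add: numeral_2_eq_2)
  have F': "(F has_derivative DF q) (at q)" if "q \<in> U" for q
    unfolding F_def DF_def
    using diff[OF that] by (intro has_derivative_snd) (simp add: frechet_derivative_works)
  have F'': "((\<lambda>q. DF q v) differentiable (at q))" if q: "q \<in> U" for q v
  proof -
    obtain D where "((\<lambda>q. frechet_derivative \<phi> (at q) v) has_derivative D) (at q)"
      using diff2[OF q, of v] unfolding differentiable_def by blast
    then have "((\<lambda>q. DF q v) has_derivative (\<lambda>w. snd (snd (D w)))) (at q)"
      unfolding DF_def by (intro has_derivative_snd)
    then show ?thesis unfolding differentiable_def by blast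
  qed
  have F0: "F q = 0" if "q \<in> S \<inter> U" for q
  proof -
    have "\<phi> q \<in> \<phi> ` (S \<inter> U)" using that by (rule imageI)
    then show ?thesis unfolding slice by (cases "\<phi> q") (simp add: F_def)
  qed
  have lin: "linear (DF (0, 0, 0))"
    by (rule has_derivative_linear[OF F'[OF U(2)]])
  define al be ga where "al = DF (0, 0, 0) (1, 0, 0)" and "be = DF (0, 0, 0) (0, 1, 0)"
    and "ga = DF (0, 0, 0) (0, 0, 1)"
  have DF0: "DF (0, 0, 0) (x, y, t) = al * x + be * y + ga * t" for x y t
  proof -
    have "(x, y, t) = x *\<^sub>R (1, 0, 0) + y *\<^sub>R (0, 1, 0) + t *\<^sub>R (0, 0, 1)" by simp
    then show ?thesis
      unfolding al_def be_def ga_def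
      by (simp only: linear_add[OF lin] linear_scale[OF lin]) simp
  qed
  \<comment> \<open>On \<open>W\<close> the composite of \<open>F\<close> with the inverse chart is
    the third coordinate, whose differential is not zero; hence neither is that of
    \<open>F\<close>.\<close>
  have nz: "al \<noteq> 0 \<or> be \<noteq> 0 \<or> ga \<noteq> 0"
  proof -
    have w: "\<phi> (0, 0, 0) \<in> W" "\<psi> (\<phi> (0, 0, 0)) = (0, 0, 0)"
      using hom U(2) by (auto simp: homeomorphism_def)
    obtain D where D: "(\<psi> has_derivative D) (at (\<phi> (0, 0, 0)))"
      using C(2) w(1) by (auto simp: numeral_2_eq_2 differentiable_def)
    have "((\<lambda>q. F (\<psi> q)) has_derivative (\<lambda>v. DF (0, 0, 0) (D v))) (at (\<phi> (0, 0, 0)))"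
      using has_derivative_compose[OF D, of F "DF (0, 0, 0)"] F'[OF U(2)] w(2) by simp
    moreover have "((\<lambda>q. F (\<psi> q)) has_derivative (\<lambda>v. snd (snd v))) (at (\<phi> (0, 0, 0)))"
    proof (rule has_derivative_transform_within_open)
      show "((\<lambda>q. snd (snd q)) has_derivative (\<lambda>v. snd (snd v))) (at (\<phi> (0, 0, 0)))"
        by (intro has_derivative_snd has_derivative_ident)
      show "snd (snd q) = F (\<psi> q)" if "q \<in> W" for q
        using hom that by (auto simp: homeomorphism_def F_def)
    qed (use W w in auto)
    ultimately have "(\<lambda>v. DF (0, 0, 0) (D v)) = (\<lambda>v. snd (snd v))"
      by (rule has_derivative_unique)
    from fun_cong[OF this, of "(0, 0, 1)"] have "DF (0, 0, 0) (D (0, 0, 1)) = 1" by simp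
    then show ?thesis
      by (cases "D (0, 0, 1)") (auto simp: DF0)
  qed
  \<comment> \<open>The slice chart parametrizes S inside \<open>U\<close> injectively by the open
    plane set \<open>P\<close>; invariance of domain is applied to this parametrization.\<close>
  define P where "P = {(a, b). (a, b, 0) \<in> W}"
  define \<sigma> where "\<sigma> z = \<psi> (fst z, snd z, 0)" for z :: "real \<times> real"
  have P: "open P"
  proof -
    have "P = (\<lambda>z. (fst z, snd z, 0)) -` W" by (auto simp: P_def)
    then show ?thesis using W by (auto intro!: open_vimage continuous_intros)
  qed
  have \<sigma>cont: "continuous_on P \<sigma>"
  proof -
    have "continuous_on W \<psi>" using hom by (simp add: homeomorphism_def)
    moreover have "continuous_on P (\<lambda>z. (fst z, snd z, 0::real))" by (intro continuous_intros)
    moreover have "(\<lambda>z. (fst z, snd z, 0)) ` P \<subseteq> W" by (auto simp: P_def)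
    ultimately show ?thesis unfolding \<sigma>_def by (rule continuous_on_compose2)
  qed
  have \<sigma>inj: "inj_on \<sigma> P"
  proof (rule inj_onI)
    fix z z' assume z: "z \<in> P" "z' \<in> P" "\<sigma> z = \<sigma> z'"
    have "\<phi> (\<sigma> w) = (fst w, snd w, 0)" if "w \<in> P" for w
      unfolding \<sigma>_def using hom that by (intro homeomorphism_apply2) (auto simp: P_def)
    with z show "z = z'"
      by (metis Pair_inject prod_eqI)
  qed
  have \<sigma>im: "\<sigma> ` P = S \<inter> U"
  proof -
    have "S \<inter> U = \<psi> ` \<phi> ` (S \<inter> U)"
      unfolding image_image using homeomorphism_apply1[OF hom] by simp
    also have "\<dots> = \<psi> ` (W \<inter> {(a, b, c). c = 0})" by (simp only: slice)
    also have "W \<inter> {(a, b, c). c = 0} = (\<lambda>z. (fst z, snd z, 0)) ` P"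
      by (force simp: P_def)
    finally show ?thesis by (simp add: \<sigma>_def[abs_def] image_image)
  qed
  show ?thesis
  proof (cases "al = 0 \<and> be = 0")
    case False
    define V where "V = {v :: heis. (al, be, 0) \<bullet> v = 0}"
    have sub: "S \<subseteq> V"
    proof
      fix p assume "p \<in> S"
      moreover obtain x y t where p: "p = (x, y, t)" by (cases p)
      ultimately have "DF (0, 0, 0) (x, y, 0) = 0"
        using cone_first_order[OF U S(2) _ F0 F0 F'[OF U(2)] p] 0 U(2) by auto
      then show "p \<in> V" by (simp add: DF0 V_def p)
    qed
    have ne: "(al, be, 0) \<noteq> (0::heis)" using False by (auto simp: zero_prod_def)
    \<comment> \<open>\<open>P\<close> and \<open>V\<close> both have dimension two, so the
      injective image of \<open>P\<close> is open in \<open>V\<close>, and S contains a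
      neighbourhood of the origin in \<open>V\<close>. Dilations then reach all of
      \<open>V\<close>.\<close>
    have "openin (top_of_set V) (\<sigma> ` P)"
    proof (rule invariance_of_domain_subspaces)
      show "openin (top_of_set UNIV) P" using P by simp
      show "subspace V" unfolding V_def by (rule subspace_hyperplane)
      show "dim V \<le> dim (UNIV :: (real \<times> real) set)"
        unfolding V_def dim_hyperplane[OF ne] by simp
      show "\<sigma> \<in> P \<rightarrow> V" using sub \<sigma>im by auto
    qed (use \<sigma>cont \<sigma>inj in auto)
    then obtain T where T: "open T" "S \<inter> U = V \<inter> T"
      unfolding \<sigma>im openin_open by auto
    have "V \<subseteq> S"
    proof
      fix p assume p: "p \<in> V"
      have "(0, 0, 0) \<in> T" using 0 U(2) T(2) by auto
      then obtain l where l: "l > 0" "dil l p \<in> T"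
        using exists_dil_in_open[OF T(1)] by metis
      have "dil l p \<in> V"
      proof -
        obtain x y t where xyt: "p = (x, y, t)" by (cases p)
        have "(al, be, 0) \<bullet> dil l p = l * ((al, be, 0) \<bullet> p)"
          by (simp add: xyt algebra_simps)
        then show ?thesis using p by (simp add: V_def)
      qed
      then have "dil l p \<in> S" using l(2) T(2) by blast
      then show "p \<in> S" by (simp only: cone_dil_mem[OF S(2) l(1)])
    qed
    with sub have "S = V" by auto
    moreover have "vertical_plane V"
      unfolding vertical_plane_def
    proof (intro conjI ballI allI)
      show "affine V" unfolding V_def by (rule affine_hyperplane)
      show "aff_dim V = 2" unfolding V_def aff_dim_hyperplane[OF ne] by simp
    qed (auto simp: V_def inner_add_right)
    ultimately show ?thesis by simp
  next
    case True
    then have ga: "ga \<noteq> 0" using nz by simp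
    have "\<exists>D2. \<forall>v. ((\<lambda>q. DF q v) has_derivative D2 v) (at (0, 0, 0))"
      using F''[OF U(2)] unfolding differentiable_def by metis
    then obtain D2 where D2: "\<And>v. ((\<lambda>q. DF q v) has_derivative D2 v) (at (0, 0, 0))"
      by blast
    have linD2: "linear (D2 v)" for v by (rule has_derivative_linear[OF D2])
    \<comment> \<open>The coefficients come from solving the second-order equation for t;
      \<open>b\<close> collects both mixed second derivatives.\<close>
    define a b c where "a = - D2 (1, 0, 0) (1, 0, 0) / (2 * ga)"
      and "b = - (D2 (1, 0, 0) (0, 1, 0) + D2 (0, 1, 0) (1, 0, 0)) / (2 * ga)"
      and "c = - D2 (0, 1, 0) (0, 1, 0) / (2 * ga)"
    have expand: "D2 v (x, y, 0) = x * D2 v (1, 0, 0) + y * D2 v (0, 1, 0)" for v x y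
      using linear_add[OF linD2[of v], of "x *\<^sub>R (1, 0, 0)" "y *\<^sub>R (0, 1, 0)"]
        linear_scale[OF linD2[of v], of x "(1, 0, 0)"] linear_scale[OF linD2[of v], of y "(0, 1, 0)"]
      by simp
    \<comment> \<open>\<open>D2 v\<close> was chosen separately for each direction v, so linearity
      in v comes from uniqueness of derivatives.\<close>
    have expand': "D2 (x, y, 0) v = x * D2 (1, 0, 0) v + y * D2 (0, 1, 0) v" for v x y
    proof -
      have "((\<lambda>q. x * DF q (1, 0, 0) + y * DF q (0, 1, 0)) has_derivative
          (\<lambda>v. x * D2 (1, 0, 0) v + y * D2 (0, 1, 0) v)) (at (0, 0, 0))"
        by (intro derivative_intros D2)
      then have "((\<lambda>q. DF q (x, y, 0)) has_derivative
          (\<lambda>v. x * D2 (1, 0, 0) v + y * D2 (0, 1, 0) v)) (at (0, 0, 0))"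
      proof (rule has_derivative_transform_within_open[OF _ U])
        fix q assume q: "q \<in> U"
        have l: "linear (DF q)" by (rule has_derivative_linear[OF F'[OF q]])
        show "x * DF q (1, 0, 0) + y * DF q (0, 1, 0) = DF q (x, y, 0)"
          using linear_add[OF l, of "x *\<^sub>R (1, 0, 0)" "y *\<^sub>R (0, 1, 0)"]
            linear_scale[OF l, of x "(1, 0, 0)"] linear_scale[OF l, of y "(0, 1, 0)"]
          by simp
      qed
      then show ?thesis
        using has_derivative_unique[OF D2] by (auto dest: fun_cong)
    qed
    define G where "G = {(x, y, t). t = a * x\<^sup>2 + b * x * y + c * (y::real)\<^sup>2}"
    have sub: "S \<subseteq> G"
    proof
      fix p assume "p \<in> S"
      moreover obtain x y t where p: "p = (x, y, t)" by (cases p)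
      moreover have "isCont (\<lambda>q. DF q (0, 0, 1)) (0, 0, 0)"
        using has_derivative_continuous[OF D2] by blast
      ultimately have "D2 (x, y, 0) (x, y, 0) + 2 * t * ga = 0"
        using cone_second_order[OF U S(2) _ F0 F' _ D2 _ p] DF0[of x y 0] True unfolding ga_def
        by auto
      then have "t = - D2 (x, y, 0) (x, y, 0) / (2 * ga)"
        using ga by (simp add: field_simps)
      also have "\<dots> = a * x\<^sup>2 + b * x * y + c * y\<^sup>2"
        using ga unfolding a_def b_def c_def expand'[of x y] expand[of _ x y]
        by (simp add: field_simps power2_eq_square)
      finally show "p \<in> G" by (simp add: p G_def)
    qed
    \<comment> \<open>The quadric is a graph over the (x, y)-plane, so the projection is injective
      on S and invariance of domain applies in the plane.\<close>
    define \<tau> where "\<tau> z = (fst (\<sigma> z), fst (snd (\<sigma> z)))" for z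
    have "openin (top_of_set UNIV) (\<tau> ` P)"
    proof (rule invariance_of_domain_subspaces)
      show "openin (top_of_set UNIV) P" using P by simp
      show "continuous_on P \<tau>"
        unfolding \<tau>_def using \<sigma>cont by (intro continuous_intros)
      show "inj_on \<tau> P"
      proof (rule inj_onI)
        fix z z' assume z: "z \<in> P" "z' \<in> P" "\<tau> z = \<tau> z'"
        then have "\<sigma> z \<in> G" "\<sigma> z' \<in> G" using \<sigma>im sub by auto
        then have "\<sigma> z = \<sigma> z'"
          using z(3) by (cases "\<sigma> z"; cases "\<sigma> z'") (auto simp: G_def \<tau>_def)
        then show "z = z'" using z \<sigma>inj by (auto dest: inj_onD)
      qed
    qed auto
    then have T: "open (\<tau> ` P)" by simp
    have "G \<subseteq> S"
    proof
      fix p assume pG: "p \<in> G"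
      obtain x y t where p: "p = (x, y, t)" by (cases p)
      have "(0, 0, 0) \<in> \<sigma> ` P" using 0 U(2) \<sigma>im by simp
      then obtain z0 where z0: "z0 \<in> P" "\<sigma> z0 = (0, 0, 0)" by (metis imageE)
      then have "\<tau> z0 = (0, 0)" by (simp add: \<tau>_def)
      then have "(0, 0) \<in> \<tau> ` P" using z0(1) by (metis image_eqI)
      moreover have "open ((\<lambda>q::heis. (fst q, fst (snd q))) -` \<tau> ` P)"
        using T by (intro open_vimage continuous_intros) auto
      ultimately obtain l where l: "l > 0" "(\<lambda>q. (fst q, fst (snd q))) (dil l p) \<in> \<tau> ` P"
        using exists_dil_in_open[of "(\<lambda>q. (fst q, fst (snd q))) -` \<tau> ` P" p] by auto
      then obtain z where z: "z \<in> P" "\<tau> z = (l * x, l * y)" by (auto simp: p)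
      then have "\<sigma> z \<in> S" "\<sigma> z \<in> G" using \<sigma>im sub by auto
      moreover have "dil l p \<in> G"
        using pG l(1) by (simp add: p G_def quadric_cone_dil)
      ultimately have "dil l p \<in> S"
        using z(2) by (cases "\<sigma> z") (auto simp: G_def \<tau>_def p)
      then show "p \<in> S" using cone_dil_mem[OF S(2) l(1)] by simp
    qed
    with sub show ?thesis unfolding G_def by blast
  qed
qed

section \<open>Continuously differentiable functions and integration below a graph\<close>

text \<open>The derivative is an explicit argument, so that formulas for it can be carried through
  products, shears and integrals. Continuity in each fixed direction is equivalent to C^1 in finite
  dimension.\<close>

definition C1_deriv :: "('a::euclidean_space \<Rightarrow> 'b::euclidean_space) \<Rightarrow> ('a \<Rightarrow> 'a \<Rightarrow> 'b) \<Rightarrow> bool" where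
  "C1_deriv f f' \<longleftrightarrow> (\<forall>p. (f has_derivative f' p) (at p)) \<and> (\<forall>v. continuous_on UNIV (\<lambda>p. f' p v))"

lemma C1_derivD: "C1_deriv f f' \<Longrightarrow> (f has_derivative f' p) (at p)"
  by (simp add: C1_deriv_def)

lemma C1_deriv_linear: "C1_deriv f f' \<Longrightarrow> linear (f' p)"
  by (metis C1_derivD has_derivative_linear)

lemma C1_deriv_continuous: "C1_deriv f f' \<Longrightarrow> continuous_on A f"
  by (metis C1_derivD has_derivative_continuous continuous_at_imp_continuous_on)

lemma C1_deriv_continuous_deriv: "C1_deriv f f' \<Longrightarrow> continuous_on A (\<lambda>p. f' p v)"
  unfolding C1_deriv_def using continuous_on_subset by blast

text \<open>Expanding the direction in a basis leaves finitely many fixed directions. It serves for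
  point-dependent directions such as X, Y and their shears.\<close>

lemma C1_deriv_continuous_joint:
  assumes f: "C1_deriv f f'" and h: "continuous_on A h" and Z: "continuous_on A Z"
  shows "continuous_on A (\<lambda>p. f' (h p) (Z p))"
proof -
  have "f' (h p) (Z p) = (\<Sum>b\<in>Basis. (Z p \<bullet> b) *\<^sub>R f' (h p) b)" for p
  proof -
    have "f' (h p) (Z p) = f' (h p) (\<Sum>b\<in>Basis. (Z p \<bullet> b) *\<^sub>R b)"
      by (simp add: euclidean_representation)
    then show ?thesis
      by (simp add: linear_sum[OF C1_deriv_linear[OF f]] linear_scale[OF C1_deriv_linear[OF f]])
  qed
  moreover have cont: "continuous_on A (\<lambda>p. f' (h p) b)" for b
    by (rule continuous_on_compose2[OF _ h, of UNIV "\<lambda>q. f' q b"])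
      (use f in \<open>auto simp: C1_deriv_def\<close>)
  have "continuous_on A (\<lambda>p. \<Sum>b\<in>Basis. (Z p \<bullet> b) *\<^sub>R f' (h p) b)"
    using Z by (intro continuous_intros cont)
  ultimately show ?thesis
    by simp
qed

lemma C1_deriv_scaleR:
  fixes c :: "'a::euclidean_space \<Rightarrow> real"
  assumes "C1_deriv c c'" "C1_deriv W W'"
  shows "C1_deriv (\<lambda>p. c p *\<^sub>R W p) (\<lambda>p v. c p *\<^sub>R W' p v + c' p v *\<^sub>R W p)"
  by (subst C1_deriv_def)
    (intro conjI allI has_derivative_scaleR C1_derivD[OF assms(1)] C1_derivD[OF assms(2)]
      continuous_on_add continuous_on_scaleR
      C1_deriv_continuous[OF assms(1)] C1_deriv_continuous[OF assms(2)]
      C1_deriv_continuous_deriv[OF assms(1)] C1_deriv_continuous_deriv[OF assms(2)])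

lemma C1_deriv_compose_functional:
  assumes f: "\<And>x. (f has_real_derivative f1 x) (at x)" "continuous_on UNIV f1" and L: "bounded_linear L"
  shows "C1_deriv (\<lambda>z. f (L z)) (\<lambda>z v. f1 (L z) * L v)"
  unfolding C1_deriv_def
proof (intro conjI allI)
  fix p
  have L': "(L has_derivative L) (at p)"
    using bounded_linear.has_derivative[OF L has_derivative_ident] by simp
  show "((\<lambda>z. f (L z)) has_derivative (\<lambda>v. f1 (L p) * L v)) (at p)"
    by (rule has_derivative_compose[OF L' f(1)[unfolded has_field_derivative_def]])
  show "continuous_on UNIV (\<lambda>p. f1 (L p) * L v)" for v
    by (intro continuous_intros continuous_on_compose2[OF f(2)] linear_continuous_on[OF L]) auto
qed

lemma C1_deriv_mult:
  fixes f g :: "'a::euclidean_space \<Rightarrow> real"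
  assumes "C1_deriv f f'" "C1_deriv g g'"
  shows "C1_deriv (\<lambda>p. f p * g p) (\<lambda>p v. f p * g' p v + f' p v * g p)"
  using C1_deriv_scaleR[OF assms] by simp

lemma C1_deriv_zero_outside:
  assumes "C1_deriv f f'" "closed K" "\<And>p. p \<notin> K \<Longrightarrow> f p = 0" "p \<notin> K"
  shows "f' p v = 0"
proof -
  have "(f has_derivative (\<lambda>_. 0)) (at p)"
    by (rule has_derivative_transform_within_open[of "\<lambda>_. 0" _ _ _ "- K"]) (use assms in auto)
  then show ?thesis
    using has_derivative_unique[OF C1_derivD[OF assms(1)]] by metis
qed

lemma C1_deriv_imp_Ck_on: "C1_deriv f f' \<Longrightarrow> Ck_on 1 UNIV f"
proof -
  assume f: "C1_deriv f f'"
  have "frechet_derivative f (at p) = f' p" for p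
    using frechet_derivative_at[OF C1_derivD[OF f]] by simp
  then show ?thesis
    using f by (auto simp: C1_deriv_def differentiable_def)
qed

lemma Ck_on_imp_C1_deriv: "Ck_on 1 UNIV f \<Longrightarrow> C1_deriv f (\<lambda>p. frechet_derivative f (at p))"
  by (auto simp: C1_deriv_def frechet_derivative_works)

section \<open>Integrals of compactly supported functions and Fubini\<close>

lemma integrable_continuous_compact_support:
  fixes f :: "'a::euclidean_space \<Rightarrow> real"
  assumes "continuous_on UNIV f" "compact K" "\<And>x. x \<notin> K \<Longrightarrow> f x = 0"
  shows "integrable lborel f"
proof -
  have "(\<lambda>x. indicator K x *\<^sub>R f x) = f"
    using assms(3) by (fastforce simp: indicator_def)
  then show ?thesis
    using borel_integrable_compact[OF assms(2) continuous_on_subset[OF assms(1)]] by simp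
qed

lemma integrable_indicator_compact_support:
  fixes f :: "'a::euclidean_space \<Rightarrow> real"
  assumes "continuous_on UNIV f" "compact K" "\<And>x. x \<notin> K \<Longrightarrow> f x = 0" "A \<in> sets borel"
  shows "integrable lborel (\<lambda>x. indicator A x * f x)"
  using integrable_mult_indicator[of A lborel f] integrable_continuous_compact_support[OF assms(1-3)] assms(4)
  by simp

text \<open>The half-line version is the source of the boundary terms: the trace on a graph in the
  divergence theorem, and the jump of a sign function.\<close>

lemma integral_deriv_compact_support:
  fixes f f' :: "real \<Rightarrow> real"
  assumes f: "\<And>x. (f has_real_derivative f' x) (at x)" and f': "continuous_on UNIV f'"
    and K: "compact K" "\<And>x. x \<notin> K \<Longrightarrow> f x = 0"
  shows "(\<integral>x. f' x \<partial>lborel) = 0" "(\<integral>x. indicator {..0} x * f' x \<partial>lborel) = f 0"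
proof -
  obtain R where R: "R > 0" "\<And>x. x \<in> K \<Longrightarrow> norm x \<le> R"
    using compact_imp_bounded[OF K(1)] unfolding bounded_pos by auto
  have out: "f' x = 0" if "\<bar>x\<bar> > R" for x
  proof -
    have "(f has_real_derivative 0) (at x)"
    proof (rule has_field_derivative_transform_within_open)
      show "open (- {-R..R})" by auto
      show "0 = f y" if "y \<in> - {-R..R}" for y
        using that R(2)[of y] K(2)[of y] by (cases "y \<in> K") auto
    qed (use that in auto)
    then show ?thesis using DERIV_unique[OF f] by metis
  qed
  have isC: "isCont f' x" for x using f' by (simp add: continuous_on_eq_continuous_at)
  have f0: "f x = 0" if "\<bar>x\<bar> > R" for x
    using that R(2)[of x] K(2)[of x] by (cases "x \<in> K") auto
  \<comment> \<open>The bound R + 1 puts both endpoints outside the support.\<close>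
  have 1: "(\<integral>x. f' x * indicator {-(R+1)..R+1} x \<partial>lborel) = f (R+1) - f (-(R+1))"
    using R(1) by (intro integral_FTC_Icc_real f isC) auto
  have "f' x * indicator {-(R+1)..R+1} x = f' x" for x
    using out[of x] by (cases "\<bar>x\<bar> > R") (auto simp: indicator_def)
  then show "(\<integral>x. f' x \<partial>lborel) = 0"
    using 1 f0[of "R + 1"] f0[of "- (R + 1)"] R(1) by (simp only:)
  have 2: "(\<integral>x. f' x * indicator {-(R+1)..0} x \<partial>lborel) = f 0 - f (-(R+1))"
    using R(1) by (intro integral_FTC_Icc_real f isC) auto
  have "f' x * indicator {-(R+1)..0} x = indicator {..0} x * f' x" for x
    using out[of x] by (cases "\<bar>x\<bar> > R") (auto simp: indicator_def)
  then show "(\<integral>x. indicator {..0} x * f' x \<partial>lborel) = f 0"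
    using 2 f0[of "R + 1"] f0[of "- (R + 1)"] R(1) by (simp only:)
qed

lemma box_Pair_eq: "box (a, c) (b, d) = box a b \<times> box c d"
  using box_prod[of "(a, c)" "(b, d)"] by simp

lemma emeasure_lborel_Times:
  assumes "A \<in> sets borel" "B \<in> sets borel"
  shows "emeasure lborel (A \<times> B) = emeasure lborel A * emeasure lborel B"
  using assms by (simp add: lborel.emeasure_pair_measure_Times flip: lborel_prod)

text \<open>\<open>heis\<close> nests to the right, while integration along vertical lines needs the
  plane as first factor. Regrouping maps boxes to boxes of the same volume, which determines
  Lebesgue measure.\<close>

lemma lborel_distr_prod_assoc:
  "distr lborel borel (\<lambda>p :: ('a::euclidean_space \<times> 'b::euclidean_space) \<times> 'c::euclidean_space.
    (fst (fst p), snd (fst p), snd p)) = lborel" (is "distr _ _ ?h = _")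
proof (rule lborel_eqI[symmetric])
  have [measurable]: "?h \<in> borel_measurable borel"
    by (intro borel_measurable_continuous_onI continuous_intros)
  fix l u :: "'a \<times> 'b \<times> 'c"
  assume le: "\<And>b. b \<in> Basis \<Longrightarrow> l \<bullet> b \<le> u \<bullet> b"
  obtain l1 l2 l3 u1 u2 u3 where lu: "l = (l1, l2, l3)" "u = (u1, u2, u3)" by (cases l, cases u)
  have "emeasure (distr lborel borel ?h) (box l u) = emeasure lborel (?h -` box l u)"
    by (subst emeasure_distr) auto
  also have "?h -` box l u = (box l1 u1 \<times> box l2 u2) \<times> box l3 u3"
    by (auto simp: lu box_Pair_eq)
  also have "\<dots> = box ((l1, l2), l3) ((u1, u2), u3)"
    by (simp add: box_Pair_eq)
  also have "emeasure lborel \<dots> = emeasure lborel (box l1 u1) * emeasure lborel (box l2 u2) * emeasure lborel (box l3 u3)"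
    by (simp add: box_Pair_eq emeasure_lborel_Times borel_Times)
  also have "\<dots> = emeasure lborel (box l u)"
    by (simp add: lu box_Pair_eq emeasure_lborel_Times borel_Times mult.assoc)
  also have "\<dots> = (\<Prod>b\<in>Basis. (u - l) \<bullet> b)"
    using le by simp
  finally show "emeasure (distr lborel borel ?h) (box l u) = (\<Prod>b\<in>Basis. (u - l) \<bullet> b)" .
qed simp

lemma integral_heis_vertical:
  fixes h :: "heis \<Rightarrow> real"
  assumes "integrable lborel h"
  shows "(\<integral>p. h p \<partial>lborel) = (\<integral>z. (\<integral>t. h (fst z, snd z, t) \<partial>lborel) \<partial>lborel)"
    "integrable lborel (\<lambda>z. \<integral>t. h (fst z, snd z, t) \<partial>lborel)"
proof -
  let ?h = "\<lambda>p :: (real \<times> real) \<times> real. (fst (fst p), snd (fst p), snd p)"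
  have m [measurable]: "?h \<in> lborel \<rightarrow>\<^sub>M borel"
    using borel_measurable_continuous_onI[of ?h] by (simp add: continuous_intros)
  have hm [measurable]: "h \<in> borel_measurable borel"
    using borel_measurable_integrable[OF assms] by simp
  have int: "integrable (lborel \<Otimes>\<^sub>M lborel) (\<lambda>p. h (?h p))"
    unfolding lborel_prod
    by (subst integrable_distr_eq[OF m hm, symmetric]) (simp add: lborel_distr_prod_assoc assms)
  have "(\<integral>p. h p \<partial>lborel) = (\<integral>p. h (?h p) \<partial>lborel)"
    by (subst integral_distr[OF m hm, symmetric]) (simp add: lborel_distr_prod_assoc)
  also have "\<dots> = (\<integral>z. (\<integral>t. h (fst z, snd z, t) \<partial>lborel) \<partial>lborel)"
    using lborel_pair.integral_fst'[OF int] by (simp add: lborel_prod)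
  finally show "(\<integral>p. h p \<partial>lborel) = (\<integral>z. (\<integral>t. h (fst z, snd z, t) \<partial>lborel) \<partial>lborel)" .
  show "integrable lborel (\<lambda>z. \<integral>t. h (fst z, snd z, t) \<partial>lborel)"
    using lborel_pair.integrable_fst'[OF int] by (simp add: lborel_prod)
qed

lemma integral_lborel_prod:
  fixes h :: "'a::euclidean_space \<times> 'b::euclidean_space \<Rightarrow> real"
  assumes "integrable lborel h"
  shows integral_lborel_prod_snd: "(\<integral>p. h p \<partial>lborel) = (\<integral>y. (\<integral>x. h (x, y) \<partial>lborel) \<partial>lborel)"
    and integral_lborel_prod_fst: "(\<integral>p. h p \<partial>lborel) = (\<integral>x. (\<integral>y. h (x, y) \<partial>lborel) \<partial>lborel)"
  using lborel_pair.integral_snd[of "\<lambda>x y. h (x, y)"] lborel_pair.integral_fst'[of h] assms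
  by (simp_all add: lborel_prod)

lemma C1_deriv_along_line:
  assumes "C1_deriv f f'"
  shows "((\<lambda>s. f (p + s *\<^sub>R v)) has_vector_derivative f' (p + s *\<^sub>R v) v) (at s)"
proof -
  have "((\<lambda>s. p + s *\<^sub>R v) has_derivative (\<lambda>h. h *\<^sub>R v)) (at s)"
    by (auto intro!: derivative_eq_intros)
  from has_derivative_compose[OF this C1_derivD[OF assms]] show ?thesis
    unfolding has_vector_derivative_def
    by (simp add: linear_scale[OF C1_deriv_linear[OF assms]])
qed

lemma compact_slice:
  fixes K :: "'a::euclidean_space set"
  assumes "compact K" "v \<noteq> 0"
  shows "compact {s. p + s *\<^sub>R v \<in> K}"
proof -
  have "closed ((\<lambda>s. p + s *\<^sub>R v) -` K)"
    by (intro continuous_closed_vimage compact_imp_closed assms continuous_intros)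
  moreover obtain R where R: "\<And>x. x \<in> K \<Longrightarrow> norm x \<le> R"
    using compact_imp_bounded[OF assms(1)] unfolding bounded_iff by auto
  have "bounded ((\<lambda>s. p + s *\<^sub>R v) -` K)"
    unfolding bounded_iff
  proof (intro exI ballI)
    fix s assume "s \<in> (\<lambda>s. p + s *\<^sub>R v) -` K"
    then have "norm (p + s *\<^sub>R v) \<le> R" using R by simp
    then have "norm (s *\<^sub>R v) \<le> R + norm p"
      using norm_triangle_ineq4[of "p + s *\<^sub>R v" p] by simp
    then show "norm s \<le> (R + norm p) / norm v"
      using assms(2) by (simp add: field_simps)
  qed
  ultimately show ?thesis
    by (simp add: compact_eq_bounded_closed vimage_def)
qed

lemma integral_deriv_line:
  fixes f :: "'a::euclidean_space \<Rightarrow> real"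
  assumes f: "C1_deriv f f'" and K: "compact K" "\<And>p. p \<notin> K \<Longrightarrow> f p = 0" and v: "v \<noteq> 0"
  shows "(\<integral>s. f' (p + s *\<^sub>R v) v \<partial>lborel) = 0"
    "(\<integral>s. indicator {..0} s * f' (p + s *\<^sub>R v) v \<partial>lborel) = f p"
proof -
  have 1: "((\<lambda>s. f (p + s *\<^sub>R v)) has_real_derivative f' (p + s *\<^sub>R v) v) (at s)" for s
    using C1_deriv_along_line[OF f] by (simp add: has_real_derivative_iff_has_vector_derivative)
  have 2: "continuous_on UNIV (\<lambda>s. f' (p + s *\<^sub>R v) v)"
    by (intro C1_deriv_continuous_joint[OF f] continuous_intros)
  note * = integral_deriv_compact_support[OF 1 2 compact_slice[OF K(1) v, of p]]
  show "(\<integral>s. f' (p + s *\<^sub>R v) v \<partial>lborel) = 0"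
    by (rule *) (use K in auto)
  have "(\<integral>s. indicator {..0} s * f' (p + s *\<^sub>R v) v \<partial>lborel) = f (p + 0 *\<^sub>R v)"
    by (rule *) (use K in auto)
  then show "(\<integral>s. indicator {..0} s * f' (p + s *\<^sub>R v) v \<partial>lborel) = f p" by simp
qed

text \<open>Gauss theorem for a half-space: lines in the x and y directions stay inside or outside,
  so these derivatives integrate to zero, while vertical half-lines end at t = 0 and leave the trace
  of \<open>w\<close>. The weight \<open>k\<close> is constant on vertical lines.\<close>

lemma integral_lower_half_deriv:
  fixes w :: "heis \<Rightarrow> real"
  assumes w: "C1_deriv w w'" and K: "compact K" "\<And>p. p \<notin> K \<Longrightarrow> w p = 0"
  shows "(\<integral>p. indicator {p. snd (snd p) \<le> 0} p * w' p (1, 0, 0) \<partial>lborel) = 0"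
    and "(\<integral>p. indicator {p. snd (snd p) \<le> 0} p * w' p (0, 1, 0) \<partial>lborel) = 0"
    and "continuous_on UNIV k \<Longrightarrow>
      (\<integral>p. indicator {p. snd (snd p) \<le> 0} p * (k (fst p, fst (snd p)) * w' p (0, 0, 1)) \<partial>lborel)
      = (\<integral>z. k z * w (fst z, snd z, 0) \<partial>lborel)"
proof -
  let ?H = "{p :: heis. snd (snd p) \<le> 0}"
  have H: "?H \<in> sets borel"
    by (intro borel_closed closed_Collect_le continuous_intros)
  have zero: "w' p v = 0" if "p \<notin> K" for p v
    using C1_deriv_zero_outside[OF w compact_imp_closed[OF K(1)] K(2)] that by blast
  note cont = C1_deriv_continuous_deriv[OF w, of UNIV]
  have int: "integrable lborel (\<lambda>p. indicator ?H p * w' p v)" for v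
    by (rule integrable_indicator_compact_support[OF cont K(1) _ H]) (simp add: zero)
  have pH: "indicator ?H (x, y, t) = (indicator {..0} t :: real)" for x y t
    by (simp add: indicator_def)
  have "(\<integral>p. indicator ?H p * w' p (1, 0, 0) \<partial>lborel)
      = (\<integral>q. (\<integral>x. indicator ?H (x, q) * w' (x, q) (1, 0, 0) \<partial>lborel) \<partial>lborel)"
    by (rule integral_lborel_prod_snd[OF int])
  also have "\<dots> = integral\<^sup>L lborel (\<lambda>q::real \<times> real. 0)"
  proof (rule Bochner_Integration.integral_cong[OF refl])
    fix q :: "real \<times> real"
    show "(\<integral>x. indicator ?H (x, q) * w' (x, q) (1, 0, 0) \<partial>lborel) = 0"
      using integral_deriv_line(1)[OF w K, of "(1, 0, 0)" "(0, q)"]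
      by (cases q) (simp add: pH zero_prod_def)
  qed
  finally show "(\<integral>p. indicator ?H p * w' p (1, 0, 0) \<partial>lborel) = 0" by simp
  have "(\<integral>p. indicator ?H p * w' p (0, 1, 0) \<partial>lborel)
      = (\<integral>x. (\<integral>q. indicator ?H (x, q) * w' (x, q) (0, 1, 0) \<partial>lborel) \<partial>lborel)"
    by (rule integral_lborel_prod_fst[OF int])
  also have "\<dots> = integral\<^sup>L lborel (\<lambda>x::real. 0)"
  proof (rule Bochner_Integration.integral_cong[OF refl])
    fix x :: real
    have "integrable lborel (\<lambda>q. indicator {q. snd q \<le> 0} q * w' (x, q) (0, 1, 0))"
    proof (rule integrable_indicator_compact_support)
      show "compact (snd ` K)"
        by (intro compact_continuous_image continuous_intros K)
      show "w' (x, q) (0, 1, 0) = 0" if "q \<notin> snd ` K" for q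
        using that by (intro zero) (metis image_eqI snd_conv)
      show "continuous_on UNIV (\<lambda>q. w' (x, q) (0, 1, 0))"
        by (intro C1_deriv_continuous_joint[OF w] continuous_intros)
      show "{q :: real \<times> real. snd q \<le> 0} \<in> sets borel"
        by (intro borel_closed closed_Collect_le continuous_intros)
    qed
    moreover have "indicator ?H (x, q) = (indicator {q. snd q \<le> 0} q :: real)" for q
      by (simp add: indicator_def)
    ultimately have "(\<integral>q. indicator ?H (x, q) * w' (x, q) (0, 1, 0) \<partial>lborel)
      = (\<integral>t. (\<integral>y. indicator ?H (x, y, t) * w' (x, y, t) (0, 1, 0) \<partial>lborel) \<partial>lborel)"
      using integral_lborel_prod_snd[of "\<lambda>q. indicator ?H (x, q) * w' (x, q) (0, 1, 0)"] by simp
    also have "\<dots> = integral\<^sup>L lborel (\<lambda>t::real. 0)"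
    proof (rule Bochner_Integration.integral_cong[OF refl])
      fix t :: real
      show "(\<integral>y. indicator ?H (x, y, t) * w' (x, y, t) (0, 1, 0) \<partial>lborel) = 0"
        using integral_deriv_line(1)[OF w K, of "(0, 1, 0)" "(x, 0, t)"]
        by (simp add: pH zero_prod_def)
    qed
    finally show "(\<integral>q. indicator ?H (x, q) * w' (x, q) (0, 1, 0) \<partial>lborel) = 0" by simp
  qed
  finally show "(\<integral>p. indicator ?H p * w' p (0, 1, 0) \<partial>lborel) = 0" by simp
  assume k: "continuous_on UNIV k"
  have "integrable lborel (\<lambda>p. indicator ?H p * (k (fst p, fst (snd p)) * w' p (0, 0, 1)))"
  proof (rule integrable_indicator_compact_support[OF _ K(1) _ H])
    show "continuous_on UNIV (\<lambda>p. k (fst p, fst (snd p)) * w' p (0, 0, 1))"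
      by (intro continuous_intros cont continuous_on_compose2[OF k]) auto
  qed (simp add: zero)
  then have "(\<integral>p. indicator ?H p * (k (fst p, fst (snd p)) * w' p (0, 0, 1)) \<partial>lborel)
    = (\<integral>z. (\<integral>t. k z * (indicator {..0} t * w' (fst z, snd z, t) (0, 0, 1)) \<partial>lborel) \<partial>lborel)"
    by (subst integral_heis_vertical) (simp_all add: pH ac_simps)
  also have "\<dots> = (\<integral>z. k z * w (fst z, snd z, 0) \<partial>lborel)"
  proof (rule Bochner_Integration.integral_cong[OF refl])
    fix z :: "real \<times> real"
    show "(\<integral>t. k z * (indicator {..0} t * w' (fst z, snd z, t) (0, 0, 1)) \<partial>lborel) = k z * w (fst z, snd z, 0)"
      using integral_deriv_line(2)[OF w K, of "(0, 0, 1)" "(fst z, snd z, 0)"]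
      by (simp add: zero_prod_def)
  qed
  finally show "(\<integral>p. indicator ?H p * (k (fst p, fst (snd p)) * w' p (0, 0, 1)) \<partial>lborel)
      = (\<integral>z. k z * w (fst z, snd z, 0) \<partial>lborel)" .
qed

section \<open>Subgraphs and integration over them\<close>

definition proj :: "heis \<Rightarrow> real \<times> real" where
  "proj p = (fst p, fst (snd p))"

definition lower :: "(real \<times> real \<Rightarrow> real) \<Rightarrow> heis set" where
  "lower f = {p. snd (snd p) \<le> f (proj p)}"

lemma proj_simps [simp]: "proj (x, y, t) = (x, y)"
  by (simp add: proj_def)

lemma continuous_on_proj [continuous_intros]:
  "continuous_on A g \<Longrightarrow> continuous_on A (\<lambda>p. proj (g p))"
  unfolding proj_def by (intro continuous_intros)

lemma lower_borel:
  assumes "continuous_on UNIV f"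
  shows "lower f \<in> sets borel"
  unfolding lower_def
  by (intro borel_closed closed_Collect_le continuous_intros continuous_on_compose2[OF assms]) auto

lemma C1_deriv_shear:
  assumes v: "C1_deriv v v'" and f: "C1_deriv f f'"
  shows "C1_deriv (\<lambda>p. v (fst p, fst (snd p), snd (snd p) + f (proj p)))
    (\<lambda>p u. v' (fst p, fst (snd p), snd (snd p) + f (proj p))
      (fst u, fst (snd u), snd (snd u) + f' (proj p) (proj u)))"
  unfolding C1_deriv_def
proof (intro conjI allI)
  fix p
  have proj: "(proj has_derivative proj) (at p)"
    unfolding proj_def by (auto intro!: derivative_eq_intros)
  have "((\<lambda>p. (fst p, fst (snd p), snd (snd p) + f (proj p))) has_derivative
    (\<lambda>u. (fst u, fst (snd u), snd (snd u) + f' (proj p) (proj u)))) (at p)"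
    by (auto intro!: derivative_eq_intros has_derivative_compose[OF proj C1_derivD[OF f]])
  from has_derivative_compose[OF this C1_derivD[OF v]]
  show "((\<lambda>p. v (fst p, fst (snd p), snd (snd p) + f (proj p))) has_derivative
    (\<lambda>u. v' (fst p, fst (snd p), snd (snd p) + f (proj p))
      (fst u, fst (snd u), snd (snd u) + f' (proj p) (proj u)))) (at p)" .
next
  fix u
  have "continuous_on UNIV (\<lambda>p. f' (proj p) (proj u))"
    by (intro C1_deriv_continuous_joint[OF f] continuous_intros)
  then show "continuous_on UNIV (\<lambda>p. v' (fst p, fst (snd p), snd (snd p) + f (proj p))
      (fst u, fst (snd u), snd (snd u) + f' (proj p) (proj u)))"
    by (intro C1_deriv_continuous_joint[OF v] continuous_intros
        continuous_on_compose2[OF C1_deriv_continuous[OF f, of UNIV]]) auto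
qed

text \<open>The shear \<open>t \<mapsto> t + f (x, y)\<close> reduces the subgraph of \<open>f\<close> to a half-space.\<close>

lemma integral_lower_deriv:
  fixes v :: "heis \<Rightarrow> real"
  assumes f: "C1_deriv f f'" and v: "C1_deriv v v'" and K: "compact K" "\<And>p. p \<notin> K \<Longrightarrow> v p = 0"
    and c: "continuous_on UNIV c"
  shows "(\<integral>p. indicator (lower f) p * v' p (a, b, c (proj p)) \<partial>lborel)
    = (\<integral>z. (c z - f' z (a, b)) * v (fst z, snd z, f z) \<partial>lborel)"
proof -
  define \<Psi> where "\<Psi> p = (fst p, fst (snd p), snd (snd p) + f (proj p))" for p :: heis
  \<comment> \<open>The preimage of \<open>K\<close> under \<open>\<Psi>\<close>, which carries the
    support of the sheared function \<open>w\<close>.\<close>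
  define K' where "K' = (\<lambda>p. (fst p, fst (snd p), snd (snd p) - f (proj p))) ` K"
  define w where "w p = v (\<Psi> p)" for p
  define w' where "w' p u = v' (\<Psi> p) (fst u, fst (snd u), snd (snd u) + f' (proj p) (proj u))" for p u
  let ?H = "{p :: heis. snd (snd p) \<le> 0}"
  have w: "C1_deriv w w'"
    unfolding w_def[abs_def] w'_def[abs_def] \<Psi>_def by (rule C1_deriv_shear[OF v f])
  have fc: "continuous_on A f" for A by (rule C1_deriv_continuous[OF f])
  have \<Psi>c: "continuous_on A \<Psi>" for A
    unfolding \<Psi>_def by (intro continuous_intros continuous_on_compose2[OF fc[of UNIV]]) auto
  have K'c: "compact K'"
    unfolding K'_def
    by (intro compact_continuous_image continuous_intros continuous_on_compose2[OF fc[of UNIV]] K) auto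
  have \<Psi>K: "\<Psi> p \<notin> K" if "p \<notin> K'" for p
  proof
    assume "\<Psi> p \<in> K"
    then have "(\<lambda>p. (fst p, fst (snd p), snd (snd p) - f (proj p))) (\<Psi> p) \<in> K'"
      unfolding K'_def by (rule imageI)
    then show False using that by (simp add: \<Psi>_def proj_def)
  qed
  have zero: "v' p u = 0" if "p \<notin> K" for p u
    using C1_deriv_zero_outside[OF v compact_imp_closed[OF K(1)] K(2)] that by blast
  have H: "?H \<in> sets borel"
    by (intro borel_closed closed_Collect_le continuous_intros)
  have cc: "continuous_on A (\<lambda>p. c (proj p))" for A
    by (intro continuous_on_compose2[OF c] continuous_intros) auto
  have int1: "integrable lborel (\<lambda>p. indicator (lower f) p * v' p (a, b, c (proj p)))"
    by (rule integrable_indicator_compact_support[OF _ K(1) _ lower_borel[OF fc]])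
      (auto simp: zero intro!: C1_deriv_continuous_joint[OF v] continuous_intros cc)
  have int2: "integrable lborel (\<lambda>p. indicator ?H p * v' (\<Psi> p) (a, b, c (proj p)))"
    by (rule integrable_indicator_compact_support[OF _ K'c _ H])
      (auto simp: zero \<Psi>K intro!: C1_deriv_continuous_joint[OF v] continuous_intros cc \<Psi>c)
  have "(\<integral>p. indicator (lower f) p * v' p (a, b, c (proj p)) \<partial>lborel)
     = (\<integral>z. (\<integral>t. indicator (lower f) (fst z, snd z, t) * v' (fst z, snd z, t) (a, b, c z) \<partial>lborel) \<partial>lborel)"
    using integral_heis_vertical(1)[OF int1] by simp
  also have "\<dots> = (\<integral>z. (\<integral>t. indicator ?H (fst z, snd z, t) * v' (\<Psi> (fst z, snd z, t)) (a, b, c z) \<partial>lborel) \<partial>lborel)"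
  proof (rule Bochner_Integration.integral_cong[OF refl])
    fix z :: "real \<times> real"
    \<comment> \<open>On each vertical line the shear is the translation by \<open>f z\<close>, of
      Jacobian one.\<close>
    show "(\<integral>t. indicator (lower f) (fst z, snd z, t) * v' (fst z, snd z, t) (a, b, c z) \<partial>lborel)
      = (\<integral>t. indicator ?H (fst z, snd z, t) * v' (\<Psi> (fst z, snd z, t)) (a, b, c z) \<partial>lborel)"
      by (subst lborel_integral_real_affine[of 1 _ "f z"])
        (simp_all add: lower_def \<Psi>_def indicator_def add.commute)
  qed
  also have "\<dots> = (\<integral>p. indicator ?H p * v' (\<Psi> p) (a, b, c (proj p)) \<partial>lborel)"
    using integral_heis_vertical(1)[OF int2] by simp
  also have "\<dots> = (\<integral>p. a * (indicator ?H p * w' p (1, 0, 0)) + b * (indicator ?H p * w' p (0, 1, 0))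
      + indicator ?H p * ((c (proj p) - f' (proj p) (a, b)) * w' p (0, 0, 1)) \<partial>lborel)"
  proof (rule Bochner_Integration.integral_cong[OF refl])
    fix p :: heis
    note lw = C1_deriv_linear[OF w, of p] and lf = C1_deriv_linear[OF f, of "proj p"]
    \<comment> \<open>By the chain rule, the direction (a, b, c) for \<open>v\<close> corresponds to
      (a, b, c - f' (a, b)) for \<open>w\<close>; the corrected last entry is the factor in the
      boundary integral.\<close>
    have "w' p (a, b, c (proj p) - f' (proj p) (a, b)) = v' (\<Psi> p) (a, b, c (proj p))"
      by (simp add: w'_def proj_def)
    moreover have "(a, b, d) = a *\<^sub>R (1, 0, 0) + b *\<^sub>R (0, 1, 0) + d *\<^sub>R (0, 0, 1)" for d :: real
      by simp
    then have "w' p (a, b, d) = a * w' p (1, 0, 0) + b * w' p (0, 1, 0) + d * w' p (0, 0, 1)" for d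
      by (simp only: linear_add[OF lw] linear_scale[OF lw]) simp
    ultimately have "v' (\<Psi> p) (a, b, c (proj p)) = a * w' p (1, 0, 0) + b * w' p (0, 1, 0)
        + (c (proj p) - f' (proj p) (a, b)) * w' p (0, 0, 1)"
      by metis
    then show "indicator ?H p * v' (\<Psi> p) (a, b, c (proj p)) = a * (indicator ?H p * w' p (1, 0, 0))
      + b * (indicator ?H p * w' p (0, 1, 0)) + indicator ?H p * ((c (proj p) - f' (proj p) (a, b)) * w' p (0, 0, 1))"
      by (cases "p \<in> ?H") simp_all
  qed
  also have "\<dots> = (\<integral>z. (c z - f' z (a, b)) * w (fst z, snd z, 0) \<partial>lborel)"
  proof -
    have w0: "w p = 0" if "p \<notin> K'" for p
      using \<Psi>K[OF that] K(2) by (simp add: w_def)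
    have w0': "w' p u = 0" if "p \<notin> K'" for p u
      using C1_deriv_zero_outside[OF w compact_imp_closed[OF K'c] w0] that by blast
    have k: "continuous_on UNIV (\<lambda>z. c z - f' z (a, b))"
      by (intro continuous_intros c C1_deriv_continuous_deriv[OF f])
    have "continuous_on UNIV (\<lambda>p. (c (proj p) - f' (proj p) (a, b)) * w' p (0, 0, 1))"
      by (intro continuous_intros cc C1_deriv_continuous_deriv[OF w] C1_deriv_continuous_joint[OF f])
    then have "integrable lborel (\<lambda>p. indicator ?H p * ((c (proj p) - f' (proj p) (a, b)) * w' p (0, 0, 1)))"
      by (rule integrable_indicator_compact_support[OF _ K'c _ H]) (simp add: w0')
    moreover have "integrable lborel (\<lambda>p. indicator ?H p * w' p u)" for u
      by (rule integrable_indicator_compact_support[OF C1_deriv_continuous_deriv[OF w] K'c _ H]) (simp add: w0')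
    ultimately show ?thesis
      using integral_lower_half_deriv[OF w K'c w0] integral_lower_half_deriv(3)[OF w K'c w0 k]
      by (simp add: proj_def)
  qed
  finally show ?thesis by (simp add: w_def \<Psi>_def)
qed

section \<open>Horizontal divergence and perimeter of subgraphs\<close>

text \<open>The coefficients \<open>(X (t - f), Y (t - f))\<close> of the horizontal normal of the graph of \<open>f\<close>.\<close>

definition hgrad :: "(real \<times> real \<Rightarrow> real \<times> real \<Rightarrow> real) \<Rightarrow> real \<times> real \<Rightarrow> real \<times> real" where
  "hgrad f' z = (snd z - f' z (1, 0), - fst z - f' z (0, 1))"

lemma continuous_on_hgrad: "C1_deriv f f' \<Longrightarrow> continuous_on A (hgrad f')"
  unfolding hgrad_def[abs_def] by (intro continuous_intros C1_deriv_continuous_deriv)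

lemma X_field_eq: "X_field p = (1, 0, snd (proj p))" and Y_field_eq: "Y_field p = (0, 1, - fst (proj p))"
  by (cases p; simp)+

lemma hdiv_C1_deriv:
  assumes "C1_deriv V V'"
  shows "hdiv V p = fst (V' p (X_field p)) + snd (V' p (Y_field p))"
proof -
  have "frechet_derivative (\<lambda>q. fst (V q)) (at p) = (\<lambda>v. fst (V' p v))"
    "frechet_derivative (\<lambda>q. snd (V q)) (at p) = (\<lambda>v. snd (V' p v))"
    by (intro frechet_derivative_at[symmetric] has_derivative_fst has_derivative_snd C1_derivD[OF assms])+
  then show ?thesis by (simp add: hdiv_def field_deriv_def)
qed

lemma C1_deriv_fst: "C1_deriv V V' \<Longrightarrow> C1_deriv (\<lambda>p. fst (V p)) (\<lambda>p v. fst (V' p v))"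
  and C1_deriv_snd: "C1_deriv V V' \<Longrightarrow> C1_deriv (\<lambda>p. snd (V p)) (\<lambda>p v. snd (V' p v))"
  by (auto simp: C1_deriv_def intro!: derivative_intros continuous_intros)

lemma continuous_on_hdiv:
  assumes "C1_deriv V V'"
  shows "continuous_on A (hdiv V)"
  unfolding hdiv_C1_deriv[OF assms, abs_def] X_field_eq Y_field_eq
  by (intro continuous_intros C1_deriv_continuous_joint[OF assms])

lemma hdiv_zero_outside:
  assumes "C1_deriv V V'" "compact K" "\<And>p. p \<notin> K \<Longrightarrow> V p = 0" "p \<notin> K"
  shows "hdiv V p = 0"
  using C1_deriv_zero_outside[OF assms(1) compact_imp_closed[OF assms(2)] assms(3,4)]
  by (simp add: hdiv_C1_deriv[OF assms(1)])

text \<open>The t-coefficients y and - x of X and Y depend only on the projection, so each component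
  falls under \<open>integral_lower_deriv\<close>, and the two boundary factors are the components
  of \<open>hgrad\<close>.\<close>

lemma integral_lower_hdiv:
  assumes f: "C1_deriv f f'" and V: "C1_deriv V V'" and K: "compact K" "\<And>p. p \<notin> K \<Longrightarrow> V p = 0"
  shows "(\<integral>p. indicator (lower f) p * hdiv V p \<partial>lborel) = (\<integral>z. hgrad f' z \<bullet> V (fst z, snd z, f z) \<partial>lborel)"
proof -
  let ?v1 = "\<lambda>p. fst (V p)" and ?v2 = "\<lambda>p. snd (V p)"
  let ?V1 = "\<lambda>p v. fst (V' p v)" and ?V2 = "\<lambda>p v. snd (V' p v)"
  have V1: "C1_deriv ?v1 ?V1" and V2: "C1_deriv ?v2 ?V2"
    by (rule C1_deriv_fst[OF V], rule C1_deriv_snd[OF V])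
  have K1: "?v1 p = 0" and K2: "?v2 p = 0" if "p \<notin> K" for p
    using K(2)[OF that] by auto
  have fc: "continuous_on A f" for A by (rule C1_deriv_continuous[OF f])
  note z1 = C1_deriv_zero_outside[OF V1 compact_imp_closed[OF K(1)] K1]
    and z2 = C1_deriv_zero_outside[OF V2 compact_imp_closed[OF K(1)] K2]
  have i1: "integrable lborel (\<lambda>p. indicator (lower f) p * ?V1 p (1, 0, snd (proj p)))"
    by (rule integrable_indicator_compact_support[OF _ K(1) _ lower_borel[OF fc]])
      (auto simp: z1 intro!: C1_deriv_continuous_joint[OF V] continuous_intros)
  have i2: "integrable lborel (\<lambda>p. indicator (lower f) p * ?V2 p (0, 1, - fst (proj p)))"
    by (rule integrable_indicator_compact_support[OF _ K(1) _ lower_borel[OF fc]])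
      (auto simp: z2 intro!: C1_deriv_continuous_joint[OF V] continuous_intros)
  have proj_K: "compact (proj ` K)"
    by (intro compact_continuous_image continuous_intros K)
  have off: "V (fst z, snd z, f z) = 0" if "z \<notin> proj ` K" for z
    using that K(2) by (metis image_eqI proj_simps prod.collapse)
  have Vc: "continuous_on UNIV (\<lambda>z. V (fst z, snd z, f z))"
    by (intro continuous_on_compose2[OF C1_deriv_continuous[OF V, of UNIV]] continuous_intros fc) auto
  have j1: "integrable lborel (\<lambda>z. (snd z - f' z (1, 0)) * fst (V (fst z, snd z, f z)))"
    by (rule integrable_continuous_compact_support[OF _ proj_K])
      (use off Vc in \<open>auto intro!: continuous_intros C1_deriv_continuous_deriv[OF f]\<close>)
  have j2: "integrable lborel (\<lambda>z. (- fst z - f' z (0, 1)) * snd (V (fst z, snd z, f z)))"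
    by (rule integrable_continuous_compact_support[OF _ proj_K])
      (use off Vc in \<open>auto intro!: continuous_intros C1_deriv_continuous_deriv[OF f]\<close>)
  have "(\<integral>p. indicator (lower f) p * hdiv V p \<partial>lborel)
    = (\<integral>p. indicator (lower f) p * ?V1 p (1, 0, snd (proj p)) + indicator (lower f) p * ?V2 p (0, 1, - fst (proj p)) \<partial>lborel)"
    by (simp add: hdiv_C1_deriv[OF V] X_field_eq Y_field_eq algebra_simps)
  also have "\<dots> = (\<integral>z. (snd z - f' z (1, 0)) * fst (V (fst z, snd z, f z)) \<partial>lborel)
      + (\<integral>z. (- fst z - f' z (0, 1)) * snd (V (fst z, snd z, f z)) \<partial>lborel)"
    using i1 i2 integral_lower_deriv[OF f V1 K(1) K1, of snd 1 0] integral_lower_deriv[OF f V2 K(1) K2, of "\<lambda>z. - fst z" 0 1]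
    by (simp add: continuous_intros)
  also have "\<dots> = (\<integral>z. hgrad f' z \<bullet> V (fst z, snd z, f z) \<partial>lborel)"
    using j1 j2 by (simp add: hgrad_def inner_prod_def)
  finally show ?thesis .
qed

lemma C1_deriv_const: "C1_deriv (\<lambda>_. c) (\<lambda>_ _. 0)"
  by (auto simp: C1_deriv_def)

text \<open>A horizontal plane above the support bounds a subgraph that contains the support, and
  its boundary term vanishes.\<close>

lemma integral_hdiv:
  assumes V: "C1_deriv V V'" and K: "compact K" "\<And>p. p \<notin> K \<Longrightarrow> V p = 0"
  shows "(\<integral>p. hdiv V p \<partial>lborel) = 0"
proof -
  obtain R where R: "\<And>p. p \<in> K \<Longrightarrow> norm p \<le> R"
    using compact_imp_bounded[OF K(1)] unfolding bounded_iff by auto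
  have t: "snd (snd p) \<le> R" if "p \<in> K" for p
    using R[OF that] norm_snd_le[of "snd p" "fst (snd p)"] norm_snd_le[of "snd p" "fst p"]
    by (metis abs_le_D1 norm_snd_le order_trans prod.collapse real_norm_def)
  have eq: "(\<lambda>p. indicator (lower (\<lambda>_. R + 1)) p * hdiv V p) = hdiv V"
  proof
    show "indicator (lower (\<lambda>_. R + 1)) p * hdiv V p = hdiv V p" for p
      using t[of p] hdiv_zero_outside[OF V K, of p] by (cases "p \<in> K") (auto simp: lower_def indicator_def)
  qed
  have "V (fst z, snd z, R + 1) = 0" for z
    using t[of "(fst z, snd z, R + 1)"] K(2) by force
  then show ?thesis
    using integral_lower_hdiv[OF C1_deriv_const[of "R + 1"] V K] unfolding eq by simp
qed

section \<open>Test fields, perimeter and complements\<close>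

lemma test_fieldsE:
  assumes "V \<in> test_fields \<Omega>"
  obtains V' K where "C1_deriv V V'" "compact K" "K \<subseteq> \<Omega>" "\<And>p. p \<notin> K \<Longrightarrow> V p = 0" "\<And>p. norm (V p) \<le> 1"
proof
  show "C1_deriv V (\<lambda>p. frechet_derivative V (at p))"
    using assms by (intro Ck_on_imp_C1_deriv) (simp add: test_fields_def)
  show "compact (closure {p. V p \<noteq> 0})" "closure {p. V p \<noteq> 0} \<subseteq> \<Omega>" "norm (V p) \<le> 1" for p
    using assms by (simp_all only: test_fields_def mem_Collect_eq)
  show "V p = 0" if "p \<notin> closure {p. V p \<noteq> 0}" for p
    using that closure_subset[of "{p. V p \<noteq> 0}"] by blast
qed

lemma test_fieldsI:
  assumes "C1_deriv V V'" "compact K" "K \<subseteq> \<Omega>" "\<And>p. p \<notin> K \<Longrightarrow> V p = 0" "\<And>p. norm (V p) \<le> 1"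
  shows "V \<in> test_fields \<Omega>"
proof -
  have "{p. V p \<noteq> 0} \<subseteq> K" using assms(4) by blast
  then have "closure {p. V p \<noteq> 0} \<subseteq> K"
    by (rule closure_minimal[OF _ compact_imp_closed[OF assms(2)]])
  then have "compact (closure {p. V p \<noteq> 0})" "closure {p. V p \<noteq> 0} \<subseteq> \<Omega>"
    using assms(2,3) by (meson bounded_subset closed_closure compact_eq_bounded_closed order_trans)+
  then show ?thesis
    using C1_deriv_imp_Ck_on[OF assms(1)] assms(5) by (simp add: test_fields_def)
qed

lemma integrable_hdiv:
  assumes "V \<in> test_fields \<Omega>"
  shows "integrable lborel (hdiv V)"
proof -
  obtain V' K where V: "C1_deriv V V'" "compact K" "K \<subseteq> \<Omega>" "\<And>p. p \<notin> K \<Longrightarrow> V p = 0" "\<And>p. norm (V p) \<le> 1"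
    using test_fieldsE[OF assms] by blast
  show ?thesis
    by (rule integrable_continuous_compact_support[OF continuous_on_hdiv[OF V(1)] V(2) hdiv_zero_outside[OF V(1,2,4)]])
qed

text \<open>\<open>E\<close> is only Lebesgue measurable; a Borel set that agrees with it almost
  everywhere gives access to Fubini for \<open>lborel\<close>.\<close>

lemma LINT_lebesgue_eq_lborel:
  fixes h :: "'a::euclidean_space \<Rightarrow> real"
  assumes "E \<in> sets lebesgue" "B \<in> sets borel" "AE p in lborel. p \<in> E \<longleftrightarrow> p \<in> B" "h \<in> borel_measurable borel"
  shows "(LINT p:E|lebesgue. h p) = (\<integral>p. indicator B p * h p \<partial>lborel)"
proof -
  have h: "h \<in> borel_measurable lebesgue"
    using measurable_completion[of h lborel borel] assms(4) by simp
  have B: "B \<in> sets lebesgue"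
    using sets_completionI_sets[of B lborel] assms(2) by simp
  have "(LINT p:E|lebesgue. h p) = (LINT p|lebesgue. indicator B p * h p)"
    unfolding set_lebesgue_integral_def
  proof (rule integral_cong_AE)
    show "AE p in lebesgue. indicator E p *\<^sub>R h p = indicator B p * h p"
      using AE_completion[OF assms(3)] by eventually_elim (auto simp: indicator_def)
  qed (use h assms(1) B in auto)
  also have "\<dots> = (\<integral>p. indicator B p * h p \<partial>lborel)"
    using assms(2,4) by (intro integral_completion) auto
  finally show ?thesis .
qed

lemma hdiv_borel: "V \<in> test_fields \<Omega> \<Longrightarrow> hdiv V \<in> borel_measurable borel"
  by (elim test_fieldsE) (auto intro: borel_measurable_continuous_onI continuous_on_hdiv)

lemma uminus_test_fields:
  assumes "V \<in> test_fields \<Omega>"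
  shows "(\<lambda>p. - V p) \<in> test_fields \<Omega>" "hdiv (\<lambda>p. - V p) p = - hdiv V p"
proof -
  obtain V' K where V: "C1_deriv V V'" "compact K" "K \<subseteq> \<Omega>" "\<And>p. p \<notin> K \<Longrightarrow> V p = 0" "\<And>p. norm (V p) \<le> 1"
    using test_fieldsE[OF assms] by blast
  have V': "C1_deriv (\<lambda>p. - V p) (\<lambda>p v. - V' p v)"
    using V(1) by (auto simp: C1_deriv_def intro!: derivative_intros continuous_intros)
  show "(\<lambda>p. - V p) \<in> test_fields \<Omega>"
    by (rule test_fieldsI[OF V' V(2,3)]) (use V(4,5) in auto)
  show "hdiv (\<lambda>p. - V p) p = - hdiv V p"
    by (simp add: hdiv_C1_deriv[OF V(1)] hdiv_C1_deriv[OF V'])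
qed

lemma perimeter_leI:
  assumes "\<And>V. V \<in> test_fields \<Omega> \<Longrightarrow> (LINT p:E|lebesgue. hdiv V p) \<le> A"
  shows "perimeter E \<Omega> \<le> ereal A"
  unfolding perimeter_def by (intro SUP_least) (simp add: assms)

lemma LINT_le_perimeter:
  "V \<in> test_fields \<Omega> \<Longrightarrow> ereal (LINT p:E|lebesgue. hdiv V p) \<le> perimeter E \<Omega>"
  unfolding perimeter_def by (intro SUP_upper)

text \<open>A test field has total divergence zero, so its integral over the complement is that of -
  V over \<open>E\<close>. This settles the question on which side of the graph a minimizer
  lies.\<close>

lemma perimeter_Compl:
  assumes "E \<in> sets lebesgue"
  shows "perimeter (- E) \<Omega> = perimeter E \<Omega>"
proof -
  have le: "perimeter (- E) \<Omega> \<le> perimeter E \<Omega>" if E: "E \<in> sets lebesgue" for E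
    unfolding perimeter_def
  proof (rule SUP_mono)
    fix V assume V: "V \<in> test_fields \<Omega>"
    have int: "integrable lebesgue (hdiv V)"
      using integrable_hdiv[OF V] hdiv_borel[OF V] by (simp add: integrable_completion)
    have i: "set_integrable lebesgue E (hdiv V)"
      unfolding set_integrable_def by (rule integrable_mult_indicator[OF E int])
    have "(LINT p|lebesgue. hdiv V p) = 0"
      using V by (elim test_fieldsE) (simp add: integral_completion hdiv_borel[OF V] integral_hdiv)
    moreover have "(LINT p:(- E)|lebesgue. hdiv V p) = (LINT p|lebesgue. hdiv V p - indicator E p *\<^sub>R hdiv V p)"
      unfolding set_lebesgue_integral_def
      by (intro Bochner_Integration.integral_cong refl) (auto simp: indicator_def)
    ultimately have "(LINT p:(- E)|lebesgue. hdiv V p) = - (LINT p:E|lebesgue. hdiv V p)"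
      using int i unfolding set_lebesgue_integral_def set_integrable_def by simp
    also have "\<dots> = (LINT p:E|lebesgue. hdiv (\<lambda>p. - V p) p)"
      by (simp add: uminus_test_fields(2)[OF V] set_lebesgue_integral_def)
    finally show "\<exists>W\<in>test_fields \<Omega>. ereal (LINT p:(- E)|lebesgue. hdiv V p) \<le> ereal (LINT p:E|lebesgue. hdiv W p)"
      using uminus_test_fields(1)[OF V] by auto
  qed
  have "- E \<in> sets lebesgue"
    using sets.compl_sets[OF assms] by (simp add: Compl_eq_Diff_UNIV)
  then show ?thesis
    using le[OF assms] le[of "- E"] by simp
qed

lemma loc_finite_perimeter_Compl: "loc_finite_perimeter E \<Longrightarrow> loc_finite_perimeter (- E)"
  using perimeter_Compl[of E] sets.compl_sets[of E lebesgue]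
  by (simp add: loc_finite_perimeter_def Compl_eq_Diff_UNIV)

lemma local_perimeter_minimizer_Compl:
  assumes "local_perimeter_minimizer E" "E \<in> sets lebesgue"
  shows "local_perimeter_minimizer (- E)"
  unfolding local_perimeter_minimizer_def perimeter_minimizer_in_def
proof (intro allI impI, elim conjE)
  fix \<Omega> F assume F: "open \<Omega>" "bounded \<Omega>" "loc_finite_perimeter F"
    "compact (closure (sym_diff (- E) F))" "closure (sym_diff (- E) F) \<subseteq> \<Omega>"
  have "sym_diff (- E) F = sym_diff E (- F)" by auto
  then have "perimeter E \<Omega> \<le> perimeter (- F) \<Omega>"
    using assms(1) F loc_finite_perimeter_Compl[OF F(3)]
    unfolding local_perimeter_minimizer_def perimeter_minimizer_in_def by auto
  then show "perimeter (- E) \<Omega> \<le> perimeter F \<Omega>"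
    using perimeter_Compl assms(2) F(3) by (simp add: loc_finite_perimeter_def)
qed

lemma integrable_indicator_bounded:
  fixes f :: "'a::euclidean_space \<Rightarrow> real"
  assumes "continuous_on UNIV f" "bounded D" "D \<in> sets borel"
  shows "integrable lborel (\<lambda>x. indicator D x * f x)"
proof -
  have "integrable lborel (\<lambda>x. indicator D x *\<^sub>R (indicator (closure D) x *\<^sub>R f x))"
    using assms by (intro integrable_mult_indicator borel_integrable_compact)
      (auto intro: continuous_on_subset)
  moreover have "(\<lambda>x. indicator D x *\<^sub>R (indicator (closure D) x *\<^sub>R f x)) = (\<lambda>x. indicator D x * f x)"
    using closure_subset[of D] by (auto simp: indicator_def fun_eq_iff)
  ultimately show ?thesis by metis
qed

text \<open>Cauchy-Schwarz after the divergence theorem: the integrand vanishes unless the graph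
  point over z lies in \<open>\<Omega>\<close>, and then z is in \<open>D\<close>. The bound holds
  for every C^1 function, thus for all graphical competitors.\<close>

lemma perimeter_lower_le:
  assumes E: "E \<in> sets lebesgue" "AE p in lborel. p \<in> E \<longleftrightarrow> p \<in> lower f" and f: "C1_deriv f f'"
    and D: "bounded D" "D \<in> sets borel" "\<And>p. p \<in> \<Omega> \<Longrightarrow> proj p \<in> D"
  shows "perimeter E \<Omega> \<le> ereal (\<integral>z. indicator D z * norm (hgrad f' z) \<partial>lborel)"
proof (rule perimeter_leI)
  fix V assume V: "V \<in> test_fields \<Omega>"
  obtain V' K where VK: "C1_deriv V V'" "compact K" "K \<subseteq> \<Omega>" "\<And>p. p \<notin> K \<Longrightarrow> V p = 0" "\<And>p. norm (V p) \<le> 1"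
    using test_fieldsE[OF V] by blast
  have fc: "continuous_on A f" for A by (rule C1_deriv_continuous[OF f])
  have "(LINT p:E|lebesgue. hdiv V p) = (\<integral>z. hgrad f' z \<bullet> V (fst z, snd z, f z) \<partial>lborel)"
    using LINT_lebesgue_eq_lborel[OF E(1) lower_borel[OF fc] E(2) hdiv_borel[OF V]]
      integral_lower_hdiv[OF f VK(1,2,4)] by simp
  also have "\<dots> \<le> (\<integral>z. indicator D z * norm (hgrad f' z) \<partial>lborel)"
  proof (rule integral_mono)
    have "compact (proj ` K)"
      by (intro compact_continuous_image continuous_intros VK)
    moreover have "V (fst z, snd z, f z) = 0" if "z \<notin> proj ` K" for z
      using that VK(4) by (metis image_eqI proj_simps prod.collapse)
    moreover have "continuous_on UNIV (\<lambda>z. V (fst z, snd z, f z))"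
      by (intro continuous_on_compose2[OF C1_deriv_continuous[OF VK(1), of UNIV]] continuous_intros fc) auto
    then have "continuous_on UNIV (\<lambda>z. hgrad f' z \<bullet> V (fst z, snd z, f z))"
      by (intro continuous_intros continuous_on_hgrad[OF f])
    ultimately show "integrable lborel (\<lambda>z. hgrad f' z \<bullet> V (fst z, snd z, f z))"
      by (intro integrable_continuous_compact_support) auto
    show "integrable lborel (\<lambda>z. indicator D z * norm (hgrad f' z))"
      by (intro integrable_indicator_bounded D continuous_intros continuous_on_hgrad[OF f])
    fix z
    show "hgrad f' z \<bullet> V (fst z, snd z, f z) \<le> indicator D z * norm (hgrad f' z)"
    proof (cases "(fst z, snd z, f z) \<in> K")
      case True
      then have "z \<in> D" using VK(3) D(3) by fastforce
      moreover have "hgrad f' z \<bullet> V (fst z, snd z, f z) \<le> norm (hgrad f' z) * 1"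
        by (rule order_trans[OF norm_cauchy_schwarz]) (intro mult_left_mono VK norm_ge_zero)
      ultimately show ?thesis by simp
    qed (simp add: VK(4))
  qed
  finally show "(LINT p:E|lebesgue. hdiv V p) \<le> (\<integral>z. indicator D z * norm (hgrad f' z) \<partial>lborel)" .
qed

lemma loc_finite_perimeter_lower:
  assumes E: "E \<in> sets lebesgue" "AE p in lborel. p \<in> E \<longleftrightarrow> p \<in> lower f" and f: "C1_deriv f f'"
  shows "loc_finite_perimeter E"
  unfolding loc_finite_perimeter_def
proof (intro conjI allI impI, rule E(1), elim conjE)
  fix \<Omega> :: "heis set" assume \<Omega>: "open \<Omega>" "bounded \<Omega>"
  have "bounded (proj ` closure \<Omega>)"
    using \<Omega> by (intro compact_imp_bounded compact_continuous_image continuous_intros) simp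
  moreover have "proj ` closure \<Omega> \<in> sets borel"
    using \<Omega> by (intro borel_compact compact_continuous_image continuous_intros) simp
  ultimately have "perimeter E \<Omega> \<le> ereal (\<integral>z. indicator (proj ` closure \<Omega>) z * norm (hgrad f' z) \<partial>lborel)"
    using closure_subset[of \<Omega>] by (intro perimeter_lower_le[OF E f]) auto
  then show "perimeter E \<Omega> < \<infinity>" by (rule order_le_less_trans) simp
qed

section \<open>Sets without perimeter in a box\<close>

text \<open>Two derivatives are recorded because the commutator argument differentiates functions
  that already contain first derivatives.\<close>

definition C2_supp :: "real \<Rightarrow> real \<Rightarrow> (real \<Rightarrow> real) \<Rightarrow> (real \<Rightarrow> real) \<Rightarrow> (real \<Rightarrow> real) \<Rightarrow> bool" where
  "C2_supp a b f f1 f2 \<longleftrightarrow> (\<forall>x. (f has_real_derivative f1 x) (at x)) \<and>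
    (\<forall>x. (f1 has_real_derivative f2 x) (at x)) \<and> continuous_on UNIV f2 \<and> (\<forall>x. x \<notin> {a..b} \<longrightarrow> f x = 0)"

lemma C2_suppD:
  assumes "C2_supp a b f f1 f2"
  shows "(f has_real_derivative f1 x) (at x)" "(f1 has_real_derivative f2 x) (at x)"
    "continuous_on A f" "continuous_on A f1" "continuous_on A f2" "x \<notin> {a..b} \<Longrightarrow> f x = 0"
    "x \<notin> {a..b} \<Longrightarrow> f1 x = 0" "x \<notin> {a..b} \<Longrightarrow> f2 x = 0"
proof -
  show d: "(f has_real_derivative f1 x) (at x)" "(f1 has_real_derivative f2 x) (at x)" for x
    using assms by (auto simp: C2_supp_def)
  show "continuous_on A f" "continuous_on A f1" "continuous_on A f2"
    using assms d by (auto intro: continuous_on_subset DERIV_continuous_on[OF has_field_derivative_at_within] simp: C2_supp_def)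
  have z: "f x = 0" if "x \<notin> {a..b}" for x
    using assms that by (auto simp: C2_supp_def)
  have z': "g' x = 0" if "\<And>x. x \<notin> {a..b} \<Longrightarrow> g x = 0" "\<And>x. (g has_real_derivative g' x) (at x)" "x \<notin> {a..b}"
    for g g' :: "real \<Rightarrow> real" and x
  proof -
    have "(g has_real_derivative 0) (at x)"
      by (rule has_field_derivative_transform_within_open[of "\<lambda>_. 0" _ _ "- {a..b}"]) (use that in auto)
    then show ?thesis using DERIV_unique that(2) by blast
  qed
  show "x \<notin> {a..b} \<Longrightarrow> f x = 0" by (rule z)
  show "x \<notin> {a..b} \<Longrightarrow> f1 x = 0" by (rule z'[OF z d(1)])
  show "x \<notin> {a..b} \<Longrightarrow> f2 x = 0" by (rule z'[OF z'[OF z d(1)] d(2)])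
qed

lemma C2_supp_mono: "C2_supp a b f f1 f2 \<Longrightarrow> a' \<le> a \<Longrightarrow> b \<le> b' \<Longrightarrow> C2_supp a' b' f f1 f2"
  by (auto simp: C2_supp_def)

text \<open>Absorbs the coefficients x and y of the horizontal fields into the factors of a product
  test function.\<close>

lemma C2_supp_mult_id:
  assumes "C2_supp a b f f1 f2"
  shows "C2_supp a b (\<lambda>x. x * f x) (\<lambda>x. f x + x * f1 x) (\<lambda>x. 2 * f1 x + x * f2 x)"
  using assms C2_suppD(3,4)[OF assms] unfolding C2_supp_def
  by (auto intro!: derivative_eq_intros continuous_intros)

lemma C2_supp_lincomb:
  assumes "C2_supp a b f f1 f2" "C2_supp a b g g1 g2"
  shows "C2_supp a b (\<lambda>x. c * f x - d * g x) (\<lambda>x. c * f1 x - d * g1 x) (\<lambda>x. c * f2 x - d * g2 x)"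
  using assms unfolding C2_supp_def
  by (auto intro!: derivative_eq_intros continuous_intros)

lemma C2_supp_integrable: "C2_supp a b f f1 f2 \<Longrightarrow> integrable lborel f"
  by (rule integrable_continuous_compact_support[of _ "{a..b}"]) (auto dest: C2_suppD)

text \<open>The primitive is normalized to vanish at a; vanishing mean makes it return to zero to
  the right of b.\<close>

lemma C2_supp_primitive:
  assumes f: "C2_supp a b f f1 f2" and int: "(\<integral>x. f x \<partial>lborel) = 0" and ab: "a \<le> b"
  obtains F where "C2_supp a b F f f1"
proof -
  have "\<exists>F. \<forall>x :: real. (-\<infinity>::ereal) < x \<longrightarrow> x < (\<infinity>::ereal) \<longrightarrow> (F has_vector_derivative f x) (at x)"
    using C2_suppD(3)[OF f, of UNIV]
    by (intro einterval_antiderivative) (auto simp: continuous_on_eq_continuous_at)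
  then obtain F where F: "\<And>x. (F has_real_derivative f x) (at x)"
    by (auto simp: has_real_derivative_iff_has_vector_derivative)
  have isC: "isCont f x" for x
    using C2_suppD(3)[OF f, of UNIV] by (simp add: continuous_on_eq_continuous_at)
  have "F x - F a = 0" if "x \<notin> {a..b}" for x
  proof (cases "x < a")
    case True
    then have "(\<integral>y. f y * indicator {x..a} y \<partial>lborel) = F a - F x"
      by (intro integral_FTC_Icc_real F isC) auto
    moreover have "(\<integral>y. f y * indicator {x..a} y \<partial>lborel) = integral\<^sup>L lborel (\<lambda>_::real. 0::real)"
    proof (rule integral_cong_AE)
      show "AE y in lborel. f y * indicator {x..a} y = 0"
        using AE_lborel_singleton[of a]
        by eventually_elim (use C2_suppD(6)[OF f] in \<open>auto simp: indicator_def\<close>)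
      show "(\<lambda>y. f y * indicator {x..a} y) \<in> borel_measurable lborel"
        using borel_measurable_continuous_onI[OF C2_suppD(3)[OF f]] by measurable
    qed auto
    ultimately show ?thesis by simp
  next
    case False
    then have "x > b" using that by auto
    then have "(\<integral>y. f y * indicator {a..x} y \<partial>lborel) = F x - F a"
      using ab by (intro integral_FTC_Icc_real F isC) auto
    moreover have "(\<lambda>y. f y * indicator {a..x} y) = f"
      using C2_suppD(6)[OF f] \<open>x > b\<close> by (fastforce simp: indicator_def)
    ultimately show ?thesis using int by simp
  qed
  moreover have "((\<lambda>x. F x - F a) has_real_derivative f x) (at x)" for x
    using F by (auto intro!: derivative_eq_intros)
  ultimately have "C2_supp a b (\<lambda>x. F x - F a) f f1"
    using C2_suppD[OF f] by (auto simp: C2_supp_def)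
  then show ?thesis by (rule that)
qed

text \<open>The cube of the positive part is C^2 and vanishes on a half-line; products of two such
  cubes give the bumps. At 0 the difference quotient is dominated by a positive power of
  |h|.\<close>

lemma max_0_cube_deriv: "((\<lambda>x::real. (max 0 x) ^ 3) has_real_derivative 3 * (max 0 x)\<^sup>2) (at x)"
  and max_0_square_deriv: "((\<lambda>x::real. (max 0 x)\<^sup>2) has_real_derivative 2 * max 0 x) (at x)"
proof -
  have *: "((\<lambda>x::real. (max 0 x) ^ Suc (Suc n)) has_real_derivative real (Suc (Suc n)) * (max 0 x) ^ Suc n) (at x)" for n
  proof (cases "x = 0")
    case True
    have "((\<lambda>h::real. (max 0 h) ^ Suc (Suc n) / h) \<longlongrightarrow> 0) (at 0)"
    proof (rule Lim_null_comparison)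
      have "((\<lambda>h::real. \<bar>h\<bar> ^ Suc n) \<longlongrightarrow> \<bar>0\<bar> ^ Suc n) (at 0)"
        by (intro tendsto_intros)
      then show "((\<lambda>h::real. \<bar>h\<bar> ^ Suc n) \<longlongrightarrow> 0) (at 0)" by simp
      show "\<forall>\<^sub>F h::real in at 0. norm ((max 0 h) ^ Suc (Suc n) / h) \<le> \<bar>h\<bar> ^ Suc n"
        by (intro always_eventually) (auto simp: max_def mult_nonpos_nonneg)
    qed
    then show ?thesis using True by (simp add: has_field_derivative_iff)
  next
    case False
    show ?thesis
    proof (cases "x > 0")
      case True
      have "((\<lambda>x::real. x ^ Suc (Suc n)) has_real_derivative real (Suc (Suc n)) * (max 0 x) ^ Suc n) (at x)"
        using DERIV_pow[of "Suc (Suc n)" x] True by (simp add: max_def del: power_Suc)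
      then show ?thesis
        by (rule has_field_derivative_transform_within_open[of _ _ _ "{0<..}"]) (use True in auto)
    next
      case 2: False
      have "((\<lambda>x::real. 0) has_real_derivative real (Suc (Suc n)) * (max 0 x) ^ Suc n) (at x)"
        using False 2 by (auto simp: max_def)
      then show ?thesis
        by (rule has_field_derivative_transform_within_open[of _ _ _ "{..<0}"]) (use False 2 in auto)
    qed
  qed
  show "((\<lambda>x::real. (max 0 x) ^ 3) has_real_derivative 3 * (max 0 x)\<^sup>2) (at x)"
    using *[of 1] by (simp add: numeral_3_eq_3 numeral_2_eq_2)
  show "((\<lambda>x::real. (max 0 x)\<^sup>2) has_real_derivative 2 * max 0 x) (at x)"
    using *[of 0] by (simp add: numeral_2_eq_2)
qed

text \<open>The functions \<open>1 - (1 - w)\<^sup>n\<close> increase to the indicator for any bump \<open>0 < w \<le> 1\<close>.\<close>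

lemma C2_cutoffs:
  assumes ab: "a < b"
  obtains u u1 u2 :: "nat \<Rightarrow> real \<Rightarrow> real" where "\<And>n. C2_supp a b (u n) (u1 n) (u2 n)"
    "\<And>n x. 0 \<le> u n x" "\<And>n x. u n x \<le> 1" "\<And>x. (\<lambda>n. u n x) \<longlonglongrightarrow> indicator {a<..<b} x"
proof
  \<comment> \<open>Each cube is at most (b - a)^3 on the interval, so this factor normalizes
    \<open>w\<close> to values at most 1.\<close>
  define k where "k = 1 / (b - a) ^ 6"
  define w where "w x = k * ((max 0 (x - a)) ^ 3 * (max 0 (b - x)) ^ 3)" for x
  define w1 where "w1 x = k * (3 * (max 0 (x - a))\<^sup>2 * (max 0 (b - x)) ^ 3 - (max 0 (x - a)) ^ 3 * (3 * (max 0 (b - x))\<^sup>2))" for x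
  define w2 where "w2 x = k * (3 * (2 * (max 0 (x - a))) * (max 0 (b - x)) ^ 3 - 2 * (3 * (max 0 (x - a))\<^sup>2 * (3 * (max 0 (b - x))\<^sup>2))
     + (max 0 (x - a)) ^ 3 * (3 * (2 * max 0 (b - x))))" for x
  \<comment> \<open>The exponent n + 2 leaves the natural number n after two
    differentiations.\<close>
  define u u1 u2 where "u n x = 1 - (1 - w x) ^ Suc (Suc n)"
    and "u1 n x = real (Suc (Suc n)) * (1 - w x) ^ Suc n * w1 x"
    and "u2 n x = real (Suc (Suc n)) * (1 - w x) ^ Suc n * w2 x - real (Suc (Suc n)) * (real (Suc n) * (1 - w x) ^ n) * (w1 x)\<^sup>2" for n :: nat and x
  note d3 = DERIV_chain2[OF max_0_cube_deriv] and d2 = DERIV_chain2[OF max_0_square_deriv]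
  have w: "(w has_real_derivative w1 x) (at x)" for x
    unfolding w_def[abs_def] w1_def
    by (rule derivative_eq_intros d3 refl)+ (simp add: algebra_simps)
  have w1: "(w1 has_real_derivative w2 x) (at x)" for x
    unfolding w1_def[abs_def] w2_def
    by (rule derivative_eq_intros d3 d2 refl)+ (simp add: algebra_simps power2_eq_square)
  have cont: "continuous_on UNIV w" "continuous_on UNIV w1" "continuous_on UNIV w2"
    unfolding w_def[abs_def] w1_def[abs_def] w2_def[abs_def] by (intro continuous_intros)+
  have out: "w x = 0" if "x \<notin> {a<..<b}" for x
    using that by (auto simp: w_def max_def)
  have bounds: "0 < w x" "w x \<le> 1" if "x \<in> {a<..<b}" for x
  proof -
    have "w x = k * ((x - a) ^ 3 * (b - x) ^ 3)" "k > 0"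
      using that by (auto simp: w_def k_def)
    moreover have "(x - a) ^ 3 * (b - x) ^ 3 \<le> (b - a) ^ 3 * (b - a) ^ 3"
      using that by (intro mult_mono power_mono) auto
    ultimately show "0 < w x" "w x \<le> 1"
      using that ab by (auto simp: k_def simp flip: power_add)
  qed
  have bounds': "0 \<le> w x" "w x \<le> 1" for x
    using bounds[of x] out[of x] by (cases "x \<in> {a<..<b}"; simp)+
  show "C2_supp a b (u n) (u1 n) (u2 n)" for n
    unfolding C2_supp_def
  proof (intro conjI allI impI)
    show "(u n has_real_derivative u1 n x) (at x)" for x
      unfolding u_def[abs_def] u1_def
      by (rule derivative_eq_intros w refl)+ (simp add: algebra_simps)
    show "(u1 n has_real_derivative u2 n x) (at x)" for x
      unfolding u1_def[abs_def] u2_def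
      by (rule derivative_eq_intros w w1 refl)+ (simp add: algebra_simps power2_eq_square)
    show "continuous_on UNIV (u2 n)"
      unfolding u2_def[abs_def] by (intro continuous_intros cont)
    show "u n x = 0" if "x \<notin> {a..b}" for x
      using out[of x] that by (auto simp: u_def)
  qed
  show "0 \<le> u n x" "u n x \<le> 1" for n x
    using bounds'[of x] power_le_one[of "1 - w x" "Suc (Suc n)"] by (auto simp: u_def simp del: power_Suc)
  show "(\<lambda>n. u n x) \<longlonglongrightarrow> indicator {a<..<b} x" for x
  proof (cases "x \<in> {a<..<b}")
    case True
    have "(\<lambda>n. 1 - (1 - w x) ^ n) \<longlonglongrightarrow> 1 - 0"
      using bounds[OF True] by (intro tendsto_intros LIMSEQ_power_zero) auto
    then show ?thesis
      using True unfolding u_def by (auto dest!: LIMSEQ_Suc simp del: power_Suc)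
  qed (simp add: u_def out)
qed

section \<open>Sets whose indicator is weakly constant along X and Y\<close>

definition prod3 :: "(real \<Rightarrow> real) \<Rightarrow> (real \<Rightarrow> real) \<Rightarrow> (real \<Rightarrow> real) \<Rightarrow> heis \<Rightarrow> real" where
  "prod3 f g h p = f (fst p) * g (fst (snd p)) * h (snd (snd p))"

lemma C1_deriv_prod3:
  assumes "\<And>x. (f has_real_derivative f1 x) (at x)" "\<And>x. (g has_real_derivative g1 x) (at x)"
    "\<And>x. (h has_real_derivative h1 x) (at x)"
    and "continuous_on UNIV f1" "continuous_on UNIV g1" "continuous_on UNIV h1"
  shows "C1_deriv (prod3 f g h)
    (\<lambda>p v. fst v * prod3 f1 g h p + fst (snd v) * prod3 f g1 h p + snd (snd v) * prod3 f g h1 p)"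
proof -
  have "C1_deriv (\<lambda>p. f (fst p) * g (fst (snd p)) * h (snd (snd p)))
    (\<lambda>p v. f (fst p) * g (fst (snd p)) * (h1 (snd (snd p)) * snd (snd v)) +
      (f (fst p) * (g1 (fst (snd p)) * fst (snd v)) + f1 (fst p) * fst v * g (fst (snd p))) * h (snd (snd p)))"
    by (intro C1_deriv_mult C1_deriv_compose_functional assms bounded_linear_fst bounded_linear_snd
      bounded_linear_fst_comp bounded_linear_snd_comp)
  then show ?thesis
    by (rule back_subst) (auto simp: prod3_def[abs_def] fun_eq_iff algebra_simps)
qed

lemma continuous_on_prod3:
  assumes "continuous_on UNIV f" "continuous_on UNIV g" "continuous_on UNIV h"
  shows "continuous_on A (prod3 f g h)"
  unfolding prod3_def[abs_def]
  by (intro continuous_intros continuous_on_compose2[OF assms(1)] continuous_on_compose2[OF assms(2)]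
        continuous_on_compose2[OF assms(3)]) auto

lemma prod3_zero_outside:
  assumes "\<forall>x. x \<notin> {l1..u1} \<longrightarrow> f x = 0" "\<forall>x. x \<notin> {l2..u2} \<longrightarrow> g x = 0" "\<forall>x. x \<notin> {l3..u3} \<longrightarrow> h x = 0"
    and "p \<notin> cbox (l1, l2, l3) (u1, u2, u3)"
  shows "prod3 f g h p = 0"
  using assms by (cases p) (auto simp: prod3_def cbox_Pair_eq)

lemma C1_deriv_diff:
  "C1_deriv f f' \<Longrightarrow> C1_deriv g g' \<Longrightarrow> C1_deriv (\<lambda>p. f p - g p) (\<lambda>p v. f' p v - g' p v)"
  and C1_deriv_add:
  "C1_deriv f f' \<Longrightarrow> C1_deriv g g' \<Longrightarrow> C1_deriv (\<lambda>p. f p + g p) (\<lambda>p v. f' p v + g' p v)"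
  by (auto simp: C1_deriv_def intro!: derivative_intros continuous_intros)

text \<open>Zero perimeter in \<open>N\<close> as a linear condition: test fields are closed under
  sign change, so a vanishing supremum means that every integral vanishes. The aim is that
  \<open>B\<close> is null or of full measure in the box.\<close>

locale perimeter_free_box =
  fixes B N :: "heis set" and l1 l2 l3 u1 u2 u3 :: real
  assumes B [measurable]: "B \<in> sets borel"
    and free: "\<And>V. V \<in> test_fields N \<Longrightarrow> (\<integral>p. indicator B p * hdiv V p \<partial>lborel) = 0"
    and sub: "cbox (l1, l2, l3) (u1, u2, u3) \<subseteq> N"
    and lu: "l1 < u1" "l2 < u2" "l3 < u3"
begin

abbreviation Q :: "heis set" where "Q \<equiv> cbox (l1, l2, l3) (u1, u2, u3)"

text \<open>Dividing by a bound \<open>M\<close> makes any C^1 function supported in the box an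
  admissible coefficient, and fields with one zero component separate X from Y.\<close>

lemma free_field:
  fixes v :: "heis \<Rightarrow> real"
  assumes v: "C1_deriv v v'" "\<And>p. p \<notin> Q \<Longrightarrow> v p = 0"
  shows "(\<integral>p. indicator B p * v' p (X_field p) \<partial>lborel) = 0"
    "(\<integral>p. indicator B p * v' p (Y_field p) \<partial>lborel) = 0"
proof -
  have "compact (v ` Q)"
    by (intro compact_continuous_image C1_deriv_continuous[OF v(1)] compact_cbox)
  then have "bounded (v ` Q)" by (rule compact_imp_bounded)
  then obtain M where M: "M > 0" "\<forall>y\<in>v ` Q. norm y \<le> M"
    unfolding bounded_pos by blast
  have le: "\<bar>v p\<bar> \<le> M" for p
    using M v(2)[of p] by (cases "p \<in> Q") auto
  have leM: "\<bar>v p\<bar> / \<bar>M\<bar> \<le> 1" for p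
    using M(1) le[of p] by simp
  have vM: "C1_deriv (\<lambda>p. v p / M) (\<lambda>p w. v' p w / M)"
    using v(1) M(1) unfolding C1_deriv_def
    by (intro conjI allI bounded_linear.has_derivative[OF bounded_linear_divide]
      continuous_on_divide continuous_on_const) auto
  have 1: "C1_deriv (\<lambda>p. (v p / M, 0::real)) (\<lambda>p w. (v' p w / M, 0))"
    and 2: "C1_deriv (\<lambda>p. (0::real, v p / M)) (\<lambda>p w. (0, v' p w / M))"
    using vM unfolding C1_deriv_def
    by (auto intro: has_derivative_Pair has_derivative_const continuous_on_Pair continuous_on_const)
  have "(\<lambda>p. (v p / M, 0)) \<in> test_fields N"
    by (rule test_fieldsI[OF 1 compact_cbox sub]) (simp_all add: v(2) leM norm_Pair zero_prod_def)
  moreover have "(\<lambda>p. (0, v p / M)) \<in> test_fields N"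
    by (rule test_fieldsI[OF 2 compact_cbox sub]) (simp_all add: v(2) leM norm_Pair zero_prod_def)
  ultimately show "(\<integral>p. indicator B p * v' p (X_field p) \<partial>lborel) = 0"
    "(\<integral>p. indicator B p * v' p (Y_field p) \<partial>lborel) = 0"
    using free[of "\<lambda>p. (v p / M, 0)"] free[of "\<lambda>p. (0, v p / M)"] M(1)
    by (simp_all add: hdiv_C1_deriv[OF 1] hdiv_C1_deriv[OF 2])
qed

definition mean :: "(heis \<Rightarrow> real) \<Rightarrow> real" where
  "mean g = (\<integral>p. indicator B p * g p \<partial>lborel)"

context
  fixes f f1 f2 g g1 g2 h h1 h2 :: "real \<Rightarrow> real"
  assumes f: "C2_supp l1 u1 f f1 f2" and g: "C2_supp l2 u2 g g1 g2" and h: "C2_supp l3 u3 h h1 h2"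
begin

text \<open>Since \<open>[X, Y] = - 2 \<partial>\<^sub>t\<close>, the indicator is also weakly constant along \<open>t\<close>.\<close>

lemma mean_dt: "mean (prod3 f g h1) = 0"
proof -
  note D = C2_suppD[OF f] C2_suppD[OF g] C2_suppD[OF h]
  have xf: "C2_supp l1 u1 (\<lambda>x. x * f x) (\<lambda>x. f x + x * f1 x) (\<lambda>x. 2 * f1 x + x * f2 x)"
    by (rule C2_supp_mult_id[OF f])
  have yg: "C2_supp l2 u2 (\<lambda>x. x * g x) (\<lambda>x. g x + x * g1 x) (\<lambda>x. 2 * g1 x + x * g2 x)"
    by (rule C2_supp_mult_id[OF g])
  note Dxf = C2_suppD[OF xf] and Dyg = C2_suppD[OF yg]
  \<comment> \<open>For v = \<open>prod3 f g h\<close>, \<open>YV\<close> and \<open>XV\<close> are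
    the differentials of Y v = f g1 h - x f g h1 and X v = f1 g h + y f g h1. Hence
    \<open>YV\<close> along X minus \<open>XV\<close> along Y is XYv - YXv = - 2 f g h1.\<close>
  define YV where "YV p v =
      (fst v * prod3 f1 g1 h p + fst (snd v) * prod3 f g2 h p + snd (snd v) * prod3 f g1 h1 p)
    - (fst v * prod3 (\<lambda>x. f x + x * f1 x) g h1 p + fst (snd v) * prod3 (\<lambda>x. x * f x) g1 h1 p
      + snd (snd v) * prod3 (\<lambda>x. x * f x) g h2 p)" for p v
  define XV where "XV p v =
      (fst v * prod3 f2 g h p + fst (snd v) * prod3 f1 g1 h p + snd (snd v) * prod3 f1 g h1 p)
    + (fst v * prod3 f1 (\<lambda>x. x * g x) h1 p + fst (snd v) * prod3 f (\<lambda>x. g x + x * g1 x) h1 p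
      + snd (snd v) * prod3 f (\<lambda>x. x * g x) h2 p)" for p v
  have Yv: "C1_deriv (\<lambda>p. prod3 f g1 h p - prod3 (\<lambda>x. x * f x) g h1 p) YV"
    unfolding YV_def[abs_def] by (intro C1_deriv_diff C1_deriv_prod3 D Dxf)
  have Xv: "C1_deriv (\<lambda>p. prod3 f1 g h p + prod3 f (\<lambda>x. x * g x) h1 p) XV"
    unfolding XV_def[abs_def] by (intro C1_deriv_add C1_deriv_prod3 D Dyg)
  have z: "\<forall>x. x \<notin> {a..b} \<longrightarrow> r x = 0" "\<forall>x. x \<notin> {a..b} \<longrightarrow> r1 x = 0" if "C2_supp a b r r1 r2" for a b r r1 r2
    using C2_suppD(6,7)[OF that] by blast+
  note pz = prod3_zero_outside[of l1 u1 _ l2 u2 _ l3 u3]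
  have Y0: "prod3 f g1 h p - prod3 (\<lambda>x. x * f x) g h1 p = 0" if p: "p \<notin> Q" for p
    using pz[OF z(1)[OF f] z(2)[OF g] z(1)[OF h] p] pz[OF z(1)[OF xf] z(1)[OF g] z(2)[OF h] p] by simp
  have X0: "prod3 f1 g h p + prod3 f (\<lambda>x. x * g x) h1 p = 0" if p: "p \<notin> Q" for p
    using pz[OF z(2)[OF f] z(1)[OF g] z(1)[OF h] p] pz[OF z(1)[OF f] z(1)[OF yg] z(2)[OF h] p] by simp
  have int: "integrable lborel (\<lambda>p. indicator B p * v' p (Z p))"
    if v: "C1_deriv v v'" "\<And>p. p \<notin> Q \<Longrightarrow> v p = 0" and Z: "continuous_on UNIV Z"
    for v :: "heis \<Rightarrow> real" and v' Z
  proof (rule integrable_indicator_compact_support[OF _ compact_cbox _ B])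
    show "continuous_on UNIV (\<lambda>p. v' p (Z p))"
      by (rule C1_deriv_continuous_joint[OF v(1) continuous_on_id Z])
    show "v' p (Z p) = 0" if "p \<notin> Q" for p
      by (rule C1_deriv_zero_outside[OF v(1) closed_cbox v(2) that])
  qed
  have iY: "integrable lborel (\<lambda>p. indicator B p * YV p (X_field p))"
    by (rule int[OF Yv Y0]) (auto simp: X_field_eq[abs_def] intro!: continuous_intros)
  have iX: "integrable lborel (\<lambda>p. indicator B p * XV p (Y_field p))"
    by (rule int[OF Xv X0]) (auto simp: Y_field_eq[abs_def] intro!: continuous_intros)
  have "indicator B p * YV p (X_field p) - indicator B p * XV p (Y_field p)
      = - 2 * (indicator B p * prod3 f g h1 p)" for p :: heis
    by (cases p) (simp add: XV_def YV_def prod3_def algebra_simps)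
  then have "- 2 * mean (prod3 f g h1)
    = (\<integral>p. indicator B p * YV p (X_field p) - indicator B p * XV p (Y_field p) \<partial>lborel)"
    unfolding mean_def by (simp only: integral_mult_right_zero)
  also have "\<dots> = 0"
    using free_field(1)[OF Yv Y0] free_field(2)[OF Xv X0] Bochner_Integration.integral_diff[OF iY iX] by linarith
  finally show ?thesis by simp
qed

end

lemma integrable_B:
  fixes f :: "heis \<Rightarrow> real"
  assumes "continuous_on UNIV f" "\<And>p. p \<notin> Q \<Longrightarrow> f p = 0"
  shows "integrable lborel (\<lambda>p. indicator B p * f p)"
  by (rule integrable_indicator_compact_support[OF assms(1) compact_cbox assms(2) B])

lemma integrable_prod3:
  assumes f: "C2_supp l1 u1 f f1 f2" and g: "C2_supp l2 u2 g g1 g2" and h: "C2_supp l3 u3 h h1 h2"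
  shows "integrable lborel (\<lambda>p. indicator B p * prod3 f g h p)"
    "integrable lborel (\<lambda>p. indicator B p * prod3 f1 g h p)"
    "integrable lborel (\<lambda>p. indicator B p * prod3 f g1 h p)"
    "integrable lborel (\<lambda>p. indicator B p * prod3 f g h1 p)"
proof -
  have z: "\<forall>x. x \<notin> {a..b} \<longrightarrow> r x = 0" "\<forall>x. x \<notin> {a..b} \<longrightarrow> r1 x = 0" if "C2_supp a b r r1 r2" for a b r r1 r2
    using C2_suppD(6,7)[OF that] by blast+
  show "integrable lborel (\<lambda>p. indicator B p * prod3 f g h p)"
    by (intro integrable_B continuous_on_prod3 C2_suppD[OF f] C2_suppD[OF g] C2_suppD[OF h])
      (rule prod3_zero_outside[OF z(1)[OF f] z(1)[OF g] z(1)[OF h]])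
  show "integrable lborel (\<lambda>p. indicator B p * prod3 f1 g h p)"
    by (intro integrable_B continuous_on_prod3 C2_suppD[OF f] C2_suppD[OF g] C2_suppD[OF h])
      (rule prod3_zero_outside[OF z(2)[OF f] z(1)[OF g] z(1)[OF h]])
  show "integrable lborel (\<lambda>p. indicator B p * prod3 f g1 h p)"
    by (intro integrable_B continuous_on_prod3 C2_suppD[OF f] C2_suppD[OF g] C2_suppD[OF h])
      (rule prod3_zero_outside[OF z(1)[OF f] z(2)[OF g] z(1)[OF h]])
  show "integrable lborel (\<lambda>p. indicator B p * prod3 f g h1 p)"
    by (intro integrable_B continuous_on_prod3 C2_suppD[OF f] C2_suppD[OF g] C2_suppD[OF h])
      (rule prod3_zero_outside[OF z(1)[OF f] z(1)[OF g] z(2)[OF h]])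
qed

text \<open>X of the product is f1 g h + y f g h1, and the second term is the t-derivative of
  another product, so its mean vanishes by \<open>mean_dt\<close>; similarly for Y.\<close>

lemma mean_dx_dy:
  assumes f: "C2_supp l1 u1 f f1 f2" and g: "C2_supp l2 u2 g g1 g2" and h: "C2_supp l3 u3 h h1 h2"
  shows "mean (prod3 f1 g h) = 0" "mean (prod3 f g1 h) = 0"
proof -
  note xf = C2_supp_mult_id[OF f] and yg = C2_supp_mult_id[OF g]
  define v' where "v' p v = fst v * prod3 f1 g h p + fst (snd v) * prod3 f g1 h p + snd (snd v) * prod3 f g h1 p" for p v
  have v: "C1_deriv (prod3 f g h) v'"
    unfolding v'_def[abs_def] by (intro C1_deriv_prod3 C2_suppD[OF f] C2_suppD[OF g] C2_suppD[OF h])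
  have z: "\<forall>x. x \<notin> {a..b} \<longrightarrow> r x = 0" if "C2_supp a b r r1 r2" for a b r r1 r2
    using C2_suppD(6)[OF that] by blast
  have v0: "prod3 f g h p = 0" if "p \<notin> Q" for p
    by (rule prod3_zero_outside[OF z[OF f] z[OF g] z[OF h] that])
  have "0 = (\<integral>p. indicator B p * v' p (X_field p) \<partial>lborel)"
    by (rule free_field(1)[OF v v0, symmetric])
  also have "\<dots> = (\<integral>p. indicator B p * prod3 f1 g h p + indicator B p * prod3 f (\<lambda>x. x * g x) h1 p \<partial>lborel)"
    by (simp add: v'_def X_field_eq proj_def prod3_def algebra_simps)
  also have "\<dots> = mean (prod3 f1 g h) + mean (prod3 f (\<lambda>x. x * g x) h1)"
    unfolding mean_def by (rule Bochner_Integration.integral_add[OF integrable_prod3(2)[OF f g h] integrable_prod3(4)[OF f yg h]])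
  finally show "mean (prod3 f1 g h) = 0" using mean_dt[OF f yg h] by simp
  have "0 = (\<integral>p. indicator B p * v' p (Y_field p) \<partial>lborel)"
    by (rule free_field(2)[OF v v0, symmetric])
  also have "\<dots> = (\<integral>p. indicator B p * prod3 f g1 h p - indicator B p * prod3 (\<lambda>x. x * f x) g h1 p \<partial>lborel)"
    by (simp add: v'_def Y_field_eq proj_def prod3_def algebra_simps)
  also have "\<dots> = mean (prod3 f g1 h) - mean (prod3 (\<lambda>x. x * f x) g h1)"
    unfolding mean_def by (rule Bochner_Integration.integral_diff[OF integrable_prod3(3)[OF f g h] integrable_prod3(4)[OF xf g h]])
  finally show "mean (prod3 f g1 h) = 0" using mean_dt[OF xf g h] by simp
qed

text \<open>The combination has integral zero, so it is the derivative of a compactly supported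
  function, and a functional that kills derivatives kills it.\<close>

lemma C2_supp_balanced:
  assumes f: "C2_supp a b f f1 f2" and g: "C2_supp a b g g1 g2" and "a < b"
  obtains F where "C2_supp a b F (\<lambda>x. integral\<^sup>L lborel g * f x - integral\<^sup>L lborel f * g x)
    (\<lambda>x. integral\<^sup>L lborel g * f1 x - integral\<^sup>L lborel f * g1 x)"
proof -
  have "(\<integral>x. integral\<^sup>L lborel g * f x - integral\<^sup>L lborel f * g x \<partial>lborel) = 0"
    using C2_supp_integrable[OF f] C2_supp_integrable[OF g] by simp
  from C2_supp_primitive[OF C2_supp_lincomb[OF f g] this less_imp_le[OF assms(3)]] that show ?thesis by blast
qed

lemma mean_lincomb:
  assumes "integrable lborel (\<lambda>p. indicator B p * r p)" "integrable lborel (\<lambda>p. indicator B p * s p)"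
  shows "mean (\<lambda>p. c * r p - d * s p) = c * mean r - d * mean s"
proof -
  have "mean (\<lambda>p. c * r p - d * s p) = (\<integral>p. c * (indicator B p * r p) - d * (indicator B p * s p) \<partial>lborel)"
    by (simp add: mean_def algebra_simps)
  then show ?thesis using assms by (simp add: mean_def)
qed

text \<open>The du Bois-Reymond argument in each variable: a functional that annihilates derivatives
  is a multiple of the integral.\<close>

lemma mean_proportional:
  assumes f: "C2_supp l1 u1 f f1 f2" and g: "C2_supp l2 u2 g g1 g2" and h: "C2_supp l3 u3 h h1 h2"
  shows "C2_supp l1 u1 r r1 r2 \<Longrightarrow> integral\<^sup>L lborel r * mean (prod3 f g h) = integral\<^sup>L lborel f * mean (prod3 r g h)"
    and "C2_supp l2 u2 r r1 r2 \<Longrightarrow> integral\<^sup>L lborel r * mean (prod3 f g h) = integral\<^sup>L lborel g * mean (prod3 f r h)"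
    and "C2_supp l3 u3 r r1 r2 \<Longrightarrow> integral\<^sup>L lborel r * mean (prod3 f g h) = integral\<^sup>L lborel h * mean (prod3 f g r)"
proof -
  note i = integrable_prod3(1)[OF f g h]
  assume r: "C2_supp l1 u1 r r1 r2"
  obtain F where F: "C2_supp l1 u1 F (\<lambda>x. integral\<^sup>L lborel r * f x - integral\<^sup>L lborel f * r x)
    (\<lambda>x. integral\<^sup>L lborel r * f1 x - integral\<^sup>L lborel f * r1 x)"
    using C2_supp_balanced[OF f r lu(1)] by blast
  have "prod3 (\<lambda>x. integral\<^sup>L lborel r * f x - integral\<^sup>L lborel f * r x) g h
      = (\<lambda>p. integral\<^sup>L lborel r * prod3 f g h p - integral\<^sup>L lborel f * prod3 r g h p)"
    by (auto simp: prod3_def algebra_simps)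
  then show "integral\<^sup>L lborel r * mean (prod3 f g h) = integral\<^sup>L lborel f * mean (prod3 r g h)"
    using mean_dx_dy(1)[OF F g h] mean_lincomb[OF i integrable_prod3(1)[OF r g h]] by simp
next
  note i = integrable_prod3(1)[OF f g h]
  assume r: "C2_supp l2 u2 r r1 r2"
  obtain F where F: "C2_supp l2 u2 F (\<lambda>x. integral\<^sup>L lborel r * g x - integral\<^sup>L lborel g * r x)
    (\<lambda>x. integral\<^sup>L lborel r * g1 x - integral\<^sup>L lborel g * r1 x)"
    using C2_supp_balanced[OF g r lu(2)] by blast
  have "prod3 f (\<lambda>x. integral\<^sup>L lborel r * g x - integral\<^sup>L lborel g * r x) h
      = (\<lambda>p. integral\<^sup>L lborel r * prod3 f g h p - integral\<^sup>L lborel g * prod3 f r h p)"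
    by (auto simp: prod3_def algebra_simps)
  then show "integral\<^sup>L lborel r * mean (prod3 f g h) = integral\<^sup>L lborel g * mean (prod3 f r h)"
    using mean_dx_dy(2)[OF f F h] mean_lincomb[OF i integrable_prod3(1)[OF f r h]] by simp
next
  note i = integrable_prod3(1)[OF f g h]
  assume r: "C2_supp l3 u3 r r1 r2"
  obtain F where F: "C2_supp l3 u3 F (\<lambda>x. integral\<^sup>L lborel r * h x - integral\<^sup>L lborel h * r x)
    (\<lambda>x. integral\<^sup>L lborel r * h1 x - integral\<^sup>L lborel h * r1 x)"
    using C2_supp_balanced[OF h r lu(3)] by blast
  have "prod3 f g (\<lambda>x. integral\<^sup>L lborel r * h x - integral\<^sup>L lborel h * r x)
      = (\<lambda>p. integral\<^sup>L lborel r * prod3 f g h p - integral\<^sup>L lborel h * prod3 f g r p)"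
    by (auto simp: prod3_def algebra_simps)
  then show "integral\<^sup>L lborel r * mean (prod3 f g h) = integral\<^sup>L lborel h * mean (prod3 f g r)"
    using mean_dt[OF f g F] mean_lincomb[OF i integrable_prod3(1)[OF f g r]] by simp
qed

end

lemma cutoff_integrals:
  assumes "a < b" "\<And>n. C2_supp a b (u n) (u1 n) (u2 n)"
    "\<And>n x. 0 \<le> u n x" "\<And>n x. u n x \<le> 1" "\<And>x. (\<lambda>n. u n x) \<longlonglongrightarrow> indicator {a<..<b} x"
  shows "(\<lambda>n. integral\<^sup>L lborel (u n)) \<longlonglongrightarrow> b - a"
proof -
  have "(\<lambda>n. integral\<^sup>L lborel (u n)) \<longlonglongrightarrow> integral\<^sup>L lborel (indicator {a<..<b} :: real \<Rightarrow> real)"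
  proof (rule integral_dominated_convergence)
    show "integrable lborel (indicator {a..b} :: real \<Rightarrow> real)"
      using assms(1) by (intro integrable_real_indicator) auto
    show "u n \<in> borel_measurable lborel" for n
      using C2_supp_integrable[OF assms(2)] by blast
    show "AE x in lborel. norm (u n x) \<le> indicator {a..b} x" for n
      using assms(3,4)[of n] C2_suppD(6)[OF assms(2)[of n]] by (auto simp: indicator_def)
  qed (use assms in auto)
  then show ?thesis using assms(1) by simp
qed

lemma C2_bump:
  assumes "a < c" "c < b"
  obtains f f1 f2 where "C2_supp a b f f1 f2" "integral\<^sup>L lborel f > 0" "\<And>x. 0 \<le> f x" "f c > 0"
proof -
  have ab: "a < b" using assms by simp
  obtain u u1 u2 :: "nat \<Rightarrow> real \<Rightarrow> real" where u: "\<And>n. C2_supp a b (u n) (u1 n) (u2 n)"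
    "\<And>n x. 0 \<le> u n x" "\<And>n x. u n x \<le> 1" "\<And>x. (\<lambda>n. u n x) \<longlonglongrightarrow> indicator {a<..<b} x"
    using C2_cutoffs[OF ab] by metis
  have "\<forall>\<^sub>F n in sequentially. integral\<^sup>L lborel (u n) > 0"
    using order_tendstoD(1)[OF cutoff_integrals[OF ab u]] ab by simp
  moreover have "\<forall>\<^sub>F n in sequentially. u n c > 0"
    using order_tendstoD(1)[OF u(4)[of c]] assms by simp
  ultimately have "\<forall>\<^sub>F n in sequentially. integral\<^sup>L lborel (u n) > 0 \<and> u n c > 0"
    by (rule eventually_conj)
  then obtain n where "integral\<^sup>L lborel (u n) > 0" "u n c > 0"
    by (auto simp: eventually_sequentially)
  then show ?thesis using that u(1,2) by blast
qed

context perimeter_free_box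
begin

text \<open>The constant is read off from one reference triple of bumps, for which the factors are
  exchanged one variable at a time.\<close>

lemma mean_prod3_eq:
  obtains C where "\<And>f f1 f2 g g1 g2 h h1 h2. C2_supp l1 u1 f f1 f2 \<Longrightarrow> C2_supp l2 u2 g g1 g2 \<Longrightarrow>
    C2_supp l3 u3 h h1 h2 \<Longrightarrow>
    mean (prod3 f g h) = C * (integral\<^sup>L lborel f * integral\<^sup>L lborel g * integral\<^sup>L lborel h)"
proof -
  have mid: "l1 < (l1 + u1) / 2" "(l1 + u1) / 2 < u1" "l2 < (l2 + u2) / 2" "(l2 + u2) / 2 < u2"
    "l3 < (l3 + u3) / 2" "(l3 + u3) / 2 < u3"
    using lu by simp_all
  obtain f0 f01 f02 where f0: "C2_supp l1 u1 f0 f01 f02" "integral\<^sup>L lborel f0 > 0"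
    using C2_bump[OF mid(1,2)] by metis
  obtain g0 g01 g02 where g0: "C2_supp l2 u2 g0 g01 g02" "integral\<^sup>L lborel g0 > 0"
    using C2_bump[OF mid(3,4)] by metis
  obtain h0 h01 h02 where h0: "C2_supp l3 u3 h0 h01 h02" "integral\<^sup>L lborel h0 > 0"
    using C2_bump[OF mid(5,6)] by metis
  let ?C = "mean (prod3 f0 g0 h0) / (integral\<^sup>L lborel f0 * integral\<^sup>L lborel g0 * integral\<^sup>L lborel h0)"
  have "mean (prod3 f g h) = ?C * (integral\<^sup>L lborel f * integral\<^sup>L lborel g * integral\<^sup>L lborel h)"
    if f: "C2_supp l1 u1 f f1 f2" and g: "C2_supp l2 u2 g g1 g2" and h: "C2_supp l3 u3 h h1 h2"
    for f f1 f2 g g1 g2 h h1 h2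
  proof -
    have "mean (prod3 f g h) = integral\<^sup>L lborel f * mean (prod3 f0 g h) / integral\<^sup>L lborel f0"
      using mean_proportional(1)[OF f g h f0(1)] f0(2) by (simp add: field_simps)
    also have "mean (prod3 f0 g h) = integral\<^sup>L lborel g * mean (prod3 f0 g0 h) / integral\<^sup>L lborel g0"
      using mean_proportional(2)[OF f0(1) g h g0(1)] g0(2) by (simp add: field_simps)
    also have "mean (prod3 f0 g0 h) = integral\<^sup>L lborel h * mean (prod3 f0 g0 h0) / integral\<^sup>L lborel h0"
      using mean_proportional(3)[OF f0(1) g0(1) h h0(1)] h0(2) by (simp add: field_simps)
    finally show ?thesis by (simp add: ac_simps)
  qed
  then show ?thesis by (rule that)
qed

text \<open>Cutoffs converge to the indicator of the small box, and dominated convergence turns the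
  formula for products into one for volumes. \<open>C\<close> is the density of \<open>B\<close> in
  the large box.\<close>

lemma measure_box_proportional:
  obtains C where "C \<ge> 0" "\<And>a1 b1 a2 b2 a3 b3. l1 \<le> a1 \<Longrightarrow> a1 < b1 \<Longrightarrow> b1 \<le> u1 \<Longrightarrow> l2 \<le> a2 \<Longrightarrow> a2 < b2 \<Longrightarrow> b2 \<le> u2 \<Longrightarrow>
    l3 \<le> a3 \<Longrightarrow> a3 < b3 \<Longrightarrow> b3 \<le> u3 \<Longrightarrow>
    emeasure lborel (B \<inter> box (a1, a2, a3) (b1, b2, b3)) = ennreal (C * ((b1 - a1) * (b2 - a2) * (b3 - a3)))"
proof -
  obtain C where C: "\<And>f f1 f2 g g1 g2 h h1 h2. C2_supp l1 u1 f f1 f2 \<Longrightarrow> C2_supp l2 u2 g g1 g2 \<Longrightarrow>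
    C2_supp l3 u3 h h1 h2 \<Longrightarrow>
    mean (prod3 f g h) = C * (integral\<^sup>L lborel f * integral\<^sup>L lborel g * integral\<^sup>L lborel h)"
    using mean_prod3_eq by blast
  have *: "emeasure lborel (B \<inter> box (a1, a2, a3) (b1, b2, b3)) = ennreal (C * ((b1 - a1) * (b2 - a2) * (b3 - a3)))"
    "C * ((b1 - a1) * (b2 - a2) * (b3 - a3)) \<ge> 0"
    if ab: "l1 \<le> a1" "a1 < b1" "b1 \<le> u1" "l2 \<le> a2" "a2 < b2" "b2 \<le> u2" "l3 \<le> a3" "a3 < b3" "b3 \<le> u3"
    for a1 b1 a2 b2 a3 b3
  proof -
    let ?b = "box (a1, a2, a3) (b1, b2, b3)"
    obtain f f1 f2 :: "nat \<Rightarrow> real \<Rightarrow> real" where f: "\<And>n. C2_supp a1 b1 (f n) (f1 n) (f2 n)"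
      "\<And>n x. 0 \<le> f n x" "\<And>n x. f n x \<le> 1" "\<And>x. (\<lambda>n. f n x) \<longlonglongrightarrow> indicator {a1<..<b1} x"
      using C2_cutoffs[OF ab(2)] by metis
    obtain g g1 g2 :: "nat \<Rightarrow> real \<Rightarrow> real" where g: "\<And>n. C2_supp a2 b2 (g n) (g1 n) (g2 n)"
      "\<And>n x. 0 \<le> g n x" "\<And>n x. g n x \<le> 1" "\<And>x. (\<lambda>n. g n x) \<longlonglongrightarrow> indicator {a2<..<b2} x"
      using C2_cutoffs[OF ab(5)] by metis
    obtain h h1 h2 :: "nat \<Rightarrow> real \<Rightarrow> real" where h: "\<And>n. C2_supp a3 b3 (h n) (h1 n) (h2 n)"
      "\<And>n x. 0 \<le> h n x" "\<And>n x. h n x \<le> 1" "\<And>x. (\<lambda>n. h n x) \<longlonglongrightarrow> indicator {a3<..<b3} x"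
      using C2_cutoffs[OF ab(8)] by metis
    have f': "C2_supp l1 u1 (f n) (f1 n) (f2 n)" and g': "C2_supp l2 u2 (g n) (g1 n) (g2 n)"
      and h': "C2_supp l3 u3 (h n) (h1 n) (h2 n)" for n
      using C2_supp_mono[OF f(1)] C2_supp_mono[OF g(1)] C2_supp_mono[OF h(1)] ab by auto
    have "(\<lambda>n. mean (prod3 (f n) (g n) (h n))) \<longlonglongrightarrow> C * ((b1 - a1) * (b2 - a2) * (b3 - a3))"
      unfolding C[OF f' g' h']
      by (intro tendsto_intros cutoff_integrals[OF ab(2) f] cutoff_integrals[OF ab(5) g] cutoff_integrals[OF ab(8) h])
    moreover have "(\<lambda>n. mean (prod3 (f n) (g n) (h n))) \<longlonglongrightarrow> (\<integral>p. indicator (B \<inter> ?b) p \<partial>lborel)"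
      unfolding mean_def
    proof (rule integral_dominated_convergence)
      show "integrable lborel (indicator Q :: heis \<Rightarrow> real)"
        by (intro integrable_real_indicator emeasure_lborel_cbox_finite) auto
      show "(\<lambda>p. indicator B p * prod3 (f n) (g n) (h n) p) \<in> borel_measurable lborel" for n
        using integrable_prod3(1)[OF f' g' h'] by blast
      show "AE p in lborel. norm (indicator B p * prod3 (f n) (g n) (h n) p) \<le> indicator Q p" for n
      proof (intro AE_I2)
        fix p
        have "\<forall>x. x \<notin> {a..b} \<longrightarrow> r x = 0" if "C2_supp a b r r1 r2" for a b r r1 r2
          using C2_suppD(6)[OF that] by blast
        then have "prod3 (f n) (g n) (h n) p = 0" if "p \<notin> Q"
          using prod3_zero_outside that f' g' h' by metis
        moreover have "0 \<le> prod3 (f n) (g n) (h n) p"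
          by (simp add: prod3_def f(2) g(2) h(2))
        moreover have "prod3 (f n) (g n) (h n) p \<le> 1 * 1 * 1"
          unfolding prod3_def by (intro mult_mono mult_nonneg_nonneg f g h) simp_all
        ultimately show "norm (indicator B p * prod3 (f n) (g n) (h n) p) \<le> indicator Q p"
          by (cases "p \<in> Q"; cases "p \<in> B") auto
      qed
      show "AE p in lborel. (\<lambda>n. indicator B p * prod3 (f n) (g n) (h n) p) \<longlonglongrightarrow> indicator (B \<inter> ?b) p"
      proof (intro AE_I2)
        fix p :: heis
        have "(\<lambda>n. indicator B p * prod3 (f n) (g n) (h n) p) \<longlonglongrightarrow> indicator B p *
          (indicator {a1<..<b1} (fst p) * indicator {a2<..<b2} (fst (snd p)) * indicator {a3<..<b3} (snd (snd p)))"
          unfolding prod3_def by (intro tendsto_intros f(4) g(4) h(4))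
        also have "indicator B p * (indicator {a1<..<b1} (fst p) * indicator {a2<..<b2} (fst (snd p)) * indicator {a3<..<b3} (snd (snd p)))
           = (indicator (B \<inter> ?b) p :: real)"
          by (cases p) (auto simp: indicator_def box_Pair_eq)
        finally show "(\<lambda>n. indicator B p * prod3 (f n) (g n) (h n) p) \<longlonglongrightarrow> indicator (B \<inter> ?b) p" .
      qed
    qed auto
    ultimately have "(\<integral>p. indicator (B \<inter> ?b) p \<partial>lborel) = C * ((b1 - a1) * (b2 - a2) * (b3 - a3))"
      using LIMSEQ_unique by blast
    then have m: "measure lborel (B \<inter> ?b) = C * ((b1 - a1) * (b2 - a2) * (b3 - a3))"
      by simp
    then show "C * ((b1 - a1) * (b2 - a2) * (b3 - a3)) \<ge> 0"
      using measure_nonneg by metis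
    have "emeasure lborel (B \<inter> ?b) < \<infinity>"
      using emeasure_mono[of "B \<inter> ?b" ?b lborel] emeasure_lborel_box_finite[of "(a1, a2, a3)" "(b1, b2, b3)"]
      by (auto simp: order_le_less_trans)
    then show "emeasure lborel (B \<inter> ?b) = ennreal (C * ((b1 - a1) * (b2 - a2) * (b3 - a3)))"
      using m by (simp add: emeasure_eq_ennreal_measure)
  qed
  have "C \<ge> 0"
  proof -
    have "(u1 - l1) * (u2 - l2) * (u3 - l3) > 0" using lu by simp
    moreover have "C * ((u1 - l1) * (u2 - l2) * (u3 - l3)) \<ge> 0"
      using lu by (intro *(2)) auto
    ultimately show ?thesis by (metis mult_neg_pos not_less)
  qed
  then show ?thesis using *(1) that by blast
qed

text \<open>Rescaling Lebesgue measure on \<open>B\<close> by the constant density gives Lebesgue measure back, so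
  \<open>B\<close> has full measure unless the density is zero.\<close>

lemma zero_one:
  defines "b \<equiv> box (l1, l2, l3) (u1, u2, u3)"
  shows "emeasure lborel (b \<inter> B) = 0 \<or> emeasure lborel (b - B) = 0"
proof -
  obtain C where C: "C \<ge> 0" "\<And>a1 b1 a2 b2 a3 b3. l1 \<le> a1 \<Longrightarrow> a1 < b1 \<Longrightarrow> b1 \<le> u1 \<Longrightarrow> l2 \<le> a2 \<Longrightarrow> a2 < b2 \<Longrightarrow> b2 \<le> u2 \<Longrightarrow>
    l3 \<le> a3 \<Longrightarrow> a3 < b3 \<Longrightarrow> b3 \<le> u3 \<Longrightarrow>
    emeasure lborel (B \<inter> box (a1, a2, a3) (b1, b2, b3)) = ennreal (C * ((b1 - a1) * (b2 - a2) * (b3 - a3)))"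
    using measure_box_proportional by blast
  have b [measurable]: "b \<in> sets borel" by (simp add: b_def)
  show ?thesis
  proof (cases "C = 0")
    case True
    then show ?thesis using C(2)[of l1 u1 l2 u2 l3 u3] lu by (simp add: b_def Int_commute)
  next
    case False
    then have Cpos: "C > 0" using C(1) by simp
    \<comment> \<open>The value is 1 / C on \<open>B\<close> inside \<open>b\<close>, 1 outside
      \<open>b\<close> and 0 on \<open>b - B\<close>. This density gives every box its volume, so it
      reproduces Lebesgue measure, and \<open>b - B\<close> is null.\<close>
    define \<rho> :: "heis \<Rightarrow> ennreal" where "\<rho> p = ennreal (1 / C) * indicator (B \<inter> b) p + indicator (- b) p" for p
    have [measurable]: "\<rho> \<in> borel_measurable borel" unfolding \<rho>_def[abs_def] by measurable
    have M: "emeasure (density lborel \<rho>) A = ennreal (1 / C) * emeasure lborel (B \<inter> (b \<inter> A)) + emeasure lborel (A - b)"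
      if [measurable]: "A \<in> sets borel" for A
    proof -
      have "emeasure (density lborel \<rho>) A = (\<integral>\<^sup>+p. \<rho> p * indicator A p \<partial>lborel)"
        by (rule emeasure_density) auto
      also have "\<dots> = (\<integral>\<^sup>+p. ennreal (1 / C) * indicator (B \<inter> (b \<inter> A)) p + indicator (A - b) p \<partial>lborel)"
        by (intro nn_integral_cong) (auto simp: \<rho>_def indicator_def)
      also have "\<dots> = ennreal (1 / C) * emeasure lborel (B \<inter> (b \<inter> A)) + emeasure lborel (A - b)"
        by (subst nn_integral_add) (auto simp: nn_integral_cmult)
      finally show ?thesis .
    qed
    have "lborel = density lborel \<rho>"
    proof (rule lborel_eqI)
      fix l u :: heis assume le: "\<And>e. e \<in> Basis \<Longrightarrow> l \<bullet> e \<le> u \<bullet> e"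
      obtain x1 x2 x3 y1 y2 y3 where xy: "l = (x1, x2, x3)" "u = (y1, y2, y3)" by (cases l, cases u)
      define a1 a2 a3 b1 b2 b3 where "a1 = max l1 x1" and "a2 = max l2 x2" and "a3 = max l3 x3"
        and "b1 = min u1 y1" and "b2 = min u2 y2" and "b3 = min u3 y3"
      have bb: "b \<inter> box l u = box (a1, a2, a3) (b1, b2, b3)"
        by (auto simp: b_def xy box_Pair_eq a1_def a2_def a3_def b1_def b2_def b3_def)
      have "ennreal (1 / C) * emeasure lborel (B \<inter> (b \<inter> box l u)) = emeasure lborel (b \<inter> box l u)"
      proof (cases "a1 < b1 \<and> a2 < b2 \<and> a3 < b3")
        case True
        then have "emeasure lborel (B \<inter> (b \<inter> box l u)) = ennreal (C * ((b1 - a1) * (b2 - a2) * (b3 - a3)))"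
          unfolding bb by (intro C(2)) (auto simp: a1_def a2_def a3_def b1_def b2_def b3_def)
        then have "ennreal (1 / C) * emeasure lborel (B \<inter> (b \<inter> box l u)) = ennreal ((b1 - a1) * (b2 - a2) * (b3 - a3))"
          using Cpos True by (simp flip: ennreal_mult)
        also have "\<dots> = emeasure lborel (b \<inter> box l u)"
          unfolding bb using True
          by (simp add: box_Pair_eq emeasure_lborel_Times borel_Times mult.assoc flip: ennreal_mult)
        finally show ?thesis .
      next
        case False
        then have "b \<inter> box l u = {}" unfolding bb by (auto simp: box_Pair_eq)
        then show ?thesis by simp
      qed
      then have "emeasure (density lborel \<rho>) (box l u) = emeasure lborel (b \<inter> box l u) + emeasure lborel (box l u - b)"
        by (simp add: M)
      also have "\<dots> = emeasure lborel (box l u)"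
        by (subst plus_emeasure) (auto intro!: arg_cong[of _ _ "emeasure lborel"])
      also have "\<dots> = (\<Prod>e\<in>Basis. (u - l) \<bullet> e)" using le by simp
      finally show "emeasure (density lborel \<rho>) (box l u) = (\<Prod>e\<in>Basis. (u - l) \<bullet> e)" .
    qed simp
    then have "emeasure lborel (b - B) = emeasure (density lborel \<rho>) (b - B)" by simp
    also have "\<dots> = 0"
    proof -
      have e: "B \<inter> (b \<inter> (b - B)) = {}" "b - B - b = {}" by auto
      have "b - B \<in> sets borel" by simp
      from M[OF this] show ?thesis unfolding e by simp
    qed
    finally show ?thesis by simp
  qed
qed

end

section \<open>First variation of the perimeter of a subgraph\<close>

lemma C1_deriv_linear_map:
  assumes "bounded_linear L"
  shows "C1_deriv L (\<lambda>_. L)"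
  using bounded_linear.has_derivative[OF assms has_derivative_ident]
  by (auto simp: C1_deriv_def)

text \<open>The positive \<open>e\<close> under the root removes the singularity of L / |L| at the
  zeros of \<open>L\<close>.\<close>

lemma C1_deriv_regularized_normal:
  fixes L :: "'a::euclidean_space \<Rightarrow> 'b::euclidean_space"
  assumes L: "bounded_linear L" and e: "e > 0"
  shows "\<exists>W'. C1_deriv (\<lambda>p. inverse (sqrt (L p \<bullet> L p + e)) *\<^sub>R L p) W'"
proof -
  have pos: "L p \<bullet> L p + e > 0" for p using e by (simp add: add_nonneg_pos)
  have dL: "(L has_derivative L) (at p)" for p
    using bounded_linear.has_derivative[OF L has_derivative_ident] by simp
  have cL: "continuous_on UNIV L"
    using L by (simp add: linear_continuous_on)
  have "C1_deriv (\<lambda>p. inverse (sqrt (L p \<bullet> L p + e)))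
    (\<lambda>p v. - (L p \<bullet> L v) * inverse (sqrt (L p \<bullet> L p + e)) ^ 3)"
    unfolding C1_deriv_def
  proof (intro conjI allI)
    fix p
    have q: "((\<lambda>p. L p \<bullet> L p + e) has_derivative (\<lambda>v. L p \<bullet> L v + L v \<bullet> L p)) (at p)"
      by (auto intro!: derivative_eq_intros dL)
    have "((\<lambda>r. inverse (sqrt r)) has_real_derivative - (inverse (sqrt r) ^ 3) / 2) (at r)" if "r > 0" for r
      using that by (auto intro!: derivative_eq_intros simp: power2_eq_square power3_eq_cube field_simps)
    from has_derivative_compose[OF q this[OF pos[of p], unfolded has_field_derivative_def]]
    show "((\<lambda>p. inverse (sqrt (L p \<bullet> L p + e))) has_derivative
      (\<lambda>v. - (L p \<bullet> L v) * inverse (sqrt (L p \<bullet> L p + e)) ^ 3)) (at p)"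
      by (simp add: inner_commute algebra_simps)
  next
    fix v
    show "continuous_on UNIV (\<lambda>p. - (L p \<bullet> L v) * inverse (sqrt (L p \<bullet> L p + e)) ^ 3)"
      using pos by (intro continuous_intros cL) (auto simp: less_imp_neq[symmetric])
  qed
  from C1_deriv_scaleR[OF this C1_deriv_linear_map[OF L]] show ?thesis by blast
qed

lemma norm_regularized_normal_le:
  fixes g :: "'b::euclidean_space"
  assumes "e > 0"
  shows "norm (inverse (sqrt (g \<bullet> g + e)) *\<^sub>R g) \<le> 1"
proof -
  have "norm g \<le> sqrt (g \<bullet> g + e)"
    using assms by (simp add: norm_eq_sqrt_inner)
  moreover have "sqrt (g \<bullet> g + e) > 0"
    using assms by (simp add: add_nonneg_pos)
  ultimately show ?thesis by (simp add: field_simps)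
qed

definition square :: "real \<Rightarrow> (real \<times> real) set" where
  "square R = box (- R, - R) (R, R)"

lemma mem_square: "z \<in> square R \<longleftrightarrow> \<bar>fst z\<bar> < R \<and> \<bar>snd z\<bar> < R"
  by (cases z) (auto simp: square_def box_Pair_eq)

lemma square_facts: "bounded (square R)" "square R \<in> sets borel"
  by (simp_all add: square_def bounded_box)

text \<open>The test fields are cutoffs of \<open>G / sqrt (\<bar>G\<bar>\<^sup>2 + 1 / n)\<close>, a regularization of the
  horizontal normal that is defined also at characteristic points.\<close>

lemma perimeter_lower_ge_inner:
  assumes E: "E \<in> sets lebesgue" "AE p in lborel. p \<in> E \<longleftrightarrow> p \<in> lower q"
    and q: "C1_deriv q q'" and G: "hgrad q' = G" "bounded_linear G"
    and r: "0 < r" "r < R" and T: "0 < T" "T < T'" "\<And>z. z \<in> square R \<Longrightarrow> \<bar>q z\<bar> < T"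
    and \<Omega>: "\<Omega> = box (- R, - R, - T') (R, R, T')"
  shows "ereal (\<integral>z. indicator (square r) z * norm (G z) \<partial>lborel) \<le> perimeter E \<Omega>"
proof -
  have rr: "- r < r" and TT: "- T < T" using r T by auto
  obtain u u1 u2 :: "nat \<Rightarrow> real \<Rightarrow> real" where u: "\<And>n. C2_supp (- r) r (u n) (u1 n) (u2 n)"
    "\<And>n x. 0 \<le> u n x" "\<And>n x. u n x \<le> 1" "\<And>x. (\<lambda>n. u n x) \<longlonglongrightarrow> indicator {- r<..<r} x"
    using C2_cutoffs[OF rr] by metis
  obtain w w1 w2 :: "nat \<Rightarrow> real \<Rightarrow> real" where w: "\<And>n. C2_supp (- T) T (w n) (w1 n) (w2 n)"
    "\<And>n x. 0 \<le> w n x" "\<And>n x. w n x \<le> 1" "\<And>x. (\<lambda>n. w n x) \<longlonglongrightarrow> indicator {- T<..<T} x"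
    using C2_cutoffs[OF TT] by metis
  \<comment> \<open>The factor \<open>w\<close> truncates vertically. The graph over the square
    stays strictly between - T and T, so the truncation disappears on it in the limit, while r < R
    and T < T' keep the support compactly inside \<open>\<Omega>\<close>.\<close>
  define c where "c n = prod3 (u n) (u n) (w n)" for n
  define e where "e n = 1 / real (Suc n)" for n
  define W where "W n z = inverse (sqrt (G z \<bullet> G z + e n)) *\<^sub>R G z" for n z
  define V where "V n p = c n p *\<^sub>R W n (proj p)" for n p
  let ?K = "cbox (- r, - r, - T) (r, r, T)"
  have e: "e n > 0" for n by (simp add: e_def)
  have Gc: "continuous_on UNIV G" using G(2) by (simp add: linear_continuous_on)
  have c01: "0 \<le> c n p" "c n p \<le> 1" for n p
  proof -
    have "prod3 (u n) (u n) (w n) p \<le> 1 * 1 * 1"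
      unfolding prod3_def by (intro mult_mono mult_nonneg_nonneg u w) simp_all
    then show "c n p \<le> 1" by (simp add: c_def)
    show "0 \<le> c n p" by (simp add: c_def prod3_def u w)
  qed
  have z0: "\<forall>x. x \<notin> {a..b} \<longrightarrow> f x = 0" if "C2_supp a b f f1 f2" for a b f f1 f2
    using C2_suppD(6)[OF that] by blast
  have c0: "c n p = 0" if "p \<notin> ?K" for n p
    unfolding c_def by (rule prod3_zero_outside[OF z0[OF u(1)] z0[OF u(1)] z0[OF w(1)] that])
  have proj: "bounded_linear proj"
    unfolding proj_def by (intro bounded_linear_Pair bounded_linear_fst_comp bounded_linear_snd_comp bounded_linear_fst bounded_linear_snd)
  have "\<exists>V'. C1_deriv (V n) V'" for n
  proof -
    have "bounded_linear (\<lambda>p. G (proj p))"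
      by (rule bounded_linear_compose[OF G(2) proj])
    then obtain W' where "C1_deriv (\<lambda>p. W n (proj p)) W'"
      using C1_deriv_regularized_normal[of "\<lambda>p. G (proj p)", OF _ e] unfolding W_def by blast
    moreover have "\<exists>c'. C1_deriv (c n) c'"
      unfolding c_def by (intro exI, rule C1_deriv_prod3) (rule C2_suppD[OF u(1)] C2_suppD[OF w(1)])+
    ultimately show ?thesis unfolding V_def using C1_deriv_scaleR by blast
  qed
  then obtain V' where V': "\<And>n. C1_deriv (V n) (V' n)" by metis
  have V: "V n \<in> test_fields \<Omega>" for n
  proof (rule test_fieldsI[OF V' compact_cbox])
    show "?K \<subseteq> \<Omega>"
      using r T(1,2) unfolding \<Omega> by (auto simp: box_Pair_eq)
    show "V n p = 0" if "p \<notin> ?K" for p using c0[OF that] by (simp add: V_def)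
    show "norm (V n p) \<le> 1" for p
      using mult_le_one[OF c01(2) norm_ge_zero norm_regularized_normal_le[OF e]] c01(1)
      unfolding V_def W_def by (simp only: norm_scaleR abs_of_nonneg)
  qed
  have le: "ereal (\<integral>z. G z \<bullet> V n (fst z, snd z, q z) \<partial>lborel) \<le> perimeter E \<Omega>" for n
  proof -
    have V0: "V n p = 0" if "p \<notin> ?K" for p using c0[OF that] by (simp add: V_def)
    have "(LINT p:E|lebesgue. hdiv (V n) p) = (\<integral>p. indicator (lower q) p * hdiv (V n) p \<partial>lborel)"
      by (rule LINT_lebesgue_eq_lborel[OF E(1) lower_borel[OF C1_deriv_continuous[OF q]] E(2) hdiv_borel[OF V]])
    also have "\<dots> = (\<integral>z. G z \<bullet> V n (fst z, snd z, q z) \<partial>lborel)"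
      using integral_lower_hdiv[OF q V' compact_cbox V0] G(1) by simp
    finally show ?thesis using LINT_le_perimeter[OF V, of E n] by simp
  qed
  \<comment> \<open>The pairing is c |G|^2 / sqrt (|G|^2 + e), which is bounded by |G| and tends to
    |G| on the square, also where G = 0.\<close>
  have GV: "G z \<bullet> V n (fst z, snd z, q z) = c n (fst z, snd z, q z) * ((G z \<bullet> G z) * inverse (sqrt (G z \<bullet> G z + e n)))" for n z
    by (simp add: V_def W_def)
  have "(\<lambda>n. \<integral>z. G z \<bullet> V n (fst z, snd z, q z) \<partial>lborel) \<longlonglongrightarrow> (\<integral>z. indicator (square r) z * norm (G z) \<partial>lborel)"
  proof (rule integral_dominated_convergence)
    let ?D = "cbox (- r, - r) (r, r) :: (real \<times> real) set"
    show "integrable lborel (\<lambda>z. indicator ?D z * norm (G z))"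
      by (intro integrable_indicator_bounded continuous_intros Gc) auto
    show "(\<lambda>z. indicator (square r) z * norm (G z)) \<in> borel_measurable lborel"
      using borel_measurable_continuous_onI[OF Gc] square_facts(2) by simp
    show "(\<lambda>z. G z \<bullet> V n (fst z, snd z, q z)) \<in> borel_measurable lborel" for n
    proof -
      have "continuous_on UNIV (\<lambda>z. G z \<bullet> V n (fst z, snd z, q z))"
        by (intro continuous_intros Gc continuous_on_compose2[OF C1_deriv_continuous[OF V', of UNIV]]
          C1_deriv_continuous[OF q]) auto
      then show ?thesis using borel_measurable_continuous_onI by simp
    qed
    show "AE z in lborel. norm (G z \<bullet> V n (fst z, snd z, q z)) \<le> indicator ?D z * norm (G z)" for n
    proof (intro AE_I2)
      fix z
      have "V n (fst z, snd z, q z) = 0" if "z \<notin> ?D"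
        using that c0[of "(fst z, snd z, q z)" n] by (cases z) (auto simp: V_def cbox_Pair_eq)
      moreover have "norm (G z \<bullet> V n (fst z, snd z, q z)) \<le> norm (G z) * 1"
        using V[of n] unfolding test_fields_def real_norm_def
        by (intro order_trans[OF Cauchy_Schwarz_ineq2] mult_left_mono) auto
      ultimately show "norm (G z \<bullet> V n (fst z, snd z, q z)) \<le> indicator ?D z * norm (G z)"
        by (cases "z \<in> ?D") auto
    qed
    show "AE z in lborel. (\<lambda>n. G z \<bullet> V n (fst z, snd z, q z)) \<longlonglongrightarrow> indicator (square r) z * norm (G z)"
    proof (intro AE_I2)
      fix z
      have "(\<lambda>n. c n (fst z, snd z, q z)) \<longlonglongrightarrow> indicator {- r<..<r} (fst z) * indicator {- r<..<r} (snd z) * indicator {- T<..<T} (q z)"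
        unfolding c_def prod3_def by (auto intro!: tendsto_intros u w)
      also have "indicator {- r<..<r} (fst z) * indicator {- r<..<r} (snd z) * indicator {- T<..<T} (q z) = (indicator (square r) z :: real)"
        using T(3)[of z] r by (auto simp: indicator_def mem_square abs_less_iff)
      finally have c: "(\<lambda>n. c n (fst z, snd z, q z)) \<longlonglongrightarrow> indicator (square r) z" .
      have "(\<lambda>n. (G z \<bullet> G z) * inverse (sqrt (G z \<bullet> G z + e n))) \<longlonglongrightarrow> norm (G z)"
      proof (cases "G z = 0")
        case False
        have "e \<longlonglongrightarrow> 0" unfolding e_def using LIMSEQ_inverse_real_of_nat by (simp add: inverse_eq_divide)
        then have "(\<lambda>n. (G z \<bullet> G z) * inverse (sqrt (G z \<bullet> G z + e n))) \<longlonglongrightarrow> (G z \<bullet> G z) * inverse (sqrt (G z \<bullet> G z + 0))"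
          using False by (intro tendsto_intros) auto
        also have "(G z \<bullet> G z) * inverse (sqrt (G z \<bullet> G z + 0)) = norm (G z)"
          using False by (simp add: dot_square_norm power2_eq_square)
        finally show ?thesis .
      qed simp
      then show "(\<lambda>n. G z \<bullet> V n (fst z, snd z, q z)) \<longlonglongrightarrow> indicator (square r) z * norm (G z)"
        unfolding GV using c by (intro tendsto_intros)
    qed
  qed
  then have "(\<lambda>n. ereal (\<integral>z. G z \<bullet> V n (fst z, snd z, q z) \<partial>lborel)) \<longlonglongrightarrow> ereal (\<integral>z. indicator (square r) z * norm (G z) \<partial>lborel)"
    by (rule tendsto_ereal)
  then show ?thesis
    by (rule LIMSEQ_le_const2) (use le in auto)
qed

text \<open>Compact support confines test fields to smaller squares; exhausting the open square
  recovers the full integral.\<close>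

lemma perimeter_lower_ge:
  assumes E: "E \<in> sets lebesgue" "AE p in lborel. p \<in> E \<longleftrightarrow> p \<in> lower q"
    and q: "C1_deriv q q'" and G: "hgrad q' = G" "bounded_linear G"
    and R: "0 < R" and T: "0 < T" "T < T'" "\<And>z. z \<in> square R \<Longrightarrow> \<bar>q z\<bar> < T"
    and \<Omega>: "\<Omega> = box (- R, - R, - T') (R, R, T')"
  shows "ereal (\<integral>z. indicator (square R) z * norm (G z) \<partial>lborel) \<le> perimeter E \<Omega>"
proof -
  \<comment> \<open>The shift to n + 2 makes the first radius R / 2, hence positive.\<close>
  define r where "r n = R * (1 - inverse (real (Suc (Suc n))))" for n
  have r: "0 < r n" "r n < R" for n
  proof -
    have i: "0 < inverse (real (Suc (Suc n)))" "inverse (real (Suc (Suc n))) < 1"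
      by (auto simp: inverse_less_1_iff)
    show "0 < r n" using R i(2) unfolding r_def by (intro mult_pos_pos) linarith+
    have "r n < R * 1" using R i(1) unfolding r_def by (intro mult_strict_left_mono) linarith+
    then show "r n < R" by simp
  qed
  have r_lim: "r \<longlonglongrightarrow> R"
  proof -
    have "r \<longlonglongrightarrow> R * (1 - 0)"
      unfolding r_def by (intro tendsto_intros LIMSEQ_Suc[OF LIMSEQ_inverse_real_of_nat])
    then show ?thesis by simp
  qed
  have Gc: "continuous_on UNIV G" using G(2) by (simp add: linear_continuous_on)
  have "(\<lambda>n. \<integral>z. indicator (square (r n)) z * norm (G z) \<partial>lborel) \<longlonglongrightarrow> (\<integral>z. indicator (square R) z * norm (G z) \<partial>lborel)"
  proof (rule integral_dominated_convergence)
    show "integrable lborel (\<lambda>z. indicator (square R) z * norm (G z))"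
      by (intro integrable_indicator_bounded continuous_intros Gc square_facts)
    show "(\<lambda>z. indicator (square s) z * norm (G z)) \<in> borel_measurable lborel" for s
      using borel_measurable_continuous_onI[OF Gc] square_facts(2) by simp
    then show "(\<lambda>z. indicator (square s) z * norm (G z)) \<in> borel_measurable lborel" for s .
    show "AE z in lborel. norm (indicator (square (r n)) z * norm (G z)) \<le> indicator (square R) z * norm (G z)" for n
    proof (intro AE_I2)
      show "norm (indicator (square (r n)) z * norm (G z)) \<le> indicator (square R) z * norm (G z)" for z
        using r(2)[of n] by (auto simp: indicator_def mem_square)
    qed
    show "AE z in lborel. (\<lambda>n. indicator (square (r n)) z * norm (G z)) \<longlonglongrightarrow> indicator (square R) z * norm (G z)"
    proof (intro AE_I2 tendsto_intros)
      fix z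
      show "(\<lambda>n. indicator (square (r n)) z :: real) \<longlonglongrightarrow> indicator (square R) z"
      proof (cases "z \<in> square R")
        case True
        then have "max \<bar>fst z\<bar> \<bar>snd z\<bar> < R" by (simp add: mem_square)
        from order_tendstoD(1)[OF r_lim this] show ?thesis
          by (intro tendsto_eventually) (auto elim!: eventually_mono simp: indicator_def mem_square True[unfolded mem_square])
      next
        case False
        then show ?thesis
          using r(2) by (intro tendsto_eventually always_eventually) (auto simp: indicator_def mem_square intro: less_trans)
      qed
    qed
  qed
  then have "(\<lambda>n. ereal (\<integral>z. indicator (square (r n)) z * norm (G z) \<partial>lborel)) \<longlonglongrightarrow> ereal (\<integral>z. indicator (square R) z * norm (G z) \<partial>lborel)"
    by (rule tendsto_ereal)
  then show ?thesis
    by (rule LIMSEQ_le_const2)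
      (use perimeter_lower_ge_inner[OF E q G r T \<Omega>] in auto)
qed

text \<open>The lower bound for the minimizer and the upper bound for the competitor are integrals
  over the same square, so comparing perimeters becomes comparing area functionals.\<close>

lemma subgraph_competitor:
  assumes E: "E \<in> sets lebesgue" "AE p in lborel. p \<in> E \<longleftrightarrow> p \<in> lower q" and min: "local_perimeter_minimizer E"
    and q: "C1_deriv q q'" and G: "hgrad q' = G" "bounded_linear G"
    and f: "C1_deriv f f'" and r: "0 < r" "r < R" and fq: "\<And>z. z \<notin> cbox (- r, - r) (r, r) \<Longrightarrow> f z = q z"
  shows "(\<integral>z. indicator (square R) z * norm (G z) \<partial>lborel) \<le> (\<integral>z. indicator (square R) z * norm (hgrad f' z) \<partial>lborel)"
proof -
  let ?D = "cbox (- R, - R) (R, R) :: (real \<times> real) set"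
  have "compact ((\<lambda>z. (q z, f z)) ` ?D)"
    by (intro compact_continuous_image continuous_intros C1_deriv_continuous[OF q] C1_deriv_continuous[OF f] compact_cbox)
  then have "bounded ((\<lambda>z. (q z, f z)) ` ?D)" by (rule compact_imp_bounded)
  then obtain T0 where T0: "T0 > 0" "\<forall>y\<in>(\<lambda>z. (q z, f z)) ` ?D. norm y \<le> T0"
    unfolding bounded_pos by blast
  define T where "T = T0 + 1"
  have T: "T > 0" "\<And>z. z \<in> ?D \<Longrightarrow> \<bar>q z\<bar> < T" "\<And>z. z \<in> ?D \<Longrightarrow> \<bar>f z\<bar> < T"
  proof -
    show "T > 0" using T0 by (simp add: T_def)
    fix z assume "z \<in> ?D"
    then have "norm (q z, f z) \<le> T0" using T0(2) by blast
    then show "\<bar>q z\<bar> < T" "\<bar>f z\<bar> < T"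
      using norm_fst_le[of "q z" "f z"] norm_snd_le[of "f z" "q z"] unfolding T_def real_norm_def by linarith+
  qed
  have sq: "square R \<subseteq> ?D" "cbox (- r, - r) (r, r) \<subseteq> ?D"
    using r by (auto simp: square_def box_Pair_eq cbox_Pair_eq)
  define \<Omega> where "\<Omega> = box (- R, - R, - (T + 1)) (R, R, T + 1)"
  define K where "K = cbox (- r, - r, - T) (r, r, T)"
  \<comment> \<open>\<open>E\<close> is a subgraph only almost everywhere, so it is altered only
    inside \<open>K\<close>; this keeps the symmetric difference relatively compact.\<close>
  define F where "F = (E - K) \<union> (lower f \<inter> K)"
  have lf: "lower f \<in> sets lebesgue"
    using lower_borel[OF C1_deriv_continuous[OF f]] sets_completionI_sets[of "lower f" lborel] by simp
  have K: "K \<in> sets lebesgue"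
    unfolding K_def using sets_completionI_sets[of "cbox _ _" lborel] by simp
  have F: "F \<in> sets lebesgue" unfolding F_def using E(1) lf K by auto
  \<comment> \<open>Outside \<open>K\<close>, either the projection is off the small square, where f
    = q, or |t| exceeds T while both functions stay below T in modulus.\<close>
  have off: "p \<in> lower q \<longleftrightarrow> p \<in> lower f" if "p \<notin> K" for p
  proof (cases "proj p \<in> cbox (- r, - r) (r, r)")
    case True
    then have "proj p \<in> ?D" using sq(2) by blast
    then have "\<bar>q (proj p)\<bar> < T" "\<bar>f (proj p)\<bar> < T" by (rule T)+
    moreover have "snd (snd p) < - T \<or> snd (snd p) > T"
      using that True by (cases p) (auto simp: K_def cbox_Pair_eq)
    ultimately show ?thesis unfolding lower_def mem_Collect_eq by linarith
  qed (simp add: lower_def fq)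
  have F_ae: "AE p in lborel. p \<in> F \<longleftrightarrow> p \<in> lower f"
    using E(2) by eventually_elim (use off in \<open>auto simp: F_def\<close>)
  have "sym_diff E F \<subseteq> K" by (auto simp: F_def)
  then have cl: "closure (sym_diff E F) \<subseteq> K"
    by (rule closure_minimal) (unfold K_def, rule closed_cbox)
  have "compact (closure (sym_diff E F))"
    using compact_Int_closed[OF compact_cbox closed_closure, of "(- r, - r, - T)" "(r, r, T)" "sym_diff E F"] cl
    unfolding K_def by (simp add: Int_absorb1)
  moreover have "K \<subseteq> \<Omega>" using r T(1) by (auto simp: K_def \<Omega>_def box_Pair_eq)
  ultimately have EF: "perimeter E \<Omega> \<le> perimeter F \<Omega>"
    using min loc_finite_perimeter_lower[OF F F_ae f] cl
    unfolding local_perimeter_minimizer_def perimeter_minimizer_in_def \<Omega>_def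
    by (meson bounded_box open_box order_trans)
  have "ereal (\<integral>z. indicator (square R) z * norm (G z) \<partial>lborel) \<le> perimeter E \<Omega>"
    by (rule perimeter_lower_ge[OF E q G _ T(1) _ _ \<Omega>_def]) (use r T sq in auto)
  also note EF
  also have "perimeter F \<Omega> \<le> ereal (\<integral>z. indicator (square R) z * norm (hgrad f' z) \<partial>lborel)"
    by (rule perimeter_lower_le[OF F F_ae f square_facts])
      (auto simp: \<Omega>_def square_def box_Pair_eq)
  finally show ?thesis by simp
qed

definition grad :: "(real \<times> real \<Rightarrow> real \<times> real \<Rightarrow> real) \<Rightarrow> real \<times> real \<Rightarrow> real \<times> real" where
  "grad f' z = (f' z (1, 0), f' z (0, 1))"

text \<open>Multiplying by the sum of the norms turns the difference of norms into one of squares, a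
  polynomial in the step size.\<close>

lemma norm_difference_quotient:
  fixes g v :: "'a::real_inner"
  assumes "g \<noteq> 0"
  shows "(\<lambda>n. real (Suc n) * (norm (g - (1 / real (Suc n)) *\<^sub>R v) - norm g)) \<longlonglongrightarrow> - (g \<bullet> v) / norm g"
proof -
  define s where "s n = 1 / real (Suc n)" for n
  have s: "s \<longlonglongrightarrow> 0" "\<And>n. s n > 0"
    unfolding s_def using LIMSEQ_inverse_real_of_nat by (simp_all add: inverse_eq_divide)
  have eq: "real (Suc n) * (norm (g - s n *\<^sub>R v) - norm g) = (s n * (v \<bullet> v) - 2 * (g \<bullet> v)) / (norm (g - s n *\<^sub>R v) + norm g)" for n
  proof -
    have pos: "norm (g - s n *\<^sub>R v) + norm g > 0" using assms by (simp add: add_nonneg_pos)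
    have "(norm (g - s n *\<^sub>R v) - norm g) * (norm (g - s n *\<^sub>R v) + norm g) = (norm (g - s n *\<^sub>R v))\<^sup>2 - (norm g)\<^sup>2"
      by (simp add: power2_eq_square algebra_simps)
    also have "\<dots> = s n * (s n * (v \<bullet> v) - 2 * (g \<bullet> v))"
      unfolding power2_norm_eq_inner by (simp add: inner_diff_left inner_diff_right inner_commute algebra_simps)
    finally have "norm (g - s n *\<^sub>R v) - norm g = s n * (s n * (v \<bullet> v) - 2 * (g \<bullet> v)) / (norm (g - s n *\<^sub>R v) + norm g)"
      using pos by (simp add: eq_divide_eq)
    moreover have "real (Suc n) * s n = 1" by (simp add: s_def)
    ultimately show ?thesis by (metis (no_types) mult.assoc mult_1 times_divide_eq_right)
  qed
  have "(\<lambda>n. (s n * (v \<bullet> v) - 2 * (g \<bullet> v)) / (norm (g - s n *\<^sub>R v) + norm g))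
    \<longlonglongrightarrow> (0 * (v \<bullet> v) - 2 * (g \<bullet> v)) / (norm (g - 0 *\<^sub>R v) + norm g)"
    using assms by (intro tendsto_intros s) auto
  also have "(0 * (v \<bullet> v) - 2 * (g \<bullet> v)) / (norm (g - 0 *\<^sub>R v) + norm g) = - (g \<bullet> v) / norm g"
    using assms by (simp add: field_simps)
  finally show ?thesis unfolding s_def[symmetric] eq .
qed

lemma C1_deriv_cmult:
  fixes f :: "'a::euclidean_space \<Rightarrow> real"
  shows "C1_deriv f f' \<Longrightarrow> C1_deriv (\<lambda>p. c * f p) (\<lambda>p v. c * f' p v)"
  by (auto simp: C1_deriv_def intro!: has_derivative_mult_right continuous_intros)

text \<open>The area integrand is Lipschitz in the gradient, so the difference quotients are
  dominated by |grad \<phi>|; they converge where G \<noteq> 0, thus almost everywhere. Minimality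
  tested with \<phi> gives one sign, with - \<phi> the other.\<close>

lemma first_variation:
  assumes E: "E \<in> sets lebesgue" "AE p in lborel. p \<in> E \<longleftrightarrow> p \<in> lower q" and min: "local_perimeter_minimizer E"
    and q: "C1_deriv q q'" and G: "hgrad q' = G" "bounded_linear G" "AE z in lborel. G z \<noteq> 0"
    and \<phi>: "C1_deriv \<phi> \<phi>'" and r: "0 < r" "\<And>z. z \<notin> cbox (- r, - r) (r, r) \<Longrightarrow> \<phi> z = 0"
  shows "(\<integral>z. (G z \<bullet> grad \<phi>' z) / norm (G z) \<partial>lborel) = 0"
proof -
  let ?D = "square (r + 1)"
  have Gc: "continuous_on UNIV G" using G(2) by (simp add: linear_continuous_on)
  have le: "(\<integral>z. indicator ?D z * ((G z \<bullet> grad \<phi>' z) / norm (G z)) \<partial>lborel) \<le> 0"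
    if \<phi>: "C1_deriv \<phi> \<phi>'" and off: "\<And>z. z \<notin> cbox (- r, - r) (r, r) \<Longrightarrow> \<phi> z = 0" for \<phi> \<phi>'
  proof -
    let ?s = "\<lambda>n. 1 / real (Suc n)"
    define J where "J n z = indicator ?D z * (real (Suc n) * (norm (G z - ?s n *\<^sub>R grad \<phi>' z) - norm (G z)))" for n z
    have Pc: "continuous_on UNIV (grad \<phi>')"
      unfolding grad_def[abs_def] by (intro continuous_intros C1_deriv_continuous_deriv[OF \<phi>])
    have Jint: "integrable lborel (\<lambda>z. indicator ?D z * norm (G z - s *\<^sub>R grad \<phi>' z))" for s
      by (intro integrable_indicator_bounded square_facts continuous_intros Gc Pc)
    have nonneg: "0 \<le> (\<integral>z. J n z \<partial>lborel)" for n
    proof -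
      have f: "C1_deriv (\<lambda>z. q z + ?s n * \<phi> z) (\<lambda>z v. q' z v + ?s n * \<phi>' z v)"
        by (rule C1_deriv_add[OF q C1_deriv_cmult[OF \<phi>]])
      have "hgrad (\<lambda>z v. q' z v + ?s n * \<phi>' z v) z = G z - ?s n *\<^sub>R grad \<phi>' z" for z
        by (simp add: G(1)[symmetric] hgrad_def grad_def algebra_simps)
      then have "(\<integral>z. indicator ?D z * norm (G z) \<partial>lborel) \<le> (\<integral>z. indicator ?D z * norm (G z - ?s n *\<^sub>R grad \<phi>' z) \<partial>lborel)"
        using subgraph_competitor[OF E min q G(1,2) f r(1), of "r + 1"] off by simp
      then have "0 \<le> real (Suc n) * ((\<integral>z. indicator ?D z * norm (G z - ?s n *\<^sub>R grad \<phi>' z) \<partial>lborel) - (\<integral>z. indicator ?D z * norm (G z) \<partial>lborel))"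
        by (intro mult_nonneg_nonneg) auto
      also have "\<dots> = real (Suc n) * (\<integral>z. indicator ?D z * norm (G z - ?s n *\<^sub>R grad \<phi>' z) - indicator ?D z * norm (G z) \<partial>lborel)"
        using Jint[of "?s n"] Jint[of 0] by (subst Bochner_Integration.integral_diff) auto
      also have "\<dots> = (\<integral>z. real (Suc n) * (indicator ?D z * norm (G z - ?s n *\<^sub>R grad \<phi>' z) - indicator ?D z * norm (G z)) \<partial>lborel)"
        by (rule integral_mult_right_zero[symmetric])
      also have "\<dots> = (\<integral>z. J n z \<partial>lborel)"
        by (rule Bochner_Integration.integral_cong) (simp_all only: J_def right_diff_distrib mult.left_commute)
      finally show ?thesis .
    qed
    have "(\<lambda>n. \<integral>z. J n z \<partial>lborel) \<longlonglongrightarrow> (\<integral>z. indicator ?D z * (- (G z \<bullet> grad \<phi>' z) / norm (G z)) \<partial>lborel)"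
    proof (rule integral_dominated_convergence)
      show "integrable lborel (\<lambda>z. indicator ?D z * norm (grad \<phi>' z))"
        by (intro integrable_indicator_bounded square_facts continuous_intros Pc)
      have [measurable]: "G \<in> borel_measurable borel" "grad \<phi>' \<in> borel_measurable borel" "?D \<in> sets borel"
        using borel_measurable_continuous_onI Gc Pc square_facts by auto
      show "(\<lambda>z. indicator ?D z * (- (G z \<bullet> grad \<phi>' z) / norm (G z))) \<in> borel_measurable lborel"
        by measurable
      show "J n \<in> borel_measurable lborel" for n
        unfolding J_def[abs_def] by measurable
      show "AE z in lborel. norm (J n z) \<le> indicator ?D z * norm (grad \<phi>' z)" for n
      proof (intro AE_I2)
        fix z
        have "\<bar>norm (G z - ?s n *\<^sub>R grad \<phi>' z) - norm (G z)\<bar> \<le> norm (?s n *\<^sub>R grad \<phi>' z)"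
          using norm_triangle_ineq3[of "G z - ?s n *\<^sub>R grad \<phi>' z" "G z"] by simp
        then have "\<bar>real (Suc n) * (norm (G z - ?s n *\<^sub>R grad \<phi>' z) - norm (G z))\<bar> \<le> real (Suc n) * norm (?s n *\<^sub>R grad \<phi>' z)"
          unfolding abs_mult by (intro mult_mono) auto
        also have "\<dots> = norm (grad \<phi>' z)" by simp
        finally show "norm (J n z) \<le> indicator ?D z * norm (grad \<phi>' z)"
          unfolding J_def by (cases "z \<in> ?D") (simp_all del: of_nat_Suc)
      qed
      show "AE z in lborel. (\<lambda>n. J n z) \<longlonglongrightarrow> indicator ?D z * (- (G z \<bullet> grad \<phi>' z) / norm (G z))"
        using G(3) by eventually_elim (unfold J_def, intro tendsto_mult tendsto_const norm_difference_quotient)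
    qed
    then have "0 \<le> (\<integral>z. indicator ?D z * (- (G z \<bullet> grad \<phi>' z) / norm (G z)) \<partial>lborel)"
      by (rule LIMSEQ_le_const) (use nonneg in auto)
    then show ?thesis by simp
  qed
  have neg: "C1_deriv (\<lambda>z. - \<phi> z) (\<lambda>z v. - \<phi>' z v)"
    using \<phi> unfolding C1_deriv_def by (auto intro!: derivative_intros continuous_intros)
  have "grad (\<lambda>z v. - \<phi>' z v) z = - grad \<phi>' z" for z
    by (simp add: grad_def)
  then have "0 \<le> (\<integral>z. indicator ?D z * ((G z \<bullet> grad \<phi>' z) / norm (G z)) \<partial>lborel)"
    using le[OF neg] r(2) by simp
  moreover have "(\<lambda>z. indicator ?D z * ((G z \<bullet> grad \<phi>' z) / norm (G z))) = (\<lambda>z. (G z \<bullet> grad \<phi>' z) / norm (G z))"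
  proof (rule ext)
    fix z
    show "indicator ?D z * ((G z \<bullet> grad \<phi>' z) / norm (G z)) = (G z \<bullet> grad \<phi>' z) / norm (G z)"
    proof (cases "z \<in> ?D")
      case False
      then have "z \<notin> cbox (- r, - r) (r, r)"
        using r(1) by (cases z) (auto simp: mem_square cbox_Pair_eq)
      then show ?thesis
        using C1_deriv_zero_outside[OF \<phi> closed_cbox r(2)] by (simp add: grad_def zero_prod_def[symmetric])
    qed simp
  qed
  ultimately show ?thesis
    using le[OF \<phi> r(2)] by (metis order_antisym)
qed

section \<open>Stationary quadratic graphs\<close>

text \<open>Extension by zero of a formula valid only on \<open>U\<close>, used for cutoffs times G
  / |G|, which is singular at zeros of G.\<close>

lemma C1_deriv_glue:
  assumes "open U" "closed K" "K \<subseteq> U" "\<And>p. p \<notin> K \<Longrightarrow> f p = 0" "\<And>p v. p \<notin> K \<Longrightarrow> f' p v = 0"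
    and "\<And>p. p \<in> U \<Longrightarrow> (f has_derivative f' p) (at p)" "\<And>v. continuous_on U (\<lambda>p. f' p v)"
  shows "C1_deriv f f'"
  unfolding C1_deriv_def
proof (intro conjI allI)
  fix p
  show "(f has_derivative f' p) (at p)"
  proof (cases "p \<in> U")
    case False
    then have p: "p \<in> - K" using assms(3) by auto
    have "f' p = (\<lambda>_. 0)" using assms(5) p by auto
    moreover have "(f has_derivative (\<lambda>_. 0)) (at p)"
      by (rule has_derivative_transform_within_open[of "\<lambda>_. 0" _ _ _ "- K"]) (use assms p in auto)
    ultimately show ?thesis by simp
  qed (rule assms)
  fix v
  have "continuous_on (- K) (\<lambda>p. f' p v)"
    using assms(5) by (auto intro: continuous_on_eq[OF continuous_on_const])
  then have "continuous_on (U \<union> - K) (\<lambda>p. f' p v)"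
    using assms(1,2,7) by (intro continuous_on_open_Un) auto
  moreover have "U \<union> - K = UNIV" using assms(3) by auto
  ultimately show "continuous_on UNIV (\<lambda>p. f' p v)" by simp
qed

lemma integral_plane_deriv:
  fixes h :: "real \<times> real \<Rightarrow> real"
  assumes h: "C1_deriv h h'" and K: "compact K" "\<And>z. z \<notin> K \<Longrightarrow> h z = 0"
  shows "(\<integral>z. h' z (1, 0) \<partial>lborel) = 0" "(\<integral>z. h' z (0, 1) \<partial>lborel) = 0"
    "integrable lborel (\<lambda>z. h' z v)"
proof -
  show int: "integrable lborel (\<lambda>z. h' z v)" for v
    by (rule integrable_continuous_compact_support[OF C1_deriv_continuous_deriv[OF h] K(1)
      C1_deriv_zero_outside[OF h compact_imp_closed[OF K(1)] K(2)]])
  have "(\<integral>x. h' (x, y) (1, 0) \<partial>lborel) = 0" for y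
    using integral_deriv_line(1)[OF h K, of "(1, 0)" "(0, y)"] by (simp add: zero_prod_def)
  then show "(\<integral>z. h' z (1, 0) \<partial>lborel) = 0"
    by (simp add: integral_lborel_prod_snd[OF int])
  have "(\<integral>y. h' (x, y) (0, 1) \<partial>lborel) = 0" for x
    using integral_deriv_line(1)[OF h K, of "(0, 1)" "(x, 0)"] by (simp add: zero_prod_def)
  then show "(\<integral>z. h' z (0, 1) \<partial>lborel) = 0"
    by (simp add: integral_lborel_prod_fst[OF int])
qed

text \<open>The equation div (G / |G|) = 0 in the sense of distributions. Supports in squares match
  the graphical competitors; at zeros of G the quotient takes the value 0.\<close>

definition weakly_stationary :: "(real \<times> real \<Rightarrow> real \<times> real) \<Rightarrow> bool" where
  "weakly_stationary G \<longleftrightarrow> (\<forall>\<phi> \<phi>' r. 0 < r \<longrightarrow> C1_deriv \<phi> \<phi>' \<longrightarrow> (\<forall>z. z \<notin> cbox (- r, - r) (r, r) \<longrightarrow> \<phi> z = 0)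
    \<longrightarrow> (\<integral>z. (G z \<bullet> grad \<phi>' z) / norm (G z) \<partial>lborel) = 0)"

lemma weakly_stationaryD:
  assumes "weakly_stationary G" "C1_deriv \<phi> \<phi>'" "bounded K" "\<And>z. z \<notin> K \<Longrightarrow> \<phi> z = 0"
  shows "(\<integral>z. (G z \<bullet> grad \<phi>' z) / norm (G z) \<partial>lborel) = 0"
proof -
  obtain r where r: "r > 0" "\<And>z. z \<in> K \<Longrightarrow> norm z \<le> r"
    using assms(3) unfolding bounded_pos by auto
  have "z \<notin> K" if "z \<notin> cbox (- r, - r) (r, r)" for z
  proof
    assume "z \<in> K"
    then have "norm z \<le> r" by (rule r(2))
    then have "\<bar>fst z\<bar> \<le> r" "\<bar>snd z\<bar> \<le> r"
      using norm_fst_le[of "fst z" "snd z"] norm_snd_le[of "snd z" "fst z"] by auto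
    then show False using that by (cases z) (auto simp: cbox_Pair_eq abs_le_iff)
  qed
  then show ?thesis
    using assms r(1) unfolding weakly_stationary_def by blast
qed

text \<open>Horizontal mean curvature (up to sign) of the graph, at a non-characteristic point.\<close>

definition curvature :: "(real \<times> real \<Rightarrow> real \<times> real) \<Rightarrow> real \<times> real \<Rightarrow> real" where
  "curvature G z = (fst (G (1, 0)) + snd (G (0, 1))) / norm (G z)
    - (fst (G z) * (G z \<bullet> G (1, 0)) + snd (G z) * (G z \<bullet> G (0, 1))) / norm (G z) ^ 3"

lemma unit_normal_deriv:
  assumes G: "bounded_linear G" and z: "G z \<noteq> 0"
  shows "((\<lambda>z. G z /\<^sub>R norm (G z)) has_derivative
    (\<lambda>v. G v /\<^sub>R norm (G z) - ((G z \<bullet> G v) / norm (G z) ^ 3) *\<^sub>R G z)) (at z)"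
proof -
  have G': "(G has_derivative G) (at z)"
    using bounded_linear.has_derivative[OF G has_derivative_ident] by simp
  have "((\<lambda>z. norm (G z)) has_derivative (\<lambda>v. G v \<bullet> sgn (G z))) (at z)"
    using has_derivative_compose[OF G' has_derivative_norm[OF z]] .
  moreover have "norm (G z) \<noteq> 0" using z by simp
  ultimately have "((\<lambda>z. inverse (norm (G z))) has_derivative
      (\<lambda>v. - (inverse (norm (G z)) ^ Suc (Suc 0)) * (G v \<bullet> sgn (G z)))) (at z)"
    by (intro has_derivative_compose[OF _ DERIV_inverse[unfolded has_field_derivative_def]])
  from has_derivative_scaleR[OF this G'] show ?thesis
    by (rule has_derivative_eq_rhs)
      (auto simp: fun_eq_iff sgn_div_norm inner_commute power3_eq_cube field_simps)
qed

text \<open>Away from zeros of G the weak equation can be integrated by parts. A nonzero curvature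
  would keep its sign on a small box, where a nonnegative bump then gives a nonzero
  integral.\<close>

lemma weakly_stationary_curvature:
  assumes G: "bounded_linear G" and st: "weakly_stationary G" and z0: "G z0 \<noteq> 0"
  shows "curvature G z0 = 0"
proof (rule ccontr)
  assume "curvature G z0 \<noteq> 0"
  \<comment> \<open>The sign makes the curvature positive, and half its modulus leaves room for a
    uniform bound near \<open>z0\<close>.\<close>
  define \<sigma> where "\<sigma> = sgn (curvature G z0)"
  define d where "d = \<bar>curvature G z0\<bar> / 2"
  define U where "U = {z. G z \<noteq> 0}"
  have d: "d > 0" "\<sigma> * curvature G z0 > d"
    using \<open>curvature G z0 \<noteq> 0\<close> by (auto simp: d_def \<sigma>_def sgn_if)
  have Gc: "continuous_on A G" for A by (rule linear_continuous_on[OF G])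
  have U: "open U"
    unfolding U_def by (intro open_Collect_neq Gc continuous_on_const)
  have curv: "continuous_on U (curvature G)"
    unfolding curvature_def[abs_def] by (intro continuous_intros Gc) (auto simp: U_def)
  have "open (U \<inter> (\<lambda>z. \<sigma> * curvature G z) -` {d<..})"
    by (intro continuous_open_preimage continuous_intros curv U open_greaterThan)
  then obtain l u where lu: "cbox l u \<subseteq> U \<inter> (\<lambda>z. \<sigma> * curvature G z) -` {d<..}" "z0 \<in> box l u"
    by (rule open_contains_cbox[of _ z0]) (use z0 d in \<open>auto simp: U_def\<close>)
  obtain l1 l2 u1 u2 where lu12: "l = (l1, l2)" "u = (u1, u2)" by (cases l, cases u)
  have less: "l1 < fst z0" "fst z0 < u1" "l2 < snd z0" "snd z0 < u2"
    using lu(2) by (cases z0; simp add: lu12 box_Pair_eq)+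
  obtain f f1 f2 where f: "C2_supp l1 u1 f f1 f2" "integral\<^sup>L lborel f > 0" "\<And>x. 0 \<le> f x" "f (fst z0) > 0"
    using C2_bump[OF less(1,2)] by metis
  obtain g g1 g2 where g: "C2_supp l2 u2 g g1 g2" "integral\<^sup>L lborel g > 0" "\<And>x. 0 \<le> g x" "g (snd z0) > 0"
    using C2_bump[OF less(3,4)] by metis
  define \<phi> where "\<phi> z = f (fst z) * g (snd z)" for z
  define \<phi>' where "\<phi>' z v = f (fst z) * (g1 (snd z) * snd v) + (f1 (fst z) * fst v) * g (snd z)" for z v :: "real \<times> real"
  have \<phi>: "C1_deriv \<phi> \<phi>'"
    unfolding \<phi>_def[abs_def] \<phi>'_def[abs_def]
    by (intro C1_deriv_mult C1_deriv_compose_functional C2_suppD[OF f(1)] C2_suppD[OF g(1)] bounded_linear_fst bounded_linear_snd)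
  have off: "\<phi> z = 0" if "z \<notin> cbox l u" for z
    using that C2_suppD(6)[OF f(1), of "fst z"] C2_suppD(6)[OF g(1), of "snd z"]
    by (cases z) (auto simp: \<phi>_def lu12 cbox_Pair_eq)
  have off': "\<phi>' z v = 0" if "z \<notin> cbox l u" for z v
    by (rule C1_deriv_zero_outside[OF \<phi> closed_cbox off that])
  define N where "N z = G z /\<^sub>R norm (G z)" for z
  define N' where "N' z v = G v /\<^sub>R norm (G z) - ((G z \<bullet> G v) / norm (G z) ^ 3) *\<^sub>R G z" for z v
  have KU: "cbox l u \<subseteq> U" using lu(1) by auto
  have N': "(N has_derivative N' z) (at z)" if "z \<in> U" for z
    using unit_normal_deriv[OF G, of z] that unfolding N_def[abs_def] N'_def[abs_def] U_def by auto
  have N'c: "continuous_on U (\<lambda>z. N' z v)" "continuous_on U N" for v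
    unfolding N'_def N_def[abs_def] by (intro continuous_intros Gc; auto simp: U_def)+
  have c: "continuous_on A \<phi>" "continuous_on A (\<lambda>z. \<phi>' z v)" for A v
    by (rule C1_deriv_continuous[OF \<phi>], rule C1_deriv_continuous_deriv[OF \<phi>])
  have h1: "C1_deriv (\<lambda>z. \<phi> z * fst (N z)) (\<lambda>z v. \<phi> z * fst (N' z v) + \<phi>' z v * fst (N z))"
    by (rule C1_deriv_glue[OF U closed_cbox KU])
      (auto simp: off off' intro!: has_derivative_mult C1_derivD[OF \<phi>] has_derivative_fst N' continuous_intros N'c c)
  have h2: "C1_deriv (\<lambda>z. \<phi> z * snd (N z)) (\<lambda>z v. \<phi> z * snd (N' z v) + \<phi>' z v * snd (N z))"
    by (rule C1_deriv_glue[OF U closed_cbox KU])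
      (auto simp: off off' intro!: has_derivative_mult C1_derivD[OF \<phi>] has_derivative_snd N' continuous_intros N'c c)
  have hz1: "\<phi> z * fst (N z) = 0" and hz2: "\<phi> z * snd (N z) = 0" if "z \<notin> cbox l u" for z
    using off[OF that] by auto
  note I1 = integral_plane_deriv[OF h1 compact_cbox[of l u] hz1] and I2 = integral_plane_deriv[OF h2 compact_cbox[of l u] hz2]
  have "(\<integral>z. (\<phi> z * fst (N' z (1, 0)) + \<phi>' z (1, 0) * fst (N z)) + (\<phi> z * snd (N' z (0, 1)) + \<phi>' z (0, 1) * snd (N z)) \<partial>lborel) = 0"
    using I1(1) I2(2) I1(3)[of "(1, 0)"] I2(3)[of "(0, 1)"] by simp
  \<comment> \<open>Product rule: div (\<phi> N) is \<phi> div N plus the pairing of N with grad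
    \<phi>, and div N is the curvature.\<close>
  moreover have "(\<phi> z * fst (N' z (1, 0)) + \<phi>' z (1, 0) * fst (N z)) + (\<phi> z * snd (N' z (0, 1)) + \<phi>' z (0, 1) * snd (N z))
      = \<phi> z * curvature G z + (G z \<bullet> grad \<phi>' z) / norm (G z)" for z
    by (simp add: N_def N'_def curvature_def grad_def inner_prod_def divide_inverse algebra_simps)
  ultimately have sum: "(\<integral>z. \<phi> z * curvature G z + (G z \<bullet> grad \<phi>' z) / norm (G z) \<partial>lborel) = 0"
    by simp
  have Kint: "integrable lborel (\<lambda>z. indicator (cbox l u) z *\<^sub>R (\<phi> z * curvature G z))"
    using curv KU by (intro borel_integrable_compact compact_cbox continuous_intros c) (auto intro: continuous_on_subset)
  have Kint': "integrable lborel (\<lambda>z. indicator (cbox l u) z *\<^sub>R ((G z \<bullet> grad \<phi>' z) / norm (G z)))"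
    unfolding grad_def using KU
    by (intro borel_integrable_compact compact_cbox continuous_intros c Gc) (auto simp: U_def)
  have e: "(\<lambda>z. indicator (cbox l u) z *\<^sub>R (\<phi> z * curvature G z)) = (\<lambda>z. \<phi> z * curvature G z)"
    using off by (auto simp: indicator_def fun_eq_iff)
  have e': "(\<lambda>z. indicator (cbox l u) z *\<^sub>R ((G z \<bullet> grad \<phi>' z) / norm (G z))) = (\<lambda>z. (G z \<bullet> grad \<phi>' z) / norm (G z))"
    using off' by (auto simp: indicator_def fun_eq_iff grad_def zero_prod_def[symmetric])
  have "(\<integral>z. (G z \<bullet> grad \<phi>' z) / norm (G z) \<partial>lborel) = 0"
    by (rule weakly_stationaryD[OF st \<phi> bounded_cbox off])
  then have zero: "(\<integral>z. \<phi> z * curvature G z \<partial>lborel) = 0"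
    using sum Bochner_Integration.integral_add[OF Kint[unfolded e] Kint'[unfolded e']] by simp
  have \<phi>int: "integrable lborel \<phi>"
    by (rule integrable_continuous_compact_support[OF c(1) compact_cbox off])
  have "d * (integral\<^sup>L lborel f * integral\<^sup>L lborel g) = (\<integral>z. d * \<phi> z \<partial>lborel)"
    by (simp add: integral_lborel_prod_fst[OF \<phi>int]) (simp add: \<phi>_def)
  also have "\<dots> \<le> (\<integral>z. \<sigma> * (\<phi> z * curvature G z) \<partial>lborel)"
  proof (rule integral_mono)
    show "integrable lborel (\<lambda>z. d * \<phi> z)" "integrable lborel (\<lambda>z. \<sigma> * (\<phi> z * curvature G z))"
      using \<phi>int Kint[unfolded e] by auto
    show "d * \<phi> z \<le> \<sigma> * (\<phi> z * curvature G z)" for z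
    proof (cases "z \<in> cbox l u")
      case True
      then have "d \<le> \<sigma> * curvature G z" using lu(1) by force
      moreover have "0 \<le> \<phi> z" by (simp add: \<phi>_def f g)
      ultimately have "d * \<phi> z \<le> \<sigma> * curvature G z * \<phi> z" by (rule mult_right_mono)
      then show ?thesis by (simp add: ac_simps)
    qed (simp add: off)
  qed
  also have "\<dots> = 0" using zero by simp
  finally show False using d(1) f(2) g(2) by (simp add: mult_le_0_iff not_le[symmetric])
qed

text \<open>Almost everywhere \<open>sgn\<close> is 1 minus twice the indicator of the nonpositive
  half-line; the first part integrates to zero and the second gives the jump.\<close>

lemma integral_sgn_deriv:
  assumes f: "C2_supp a b f f1 f2"
  shows "(\<integral>s. sgn s * f1 s \<partial>lborel) = - 2 * f 0" "integrable lborel (\<lambda>s. sgn s * f1 s)"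
proof -
  note fd = integral_deriv_compact_support[OF C2_suppD(1)[OF f] C2_suppD(4)[OF f] compact_Icc C2_suppD(6)[OF f]]
  have i: "integrable lborel f1" "integrable lborel (\<lambda>s. indicator {..0} s * f1 s)"
    by (rule integrable_continuous_compact_support[OF C2_suppD(4)[OF f] compact_Icc C2_suppD(7)[OF f]], assumption)
      (rule integrable_indicator_compact_support[OF C2_suppD(4)[OF f] compact_Icc C2_suppD(7)[OF f]], auto)
  have m: "(\<lambda>s. sgn s * f1 s) \<in> borel_measurable lborel"
    using borel_measurable_continuous_onI[OF C2_suppD(4)[OF f]] by measurable
  have ae: "AE s in lborel. f1 s - 2 * (indicator {..0} s * f1 s) = sgn s * f1 s"
    using AE_lborel_singleton[of 0] by eventually_elim (auto simp: indicator_def sgn_if)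
  have int: "integrable lborel (\<lambda>s. f1 s - 2 * (indicator {..0} s * f1 s))"
    using i by auto
  show "integrable lborel (\<lambda>s. sgn s * f1 s)"
    using integrable_cong_AE[OF borel_measurable_integrable[OF int] m ae] int by simp
  have "(\<integral>s. sgn s * f1 s \<partial>lborel) = (\<integral>s. f1 s - 2 * (indicator {..0} s * f1 s) \<partial>lborel)"
    by (rule integral_cong_AE[OF m borel_measurable_integrable[OF int]]) (use ae in eventually_elim, simp)
  also have "\<dots> = - 2 * f 0"
    using i fd by simp
  finally show "(\<integral>s. sgn s * f1 s \<partial>lborel) = - 2 * f 0" .
qed

text \<open>The jump of the unit normal across the characteristic line is detected by \<open>\<phi> = f (L z) * f y\<close>,
  for which the integral over \<open>x\<close> depends on \<open>y\<close> only through \<open>f\<close> and its derivative.\<close>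

lemma weakly_stationary_rank_one:
  fixes u :: "real \<times> real"
  assumes l: "l1 \<noteq> 0" and u: "u \<noteq> 0"
    and st: "weakly_stationary (\<lambda>z. (l1 * fst z + l2 * snd z) *\<^sub>R u)"
  shows "l1 * fst u + l2 * snd u = 0"
proof -
  obtain f f1 f2 where f: "C2_supp (-1) 1 f f1 f2" "integral\<^sup>L lborel f > 0" "\<And>x. 0 \<le> f x" "f 0 > 0"
    using C2_bump[of "-1" 0 1] by auto
  define L where "L z = l1 * fst z + l2 * snd z" for z
  define \<phi> where "\<phi> z = f (L z) * f (snd z)" for z
  define \<phi>' where "\<phi>' z v = f (L z) * (f1 (snd z) * snd v) + (f1 (L z) * L v) * f (snd z)" for z v :: "real \<times> real"
  have L: "bounded_linear L"
    unfolding L_def[abs_def] by (intro bounded_linear_intros)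
  have \<phi>: "C1_deriv \<phi> \<phi>'"
    unfolding \<phi>_def[abs_def] \<phi>'_def[abs_def]
    by (intro C1_deriv_mult C1_deriv_compose_functional C2_suppD[OF f(1)] L bounded_linear_snd)
  \<comment> \<open>From |L z| \<le> 1 and |y| \<le> 1 follows |l1 x| \<le> 1 + |l2|.\<close>
  define r where "r = (1 + \<bar>l2\<bar>) / \<bar>l1\<bar>"
  define K where "K = cbox (- r, - 1) (r, 1 :: real)"
  have off: "\<phi> z = 0" if "z \<notin> K" for z
  proof (rule ccontr)
    assume "\<phi> z \<noteq> 0"
    then have "L z \<in> {-1..1}" "snd z \<in> {-1..1}"
      using C2_suppD(6)[OF f(1)] unfolding \<phi>_def by force+
    then have 1: "\<bar>L z\<bar> \<le> 1" "\<bar>snd z\<bar> \<le> 1" by auto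
    have "\<bar>l1 * fst z\<bar> = \<bar>L z - l2 * snd z\<bar>" by (simp add: L_def)
    also have "\<dots> \<le> \<bar>L z\<bar> + \<bar>l2\<bar> * \<bar>snd z\<bar>"
      using abs_triangle_ineq4[of "L z" "l2 * snd z"] by (simp add: abs_mult)
    also have "\<dots> \<le> 1 + \<bar>l2\<bar> * 1"
      using 1 by (intro add_mono mult_left_mono) auto
    finally have "\<bar>fst z\<bar> \<le> r"
      using l by (simp add: r_def abs_mult field_simps)
    then show False using that 1 by (cases z) (auto simp: K_def cbox_Pair_eq)
  qed
  have cL: "continuous_on A L" for A by (rule linear_continuous_on[OF L])
  \<comment> \<open>\<open>M\<close> is the derivative of \<phi> along \<open>u\<close>; the unit
    normal is sgn (L z) times u / |u|.\<close>
  define M where "M z = f1 (L z) * (L u * f (snd z)) + f (L z) * (snd u * f1 (snd z))" for z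
  have gr: "u \<bullet> grad \<phi>' z = M z" for z
    by (simp add: grad_def \<phi>'_def M_def inner_prod_def L_def algebra_simps)
  have Mc: "continuous_on UNIV M"
    unfolding M_def[abs_def]
    by (intro continuous_intros continuous_on_compose2[OF C2_suppD(3)[OF f(1), of UNIV]]
      continuous_on_compose2[OF C2_suppD(4)[OF f(1), of UNIV]] cL) auto
  have M0: "M z = 0" if "z \<notin> K" for z
    using C1_deriv_zero_outside[OF \<phi> _ off that] unfolding gr[symmetric] K_def grad_def
    by (simp add: closed_cbox zero_prod_def[symmetric])
  have int: "integrable lborel (\<lambda>z. sgn (L z) * M z)"
  proof -
    have "integrable lborel (\<lambda>z. indicator {z. L z > 0} z * M z - indicator {z. L z < 0} z * M z)"
      using Mc M0 unfolding K_def
      by (intro Bochner_Integration.integrable_diff integrable_indicator_compact_support[OF _ compact_cbox])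
        (auto intro!: borel_open open_Collect_less cL continuous_intros)
    moreover have "indicator {z. L z > 0} z * M z - indicator {z. L z < 0} z * M z = sgn (L z) * M z" for z
      by (auto simp: indicator_def sgn_if)
    ultimately show ?thesis by simp
  qed
  have "(((l1 * fst z + l2 * snd z) *\<^sub>R u) \<bullet> grad \<phi>' z) / norm ((l1 * fst z + l2 * snd z) *\<^sub>R u) = sgn (L z) * M z / norm u" for z
    by (simp add: gr[symmetric] L_def[symmetric] sgn_real_def abs_if)
  then have "(\<integral>z. sgn (L z) * M z / norm u \<partial>lborel) = 0"
    using weakly_stationaryD[OF st \<phi>, of K] off by (simp add: K_def)
  then have "0 = (\<integral>z. sgn (L z) * M z \<partial>lborel)"
    using u by simp
  also have "\<dots> = (\<integral>y. (\<integral>x. sgn (L (x, y)) * M (x, y) \<partial>lborel) \<partial>lborel)"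
    by (rule integral_lborel_prod_snd[OF int])
  \<comment> \<open>At fixed y, substitute s = l1 x + l2 y, which contributes the factor 1 / |l1|.
    The jump of \<open>sgn\<close> at s = 0 yields - 2 f 0.\<close>
  also have "\<dots> = (\<integral>y. (- 2 * f 0 * (L u * f y) + (\<integral>s. sgn s * f s \<partial>lborel) * (snd u * f1 y)) / \<bar>l1\<bar> \<partial>lborel)"
  proof (rule Bochner_Integration.integral_cong[OF refl])
    fix y :: real
    define F where "F s = (sgn s * f1 s) * (L u * f y) + (sgn s * f s) * (snd u * f1 y)" for s
    have sf: "integrable lborel (\<lambda>s. sgn s * f s)"
    proof (rule Bochner_Integration.integrable_bound[OF C2_supp_integrable[OF f(1)]])
      show "(\<lambda>s. sgn s * f s) \<in> borel_measurable lborel"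
        using borel_measurable_continuous_onI[OF C2_suppD(3)[OF f(1)]] by measurable
    qed (auto simp: abs_mult sgn_if)
    have "(\<integral>s. F s \<partial>lborel) = \<bar>l1\<bar> *\<^sub>R (\<integral>x. F (l2 * y + l1 * x) \<partial>lborel)"
      by (rule lborel_integral_real_affine[OF l])
    moreover have "F (l2 * y + l1 * x) = sgn (L (x, y)) * M (x, y)" for x
      by (simp add: F_def M_def L_def algebra_simps)
    moreover have "(\<integral>s. F s \<partial>lborel) = - 2 * f 0 * (L u * f y) + (\<integral>s. sgn s * f s \<partial>lborel) * (snd u * f1 y)"
      unfolding F_def using integral_sgn_deriv[OF f(1)] sf by simp
    ultimately show "(\<integral>x. sgn (L (x, y)) * M (x, y) \<partial>lborel)
      = (- 2 * f 0 * (L u * f y) + (\<integral>s. sgn s * f s \<partial>lborel) * (snd u * f1 y)) / \<bar>l1\<bar>"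
      using l by (simp add: field_simps)
  qed
  \<comment> \<open>The term with f1 y integrates to zero, so a nonzero multiple of L u is
    left.\<close>
  also have "\<dots> = - 2 * f 0 * L u * integral\<^sup>L lborel f / \<bar>l1\<bar>"
  proof -
    have "integrable lborel f1"
      by (rule integrable_continuous_compact_support[OF C2_suppD(4)[OF f(1)] compact_Icc C2_suppD(7)[OF f(1)]])
    moreover have "integral\<^sup>L lborel f1 = 0"
      by (rule integral_deriv_compact_support(1)[OF C2_suppD(1)[OF f(1)] C2_suppD(4)[OF f(1)] compact_Icc C2_suppD(6)[OF f(1)]])
    ultimately show ?thesis
      using C2_supp_integrable[OF f(1)] by simp
  qed
  finally have "L u = 0" using f(2,4) l by simp
  then show ?thesis by (simp add: L_def)
qed

text \<open>The rank-one argument integrates along x and divides by the x-coefficient; reflection in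
  the diagonal covers the case in which only the second row has a nonzero diagonal entry.\<close>

lemma weakly_stationary_swap:
  assumes G: "bounded_linear G" and st: "weakly_stationary G"
  shows "weakly_stationary (\<lambda>z. prod.swap (G (prod.swap z)))"
  unfolding weakly_stationary_def
proof (intro allI impI)
  fix \<phi> :: "real \<times> real \<Rightarrow> real" and \<phi>' and r :: real
  assume r: "0 < r" and \<phi>: "C1_deriv \<phi> \<phi>'" and off: "\<forall>z. z \<notin> cbox (- r, - r) (r, r) \<longrightarrow> \<phi> z = 0"
  define \<psi> where "\<psi> z = \<phi> (prod.swap z)" for z
  define \<psi>' where "\<psi>' z v = \<phi>' (prod.swap z) (prod.swap v)" for z v
  have sw: "bounded_linear (prod.swap :: real \<times> real \<Rightarrow> _)"
    unfolding prod.swap_def by (intro bounded_linear_intros)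
  have \<psi>: "C1_deriv \<psi> \<psi>'"
    unfolding C1_deriv_def
  proof (intro conjI allI)
    fix p :: "real \<times> real"
    have "(prod.swap has_derivative prod.swap) (at p)"
      using bounded_linear.has_derivative[OF sw has_derivative_ident] by simp
    from has_derivative_compose[OF this C1_derivD[OF \<phi>]]
    show "(\<psi> has_derivative \<psi>' p) (at p)" by (simp add: \<psi>_def[abs_def] \<psi>'_def[abs_def])
    show "continuous_on UNIV (\<lambda>p. \<psi>' p v)" for v
      unfolding \<psi>'_def by (intro C1_deriv_continuous_joint[OF \<phi>] linear_continuous_on[OF sw] continuous_on_const)
  qed
  define H where "H z = (prod.swap (G (prod.swap z)) \<bullet> grad \<phi>' z) / norm (prod.swap (G (prod.swap z)))" for z
  have Gc: "continuous_on UNIV G" by (rule linear_continuous_on[OF G])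
  have [measurable]: "G \<in> borel_measurable borel" "prod.swap \<in> borel \<rightarrow>\<^sub>M (borel :: (real \<times> real) measure)"
    "grad \<phi>' \<in> borel_measurable borel"
    unfolding grad_def[abs_def]
    by (intro borel_measurable_continuous_onI Gc linear_continuous_on[OF sw] continuous_intros C1_deriv_continuous_deriv[OF \<phi>])+
  have "H \<in> borel_measurable (lborel \<Otimes>\<^sub>M lborel)"
    unfolding H_def[abs_def] lborel_prod by measurable
  from lborel_pair.integral_product_swap[OF this]
  have "(\<integral>z. H z \<partial>lborel) = (\<integral>z. H (prod.swap z) \<partial>lborel)"
    by (simp add: lborel_prod split_def prod.swap_def)
  also have "\<dots> = (\<integral>z. (G z \<bullet> grad \<psi>' z) / norm (G z) \<partial>lborel)"
    by (rule Bochner_Integration.integral_cong)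
      (auto simp: H_def grad_def \<psi>'_def inner_prod_def norm_prod_def prod.swap_def add.commute)
  also have "\<dots> = 0"
  proof (rule weakly_stationaryD[OF st \<psi> bounded_cbox])
    show "\<psi> z = 0" if "z \<notin> cbox (- r, - r) (r, r)" for z
      using off that by (cases z) (auto simp: \<psi>_def cbox_Pair_eq)
  qed
  finally show "(\<integral>z. (prod.swap (G (prod.swap z)) \<bullet> grad \<phi>' z) / norm (prod.swap (G (prod.swap z))) \<partial>lborel) = 0"
    by (simp add: H_def)
qed

section \<open>Which quadrics are stationary\<close>

definition quadric :: "real \<Rightarrow> real \<Rightarrow> real \<Rightarrow> real \<times> real \<Rightarrow> real" where
  "quadric a b c z = a * (fst z)\<^sup>2 + b * fst z * snd z + c * (snd z)\<^sup>2"

text \<open>A linear map with trace - 2 (a + c) and determinant 4 a c + 1 - b^2; these two numbers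
  govern the classification.\<close>

definition quadric_hgrad :: "real \<Rightarrow> real \<Rightarrow> real \<Rightarrow> real \<times> real \<Rightarrow> real \<times> real" where
  "quadric_hgrad a b c z = (- 2 * a * fst z + (1 - b) * snd z, - (1 + b) * fst z - 2 * c * snd z)"

lemma quadric_deriv:
  obtains q' where "C1_deriv (quadric a b c) q'" "hgrad q' = quadric_hgrad a b c"
proof
  let ?q' = "\<lambda>z v. (2 * a * fst z + b * snd z) * fst v + (b * fst z + 2 * c * snd z) * snd v :: real"
  show "C1_deriv (quadric a b c) ?q'"
    unfolding C1_deriv_def quadric_def[abs_def]
    by (auto intro!: derivative_eq_intros continuous_intros simp: algebra_simps power2_eq_square)
  show "hgrad ?q' = quadric_hgrad a b c"
    by (auto simp: hgrad_def quadric_hgrad_def algebra_simps)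
qed

lemma bounded_linear_quadric_hgrad: "bounded_linear (quadric_hgrad a b c)"
  unfolding quadric_hgrad_def[abs_def] by (intro bounded_linear_intros)

lemma quadric_hgrad_AE_nonzero: "AE z in lborel. quadric_hgrad a b c z \<noteq> 0"
proof -
  \<comment> \<open>The entries 1 - b and - (1 + b) cannot both vanish, so one row is nonzero, and
    all zeros lie on the line orthogonal to it.\<close>
  define n where "n = (if b = 1 then (- (1 + b), - 2 * c) else (- 2 * a, 1 - b))"
  have "n \<noteq> 0" by (auto simp: n_def zero_prod_def)
  then have "negligible {z. n \<bullet> z = 0}" by (intro negligible_hyperplane) auto
  moreover have "{z. n \<bullet> z = 0} \<in> sets lborel" by (simp add: closed_hyperplane borel_closed)
  ultimately have "{z. n \<bullet> z = 0} \<in> null_sets lborel"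
    by (simp add: negligible_iff_null_sets null_sets_completion_iff)
  then show ?thesis
    by (rule AE_I') (auto simp: n_def quadric_hgrad_def zero_prod_def inner_prod_def)
qed

lemma quadric_weakly_stationary:
  assumes st: "weakly_stationary (quadric_hgrad a b c)"
  shows "a = 0 \<and> b = 0 \<and> c = 0 \<or> c = - a \<and> 4 * a\<^sup>2 + b\<^sup>2 = 1"
proof -
  let ?G = "quadric_hgrad a b c"
  define D where "D = 4 * a * c + (1 - b\<^sup>2)"
  show ?thesis
  proof (cases "D = 0")
    case False
    \<comment> \<open>The inverse by Cramer's rule: every vector is a value of G.\<close>
    have surj: "?G (((- 2 * c) * g1 - (1 - b) * g2) / D, ((1 + b) * g1 + (- 2 * a) * g2) / D) = (g1, g2)" for g1 g2
    proof -
      have "(- 2 * a) * ((- 2 * c) * g1 - (1 - b) * g2) + (1 - b) * ((1 + b) * g1 + (- 2 * a) * g2) = D * g1"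
        "- (1 + b) * ((- 2 * c) * g1 - (1 - b) * g2) - 2 * c * ((1 + b) * g1 + (- 2 * a) * g2) = D * g2"
        by (simp_all add: D_def algebra_simps power2_eq_square)
      then show ?thesis
        using False unfolding quadric_hgrad_def fst_conv snd_conv times_divide_eq_right
          add_divide_distrib[symmetric] diff_divide_distrib[symmetric] by simp
    qed
    have curv: "curvature ?G z = 0" if "?G z \<noteq> 0" for z
      by (rule weakly_stationary_curvature[OF bounded_linear_quadric_hgrad st that])
    have aux: "A * n\<^sup>2 = B" if "A / n - B / n ^ 3 = 0" "n \<noteq> 0" for A B n :: real
    proof -
      have "A * n\<^sup>2 = (A / n) * n ^ 3" using that(2) by (simp add: power2_eq_square power3_eq_cube)
      also have "\<dots> = (B / n ^ 3) * n ^ 3" using that(1) by simp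
      finally show ?thesis using that(2) by simp
    qed
    \<comment> \<open>In terms of the value (g1, g2) of G, the curvature equation is an identity
      between quadratic forms; evaluation at three vectors determines all coefficients.\<close>
    have *: "(- 2 * a - 2 * c) * (g1\<^sup>2 + g2\<^sup>2) = - 2 * a * g1\<^sup>2 - 2 * b * g1 * g2 - 2 * c * g2\<^sup>2" if "(g1, g2) \<noteq> 0" for g1 g2
    proof -
      obtain z where z: "?G z = (g1, g2)" using surj by blast
      have n: "norm (g1, g2) \<noteq> 0" using that by simp
      have "(- 2 * a - 2 * c) / norm (g1, g2) - (g1 * (- 2 * a * g1 - (1 + b) * g2) + g2 * ((1 - b) * g1 - 2 * c * g2)) / norm (g1, g2) ^ 3 = 0"
        using curv[of z] that by (simp add: curvature_def z) (simp add: quadric_hgrad_def algebra_simps)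
      then have "(- 2 * a - 2 * c) * (norm (g1, g2))\<^sup>2 = g1 * (- 2 * a * g1 - (1 + b) * g2) + g2 * ((1 - b) * g1 - 2 * c * g2)"
        by (rule aux[OF _ n])
      moreover have "(norm (g1, g2))\<^sup>2 = g1\<^sup>2 + g2\<^sup>2" by (simp add: norm_Pair)
      ultimately show ?thesis by (simp add: algebra_simps power2_eq_square)
    qed
    from *[of 1 0] *[of 0 1] *[of 1 1] show ?thesis by (simp add: zero_prod_def)
  next
    case True
    then have det: "b\<^sup>2 = 1 + 4 * a * c" by (simp add: D_def)
    consider "a \<noteq> 0" | "a = 0" "c \<noteq> 0" | "a = 0" "c = 0" by blast
    then have "c = - a"
    proof cases
      case 1
      \<comment> \<open>The ratio of the rows of the singular matrix: G is the first row, as a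
        functional L, times u = (1, k). Since (1 - b) k = - 2 c, the condition L u = 0 says that the
        trace vanishes.\<close>
      define k where "k = (1 + b) / (2 * a)"
      have k: "k * (1 - b) = - 2 * c" "k * (- 2 * a) = - (1 + b)"
        using 1 det by (simp_all add: k_def field_simps power2_eq_square)
      have "?G = (\<lambda>z. ((- 2 * a) * fst z + (1 - b) * snd z) *\<^sub>R (1, k))"
      proof
        fix z
        have "((- 2 * a) * fst z + (1 - b) * snd z) * k = (k * (- 2 * a)) * fst z + (k * (1 - b)) * snd z"
          by (simp add: algebra_simps)
        then show "?G z = ((- 2 * a) * fst z + (1 - b) * snd z) *\<^sub>R (1, k)"
          unfolding k by (simp add: quadric_hgrad_def)
      qed
      with st have "weakly_stationary (\<lambda>z. ((- 2 * a) * fst z + (1 - b) * snd z) *\<^sub>R (1, k))" by simp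
      from weakly_stationary_rank_one[OF _ _ this] have "(- 2 * a) * 1 + (1 - b) * k = 0"
        using 1 by (simp add: zero_prod_def)
      then show ?thesis using k(1) by (simp add: mult.commute)
    next
      case 2
      \<comment> \<open>With a = 0 the determinant gives b^2 = 1, and the tangency condition then
        forces c = 0; so this case is contradictory.\<close>
      have "(\<lambda>z. prod.swap (?G (prod.swap z))) = (\<lambda>z. ((- 2 * c) * fst z + (- (1 + b)) * snd z) *\<^sub>R (1, - (1 - b) / (2 * c)))"
      proof
        fix z
        have "(1 - b) * (1 + b) = 0" using 2 det by (simp add: algebra_simps power2_eq_square)
        then show "prod.swap (?G (prod.swap z)) = ((- 2 * c) * fst z + (- (1 + b)) * snd z) *\<^sub>R (1, - (1 - b) / (2 * c))"
          using 2 by (simp add: quadric_hgrad_def prod.swap_def field_simps)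
      qed
      with weakly_stationary_swap[OF bounded_linear_quadric_hgrad st]
      have "weakly_stationary (\<lambda>z. ((- 2 * c) * fst z + (- (1 + b)) * snd z) *\<^sub>R (1, - (1 - b) / (2 * c)))"
        by metis
      from weakly_stationary_rank_one[OF _ _ this] have "(- 2 * c) * 1 + (- (1 + b)) * (- (1 - b) / (2 * c)) = 0"
        using 2 by (simp add: zero_prod_def)
      then show ?thesis using 2 det by (simp add: field_simps power2_eq_square)
    qed simp
    then show ?thesis using det by (simp add: power2_eq_square)
  qed
qed

text \<open>A trace-free form a (x^2 - y^2) + b x y turns by twice the angle of a rotation of the
  plane, so the unit vector (- b, 2 a) = (cos \<psi>, sin \<psi>) is reached from the saddle - x y
  by the angle \<psi> / 2.\<close>

lemma rotated_saddle:
  assumes "4 * a\<^sup>2 + b\<^sup>2 = 1"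
  shows "\<exists>\<theta>. {(x, y, t). t = a * x\<^sup>2 + b * x * y - a * y\<^sup>2} = rot \<theta> ` {(x, y, t). t = - x * y}"
proof -
  have "(- b)\<^sup>2 + (2 * a)\<^sup>2 = 1" using assms by (simp add: power2_eq_square)
  then obtain \<psi> where \<psi>: "- b = cos \<psi>" "2 * a = sin \<psi>"
    using sincos_total_2pi by metis
  define \<theta> where "\<theta> = \<psi> / 2"
  let ?c = "cos \<theta>" and ?s = "sin \<theta>"
  have ab: "a = ?s * ?c" "b = ?s\<^sup>2 - ?c\<^sup>2"
    using \<psi> sin_double[of \<theta>] cos_double[of \<theta>] by (simp_all add: \<theta>_def)
  have cs: "?c * ?c + ?s * ?s = 1" using sin_cos_squared_add3[of \<theta>] by simp
  have *: "a * x\<^sup>2 + b * x * y - a * y\<^sup>2 = - (?c * x + ?s * y) * (- ?s * x + ?c * y)" for x y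
    unfolding ab by (simp add: power2_eq_square algebra_simps)
  have inv: "?c * (?c * x + ?s * y) - ?s * (- ?s * x + ?c * y) = x" "?s * (?c * x + ?s * y) + ?c * (- ?s * x + ?c * y) = y"
    "?c * (?c * x - ?s * y) + ?s * (?s * x + ?c * y) = x" "- ?s * (?c * x - ?s * y) + ?c * (?s * x + ?c * y) = y" for x y
  proof -
    have "(?c * ?c + ?s * ?s) * x = x" "(?c * ?c + ?s * ?s) * y = y" by (simp_all add: cs)
    then show "?c * (?c * x + ?s * y) - ?s * (- ?s * x + ?c * y) = x" "?s * (?c * x + ?s * y) + ?c * (- ?s * x + ?c * y) = y"
    "?c * (?c * x - ?s * y) + ?s * (?s * x + ?c * y) = x" "- ?s * (?c * x - ?s * y) + ?c * (?s * x + ?c * y) = y"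
      by (simp_all only: distrib_left distrib_right right_diff_distrib left_diff_distrib mult_minus_left minus_mult_right) (simp_all add: algebra_simps)
  qed
  have "{(x, y, t). t = a * x\<^sup>2 + b * x * y - a * y\<^sup>2} = rot \<theta> ` {(x, y, t). t = - x * y}"
  proof (intro equalityI subsetI)
    fix p assume "p \<in> {(x, y, t). t = a * x\<^sup>2 + b * x * y - a * y\<^sup>2}"
    then obtain x y t where p: "p = (x, y, t)" "t = a * x\<^sup>2 + b * x * y - a * y\<^sup>2" by auto
    have "p = rot \<theta> (?c * x + ?s * y, - ?s * x + ?c * y, t)"
      unfolding p(1) rot.simps inv ..
    then show "p \<in> rot \<theta> ` {(x, y, t). t = - x * y}"
      unfolding p(2) * by (rule image_eqI) (simp only: mem_Collect_eq case_prod_conv)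
  next
    fix p assume "p \<in> rot \<theta> ` {(x, y, t). t = - x * y}"
    then obtain x y where "p = rot \<theta> (x, y, - x * y)" by auto
    then show "p \<in> {(x, y, t). t = a * x\<^sup>2 + b * x * y - a * y\<^sup>2}"
      unfolding * rot.simps by (simp only: mem_Collect_eq case_prod_conv inv)
  qed
  then show ?thesis by blast
qed

section \<open>Minimal cones\<close>

lemma closed_measure_support: "closed (measure_support \<mu>)"
proof -
  have "- measure_support \<mu> = \<Union>{U. open U \<and> \<not> emeasure \<mu> U > 0}"
    by (auto simp: measure_support_def)
  then have "open (- measure_support \<mu>)" by auto
  then show ?thesis by (simp add: closed_def)
qed

text \<open>By sign symmetry all test integrals vanish, so the zero-one alternative applies on a box
  around \<open>p\<close>.\<close>

lemma perimeter_zero_imp_locally_trivial: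
  assumes E: "E \<in> sets lebesgue" and B: "B \<in> sets borel" "AE p in lborel. p \<in> E \<longleftrightarrow> p \<in> B"
    and N: "open N" "p \<in> N" "perimeter E N \<le> 0"
  shows "\<exists>U. open U \<and> p \<in> U \<and> (emeasure lborel (U \<inter> B) = 0 \<or> emeasure lborel (U - B) = 0)"
proof -
  obtain l u where bx: "cbox l u \<subseteq> N" "p \<in> box l u" "\<forall>i\<in>Basis. l \<bullet> i < u \<bullet> i"
    by (rule open_contains_cbox[OF N(1,2)])
  obtain l1 l2 l3 u1 u2 u3 where lu3: "l = (l1, l2, l3)" "u = (u1, u2, u3)" by (cases l, cases u)
  have le: "(\<integral>p. indicator B p * hdiv V p \<partial>lborel) \<le> 0" if V: "V \<in> test_fields N" for V
  proof -
    have "ereal (LINT p:E|lebesgue. hdiv V p) \<le> 0"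
      using LINT_le_perimeter[OF V, of E] N(3) by (rule order_trans)
    then show ?thesis
      using LINT_lebesgue_eq_lborel[OF E B hdiv_borel[OF V]] by simp
  qed
  interpret perimeter_free_box B N l1 l2 l3 u1 u2 u3
  proof
    show "(\<integral>p. indicator B p * hdiv V p \<partial>lborel) = 0" if V: "V \<in> test_fields N" for V
      using le[OF V] le[OF uminus_test_fields(1)[OF V]] by (simp add: uminus_test_fields(2)[OF V])
    show "cbox (l1, l2, l3) (u1, u2, u3) \<subseteq> N" using bx(1) by (simp add: lu3)
    show "l1 < u1" "l2 < u2" "l3 < u3"
      using bx(2) by (cases p; simp add: lu3 box_Pair_eq)+
  qed (rule B)
  show ?thesis
    using zero_one bx(2) unfolding lu3 by (intro exI[of _ "box (l1, l2, l3) (u1, u2, u3)"]) auto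
qed

text \<open>Lindelof's theorem leaves countably many of the null neighbourhoods.\<close>

lemma emeasure_zero_of_locally_zero:
  fixes A C :: "'a::euclidean_space set"
  assumes A: "open A" and C: "C \<in> sets borel"
    and loc: "\<And>p. p \<in> A \<Longrightarrow> \<exists>U. open U \<and> p \<in> U \<and> emeasure lborel (U \<inter> C) = 0"
  shows "emeasure lborel (A \<inter> C) = 0"
proof -
  let ?F = "{U. open U \<and> emeasure lborel (U \<inter> C) = 0}"
  obtain F where F: "F \<subseteq> ?F" "countable F" "\<Union>F = \<Union>?F"
    using Lindelof[of ?F] by (metis (no_types, lifting) mem_Collect_eq)
  have n: "(\<Union>U\<in>F. U \<inter> C) \<in> null_sets lborel"
    using F(1,2) C by (intro null_sets_UN') (auto intro!: null_setsI)
  have s: "A \<inter> C \<subseteq> (\<Union>U\<in>F. U \<inter> C)"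
    using loc F(3) by blast
  have "A \<inter> C \<in> sets lborel" using A C by simp
  from null_sets_subset[OF n this s] show ?thesis by auto
qed

text \<open>The open sets null for \<open>B\<close> and those null for its complement have unions
  that cover \<open>A\<close>. These unions are disjoint, because a nonempty open set is not null,
  so connectedness leaves one of them.\<close>

lemma zero_one_connected:
  fixes A B :: "'a::euclidean_space set"
  assumes A: "open A" "connected A" and B: "B \<in> sets borel"
    and loc: "\<And>p. p \<in> A \<Longrightarrow> \<exists>U. open U \<and> p \<in> U \<and> (emeasure lborel (U \<inter> B) = 0 \<or> emeasure lborel (U - B) = 0)"
  shows "emeasure lborel (A \<inter> B) = 0 \<or> emeasure lborel (A - B) = 0"
proof -
  have B': "- B \<in> sets borel" using B by simp
  define P where "P C = \<Union>{U. open U \<and> emeasure lborel (U \<inter> C) = 0}" for C :: "'a set"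
  have P: "open (P C)" for C by (auto simp: P_def)
  have cover: "A \<subseteq> P B \<union> P (- B)" using loc unfolding P_def Diff_eq by blast
  have disj: "P B \<inter> P (- B) = {}"
  proof (rule ccontr)
    assume "P B \<inter> P (- B) \<noteq> {}"
    then obtain p U U' where U: "open U" "p \<in> U" "emeasure lborel (U \<inter> B) = 0"
      and U': "open U'" "p \<in> U'" "emeasure lborel (U' \<inter> - B) = 0"
      unfolding P_def by blast
    have "U \<inter> B \<in> null_sets lborel" "U' \<inter> - B \<in> null_sets lborel"
      using U U' B by (auto intro!: null_setsI)
    then have n: "(U \<inter> B) \<union> (U' \<inter> - B) \<in> null_sets lborel" by (rule null_sets.Un)
    have "U \<inter> U' \<in> sets lborel" using U(1) U'(1) by simp
    then have "U \<inter> U' \<in> null_sets lborel"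
      by (rule null_sets_subset[OF n]) blast
    then have "U \<inter> U' \<in> null_sets lebesgue"
      by (rule null_sets_completionI)
    then have "negligible (U \<inter> U')"
      by (simp add: negligible_iff_null_sets)
    then show False
      using open_not_negligible[of "U \<inter> U'"] U U' by auto
  qed
  have "P B \<inter> A = {} \<or> P (- B) \<inter> A = {}"
    using A(2) P cover disj unfolding connected_def by blast
  then have "A \<subseteq> P (- B) \<or> A \<subseteq> P B" using cover by blast
  then show ?thesis
  proof
    assume "A \<subseteq> P (- B)"
    then show ?thesis
      using emeasure_zero_of_locally_zero[OF A(1) B'] unfolding P_def Diff_eq by blast
  next
    assume "A \<subseteq> P B"
    then show ?thesis
      using emeasure_zero_of_locally_zero[OF A(1) B] unfolding P_def by blast
  qed
qed

text \<open>A shear maps half-spaces, which are convex, onto the two sides of the graph.\<close>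

lemma connected_subgraphs:
  assumes q: "continuous_on UNIV q"
  shows "connected {p :: heis. snd (snd p) < q (proj p)}" "connected {p :: heis. q (proj p) < snd (snd p)}"
proof -
  let ?sh = "\<lambda>p :: heis. (fst p, fst (snd p), snd (snd p) + q (proj p))"
  have cont: "continuous_on A ?sh" for A
    by (intro continuous_intros continuous_on_compose2[OF q]) auto
  have lin: "linear (\<lambda>p :: heis. snd (snd p))"
    by (intro linearI) auto
  have conv: "convex {p :: heis. snd (snd p) < 0}" "convex {p :: heis. 0 < snd (snd p)}"
    using convex_linear_vimage[OF lin convex_real_interval(4)[of 0]] convex_linear_vimage[OF lin convex_real_interval(3)[of 0]]
    by (simp_all add: vimage_def lessThan_def greaterThan_def)
  have c: "connected (?sh ` {p :: heis. snd (snd p) < 0})" "connected (?sh ` {p :: heis. 0 < snd (snd p)})"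
    by (rule connected_continuous_image[OF cont convex_connected[OF conv(1)]],
      rule connected_continuous_image[OF cont convex_connected[OF conv(2)]])
  have "p \<in> ?sh ` Z" if "(fst p, fst (snd p), snd (snd p) - q (proj p)) \<in> Z" for p Z
    using that by (intro image_eqI[of _ _ "(fst p, fst (snd p), snd (snd p) - q (proj p))"]) (auto simp: proj_def)
  then have "?sh ` {p :: heis. snd (snd p) < 0} = {p. snd (snd p) < q (proj p)}"
    "?sh ` {p :: heis. 0 < snd (snd p)} = {p. q (proj p) < snd (snd p)}"
    by (fastforce simp: proj_def)+
  with c show "connected {p :: heis. snd (snd p) < q (proj p)}" "connected {p :: heis. q (proj p) < snd (snd p)}"
    by simp_all
qed

lemma graph_AE:
  assumes q: "C1_deriv q q'"
  shows "AE p in lborel. snd (snd p) \<noteq> q (proj p)"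
proof -
  have "(\<lambda>z. (fst z, snd z, q z)) differentiable_on UNIV"
    unfolding differentiable_on_def
  proof
    fix z
    have "((\<lambda>z. (fst z, snd z, q z)) has_derivative (\<lambda>v. (fst v, snd v, q' z v))) (at z)"
      by (intro has_derivative_Pair has_derivative_fst has_derivative_snd has_derivative_ident C1_derivD[OF q])
    then show "(\<lambda>z. (fst z, snd z, q z)) differentiable (at z)"
      unfolding differentiable_def by blast
  qed
  then have "negligible ((\<lambda>z. (fst z, snd z, q z)) ` UNIV)"
    by (intro negligible_differentiable_image_lowdim) auto
  moreover have "(\<lambda>z. (fst z, snd z, q z)) ` UNIV = {p. snd (snd p) = q (proj p)}"
    by (auto simp: proj_def image_iff)
  moreover have "{p. snd (snd p) = q (proj p)} \<in> sets lborel"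
    by (simp, intro borel_closed closed_Collect_eq continuous_intros
        continuous_on_compose2[OF C1_deriv_continuous[OF q, of UNIV]]) auto
  ultimately have "{p. snd (snd p) = q (proj p)} \<in> null_sets lborel"
    by (simp add: negligible_iff_null_sets null_sets_completion_iff)
  then show ?thesis by (rule AE_I') auto
qed

lemma perimeter_zero_of_null:
  assumes "E \<in> sets lebesgue" "AE p in lborel. p \<notin> E"
  shows "perimeter E \<Omega> \<le> 0"
  unfolding perimeter_def
proof (rule SUP_least)
  fix V assume V: "V \<in> test_fields \<Omega>"
  have "AE p in lborel. p \<in> E \<longleftrightarrow> p \<in> {}" using assms(2) by simp
  from LINT_lebesgue_eq_lborel[OF assms(1) _ this hdiv_borel[OF V]]
  show "ereal (LINT p:E|lebesgue. hdiv V p) \<le> 0" by simp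
qed

lemma minimal_quadric_weakly_stationary:
  assumes "minimal_surface S" and S: "S = {(x, y, t). t = quadric a b c (x, y)}"
  shows "weakly_stationary (quadric_hgrad a b c)"
proof -
  obtain E \<mu> where E: "loc_finite_perimeter E" "local_perimeter_minimizer E" "is_perimeter_measure E \<mu>"
    and S\<mu>: "S = measure_support \<mu>" and "S \<noteq> {}"
    using assms(1) unfolding minimal_surface_def by blast
  have EL: "E \<in> sets lebesgue" using E(1) by (simp add: loc_finite_perimeter_def)
  have pm: "enn2ereal (emeasure \<mu> \<Omega>) = perimeter E \<Omega>" if "open \<Omega>" for \<Omega>
    using E(3) that unfolding is_perimeter_measure_def by blast
  \<comment> \<open>A Borel representative of \<open>E\<close>, as the arguments on boxes
    require.\<close>
  define B where "B = main_part lborel E"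
  have B: "B \<in> sets borel" using main_part_sets[OF EL] by (simp add: B_def)
  have EB: "AE p in lborel. p \<in> E \<longleftrightarrow> p \<in> B"
    using AE_in_main_part[OF EL] unfolding B_def by (auto elim!: eventually_mono)
  let ?q = "quadric a b c"
  obtain q' where q: "C1_deriv ?q q'" and hq: "hgrad q' = quadric_hgrad a b c"
    by (rule quadric_deriv)
  have qc: "continuous_on A ?q" for A by (rule C1_deriv_continuous[OF q])
  have loc: "\<exists>U. open U \<and> p \<in> U \<and> (emeasure lborel (U \<inter> B) = 0 \<or> emeasure lborel (U - B) = 0)"
    if "snd (snd p) \<noteq> ?q (proj p)" for p
  proof -
    have "p \<notin> measure_support \<mu>" using that S S\<mu> by (cases p) auto
    then obtain N where N: "open N" "p \<in> N" "emeasure \<mu> N = 0"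
      unfolding measure_support_def by auto
    then have "perimeter E N \<le> 0"
      using pm[OF N(1)] by (simp add: N(3) zero_ennreal.rep_eq)
    then show ?thesis using perimeter_zero_imp_locally_trivial[OF EL B EB N(1,2)] by blast
  qed
  define A1 A2 :: "heis set" where "A1 = {p. snd (snd p) < ?q (proj p)}" and "A2 = {p. ?q (proj p) < snd (snd p)}"
  have op: "open A1" "open A2"
    unfolding A1_def A2_def by (intro open_Collect_less continuous_intros continuous_on_compose2[OF qc[of UNIV]]; simp)+
  have zo1: "emeasure lborel (A1 \<inter> B) = 0 \<or> emeasure lborel (A1 - B) = 0"
    by (rule zero_one_connected[OF op(1) _ B loc])
      (use connected_subgraphs[OF qc] in \<open>auto simp: A1_def\<close>)
  have zo2: "emeasure lborel (A2 \<inter> B) = 0 \<or> emeasure lborel (A2 - B) = 0"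
    by (rule zero_one_connected[OF op(2) _ B loc])
      (use connected_subgraphs[OF qc] in \<open>auto simp: A2_def\<close>)
  have AE_null: "AE p in lborel. p \<notin> C" if "emeasure lborel C = 0" "C \<in> sets borel" for C :: "heis set"
    using that by (intro AE_not_in null_setsI) auto
  \<comment> \<open>A nonempty support means positive perimeter; this excludes that \<open>E\<close>
    or its complement is null.\<close>
  have nontrivial: "\<not> perimeter E UNIV \<le> 0"
  proof
    assume "perimeter E UNIV \<le> 0"
    then have "enn2ereal (emeasure \<mu> UNIV) \<le> 0"
      using pm[OF open_UNIV] by simp
    then have "\<not> emeasure \<mu> UNIV > 0"
      by (simp add: less_ennreal.rep_eq zero_ennreal.rep_eq)
    then have "S = {}" unfolding S\<mu> measure_support_def by blast
    with \<open>S \<noteq> {}\<close> show False by simp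
  qed
  have m: "A1 \<inter> B \<in> sets borel" "A1 - B \<in> sets borel" "A2 \<inter> B \<in> sets borel" "A2 - B \<in> sets borel"
    using op B by auto
  have compl: "- E \<in> sets lebesgue"
    using sets.compl_sets[OF EL] by (simp add: Compl_eq_Diff_UNIV)
  note graph = graph_AE[OF q]
  have lower: "p \<in> lower ?q \<longleftrightarrow> p \<in> A1" "p \<in> A1 \<or> p \<in> A2" "\<not> (p \<in> A1 \<and> p \<in> A2)" if "snd (snd p) \<noteq> ?q (proj p)" for p
    using that by (auto simp: lower_def A1_def A2_def)
  have conclude: "weakly_stationary (quadric_hgrad a b c)"
    if F: "F \<in> sets lebesgue" "local_perimeter_minimizer F" "AE p in lborel. p \<in> F \<longleftrightarrow> p \<in> lower ?q" for F
    unfolding weakly_stationary_def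
    using first_variation[OF F(1,3,2) q hq bounded_linear_quadric_hgrad quadric_hgrad_AE_nonzero] by blast
  \<comment> \<open>The alternative on each side of the graph gives four cases: two trivial ones,
    the subgraph, and its complement, which is treated by passing to \<open>- E\<close>.\<close>
  consider "emeasure lborel (A1 \<inter> B) = 0" "emeasure lborel (A2 \<inter> B) = 0"
    | "emeasure lborel (A1 - B) = 0" "emeasure lborel (A2 - B) = 0"
    | "emeasure lborel (A1 - B) = 0" "emeasure lborel (A2 \<inter> B) = 0"
    | "emeasure lborel (A1 \<inter> B) = 0" "emeasure lborel (A2 - B) = 0"
    using zo1 zo2 by blast
  then show ?thesis
  proof cases
    case 1
    have "AE p in lborel. p \<notin> E"
      using AE_null[OF 1(1) m(1)] AE_null[OF 1(2) m(3)] EB graph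
      by eventually_elim (use lower in blast)
    then show ?thesis using perimeter_zero_of_null[OF EL] nontrivial by blast
  next
    case 2
    have "AE p in lborel. p \<notin> - E"
      using AE_null[OF 2(1) m(2)] AE_null[OF 2(2) m(4)] EB graph
      by eventually_elim (use lower in blast)
    then show ?thesis using perimeter_zero_of_null[OF compl] perimeter_Compl[OF EL] nontrivial by metis
  next
    case 3
    have "AE p in lborel. p \<in> E \<longleftrightarrow> p \<in> lower ?q"
      using AE_null[OF 3(1) m(2)] AE_null[OF 3(2) m(3)] EB graph
      by eventually_elim (use lower in blast)
    then show ?thesis by (rule conclude[OF EL E(2)])
  next
    case 4
    have "AE p in lborel. p \<in> - E \<longleftrightarrow> p \<in> lower ?q"
      using AE_null[OF 4(1) m(1)] AE_null[OF 4(2) m(4)] EB graph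
      by eventually_elim (use lower in blast)
    then show ?thesis by (rule conclude[OF compl local_perimeter_minimizer_Compl[OF E(2) EL]])
  qed
qed

theorem theorem1p3:
  fixes S :: "heis set"
  assumes "minimal_cone S" and "Ck_surface 2 S"
  shows "vertical_plane S \<or> S = {(x, y, t). t = 0} \<or>
    (\<exists>\<theta>. S = rot \<theta> ` {(x, y, t). t = - x * y})"
proof -
  have S: "minimal_surface S" "is_cone S" "S \<noteq> {}" "closed S"
    using assms(1) closed_measure_support by (auto simp: minimal_cone_def minimal_surface_def)
  from C2_cone_cases[OF S(4,2,3) assms(2)] show ?thesis
  proof (elim disjE exE)
    fix a b c assume *: "S = {(x, y, t). t = a * x\<^sup>2 + b * x * y + c * y\<^sup>2}"
    then have "weakly_stationary (quadric_hgrad a b c)"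
      by (intro minimal_quadric_weakly_stationary[OF S(1)]) (simp add: quadric_def)
    from quadric_weakly_stationary[OF this] show ?thesis
    proof (elim disjE conjE)
      assume "c = - a" "4 * a\<^sup>2 + b\<^sup>2 = 1"
      then show ?thesis using rotated_saddle[of a b] unfolding * by simp
    qed (simp add: *)
  qed simp
qed

end
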